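(* Every real nilpotent Lie algebra of dimension $\leq 10$ is $T^*$-solitary. In particular, any ad-invariant metric on a real nilpotent Lie algebra of dimension $\leq 10$ is solitary.
   Context: A metric on a real Lie algebra $\mathfrak g$ is a nondegenerate symmetric bilinear form $g$; it is ad-invariant if $g([X,Y],Z)=-g(Y,[X,Z])$ for all $X,Y,Z\in\mathfrak g$. A linear map $\phi\colon\mathfrak g\to\mathfrak g$ is ad-invariant if $\phi([X,Y])=[X,\phi(Y)]$ for all $X,Y$. For a linear map $f$, $f^{*_g}$ denotes its adjoint with respect to $g$. An ad-invariant metric $g$ is solitary if every ad-invariant $g$-self-adjoint linear map $\phi\colon\mathfrak g\to\mathfrak g$ can be written as $\phi=D+D^{*_g}$ for some derivation $D$ of $\mathfrak g$. For a linear map $\phi\colon\mathfrak g\to\mathfrak g^*$: its transpose is ${}^t\phi\colon\mathfrak g\to\mathfrak g^*$, ${}^t\phi(X)(Y)=\phi(Y)(X)$; $\phi$ is symmetric if $\phi={}^t\phi$; $\phi$ is ad-invariant if $\phi([X,Y])(Z)=-\phi(Y)([X,Z])$ for all $X,Y,Z\in\mathfrak g$. A linear map $D\colon\mathfrak g\to\mathfrak g^*$ is a derivation if $D([X,Y])(Z)=D(X)([Y,Z])-D(Y)([X,Z])$ for all $X,Y,Z\in\mathfrak g$. $\mathfrak g$ is $T^*$-solitary if every ad-invariant symmetric linear map $\phi\colon\mathfrak g\to\mathfrak g^*$ can be written as $\phi=D+{}^tD$ for some derivation $D\colon\mathfrak g\to\mathfrak g^*$. *)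

theory Defs
  imports "HOL-Analysis.Analysis"
begin

text \<open>The carrier is a whole type of class \<open>real_vector\<close>. Unlike \<open>euclidean_space\<close>, this class
  allows the zero space and does not single out an inner product; finite dimensionality has to
  be assumed explicitly.\<close>

locale lie_algebra =
  fixes br :: "'a::real_vector \<Rightarrow> 'a \<Rightarrow> 'a"
  assumes bilinear_br: "bilinear br"
    and br_self: "br X X = 0"
    and jacobi: "br X (br Y Z) + br Y (br Z X) + br Z (br X Y) = 0"

primrec lower_central_series :: "('a::real_vector \<Rightarrow> 'a \<Rightarrow> 'a) \<Rightarrow> nat \<Rightarrow> 'a set" where
  "lower_central_series br 0 = UNIV"
| "lower_central_series br (Suc n) = span {br X Y | X Y. Y \<in> lower_central_series br n}"

definition nilpotent_lie :: "('a::real_vector \<Rightarrow> 'a \<Rightarrow> 'a) \<Rightarrow> bool" where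
  "nilpotent_lie br \<longleftrightarrow> (\<exists>n. lower_central_series br n = {0})"

definition lie_derivation :: "('a::real_vector \<Rightarrow> 'a \<Rightarrow> 'a) \<Rightarrow> ('a \<Rightarrow> 'a) \<Rightarrow> bool" where
  "lie_derivation br D \<longleftrightarrow> linear D \<and> (\<forall>X Y. D (br X Y) = br (D X) Y + br X (D Y))"

definition ad_invariant_map :: "('a::real_vector \<Rightarrow> 'a \<Rightarrow> 'a) \<Rightarrow> ('a \<Rightarrow> 'a) \<Rightarrow> bool" where
  "ad_invariant_map br \<phi> \<longleftrightarrow> (\<forall>X Y. \<phi> (br X Y) = br X (\<phi> Y))"


subsection \<open>Maps into the dual\<close>

text \<open>A linear map from the algebra to its dual is represented by its curried form
  \<open>\<phi> :: 'a \<Rightarrow> 'a \<Rightarrow> real\<close>; linearity of \<open>\<phi>\<close> together with linearity of each value \<open>\<phi> X\<close> is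
  \<open>bilinear \<phi>\<close>. In this form ad-invariance of a metric and ad-invariance of a linear map into
  the dual are literally the same equation.\<close>

definition ad_invariant_form :: "('a::real_vector \<Rightarrow> 'a \<Rightarrow> 'a) \<Rightarrow> ('a \<Rightarrow> 'a \<Rightarrow> real) \<Rightarrow> bool" where
  "ad_invariant_form br \<phi> \<longleftrightarrow> (\<forall>X Y Z. \<phi> (br X Y) Z = - \<phi> Y (br X Z))"

definition dual_transpose :: "('a \<Rightarrow> 'a \<Rightarrow> real) \<Rightarrow> 'a \<Rightarrow> 'a \<Rightarrow> real" where
  "dual_transpose \<phi> = (\<lambda>X Y. \<phi> Y X)"

definition dual_derivation :: "('a::real_vector \<Rightarrow> 'a \<Rightarrow> 'a) \<Rightarrow> ('a \<Rightarrow> 'a \<Rightarrow> real) \<Rightarrow> bool" where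
  "dual_derivation br D \<longleftrightarrow>
     bilinear D \<and> (\<forall>X Y Z. D (br X Y) Z = D X (br Y Z) - D Y (br X Z))"

definition Tstar_solitary :: "('a::real_vector \<Rightarrow> 'a \<Rightarrow> 'a) \<Rightarrow> bool" where
  "Tstar_solitary br \<longleftrightarrow>
     (\<forall>\<phi>. bilinear \<phi> \<and> ad_invariant_form br \<phi> \<and> \<phi> = dual_transpose \<phi> \<longrightarrow>
        (\<exists>D. dual_derivation br D \<and> \<phi> = (\<lambda>X Y. D X Y + dual_transpose D X Y)))"


subsection \<open>Metrics\<close>

definition metric_form :: "('a::real_vector \<Rightarrow> 'a \<Rightarrow> real) \<Rightarrow> bool" where
  "metric_form g \<longleftrightarrow>
     bilinear g \<and> (\<forall>X Y. g X Y = g Y X) \<and> (\<forall>X. (\<forall>Y. g X Y = 0) \<longrightarrow> X = 0)"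

text \<open>On a finite-dimensional space with a metric \<open>g\<close>, the adjoint of a linear map exists; it is
  unique and linear by nondegeneracy.\<close>

definition metric_adjoint :: "('a::real_vector \<Rightarrow> 'a \<Rightarrow> real) \<Rightarrow> ('a \<Rightarrow> 'a) \<Rightarrow> 'a \<Rightarrow> 'a" where
  "metric_adjoint g f = (THE h. \<forall>X Y. g (f X) Y = g X (h Y))"

definition solitary :: "('a::real_vector \<Rightarrow> 'a \<Rightarrow> 'a) \<Rightarrow> ('a \<Rightarrow> 'a \<Rightarrow> real) \<Rightarrow> bool" where
  "solitary br g \<longleftrightarrow>
     metric_form g \<and> ad_invariant_form br g \<and>
     (\<forall>\<phi>. linear \<phi> \<and> ad_invariant_map br \<phi> \<and> metric_adjoint g \<phi> = \<phi> \<longrightarrow>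
        (\<exists>D. lie_derivation br D \<and> \<phi> = (\<lambda>X. D X + metric_adjoint g D X)))"

end

theory Submission
  imports Defs
begin

text \<open>Let \<open>\<omega> X Y Z = \<phi> (br X Y) Z\<close>. Writing \<open>D = (\<phi> + \<sigma>) / 2\<close> with \<open>\<sigma>\<close> skew, \<open>D\<close> is a derivation
  exactly when \<open>\<omega>\<close> is the differential of the 2-form \<open>\<sigma>\<close>, so one has to show that the closed 3-form
  \<open>\<omega>\<close> is exact. Let \<open>Z\<close> be the kernel of \<open>\<omega>\<close>, that is the orthogonal space of the derived algebra \<open>G\<close>,
  let \<open>W\<close> be a complement of \<open>G \<inter> Z\<close> in \<open>G\<close> and \<open>k\<close> the codimension of \<open>G + Z\<close>. Then \<open>\<phi>\<close> is
  nondegenerate on \<open>W\<close>, and \<open>2 * k + dim W \<le> 10\<close> since \<open>dim Z\<close> is at least the codimension of \<open>G\<close>.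

  The algebra acts on \<open>W\<close> by a jointly nilpotent family of skew maps. In dimension at most 4 a nonzero
  family of this kind consists of the maps \<open>p \<mapsto> \<langle>v, p\<rangle> e\<^sub>t - \<langle>e\<^sub>t, p\<rangle> v\<close> for one isotropic \<open>v\<close> in the
  common kernel. This leaves few normal forms of \<open>\<omega>\<close>, with \<open>k \<in> {2, 3, 4}\<close>. In each of them \<open>\<omega>\<close> is a
  linear combination of two kinds of exact forms: the product of a closed 1-form with a contraction of \<open>\<omega>\<close>,
  and the antisymmetrised product of \<open>\<phi> q\<close> with the contraction of \<open>\<omega>\<close> by \<open>p\<close>.\<close>

subsection \<open>Nilpotent families of skew maps\<close>

text \<open>The bound 10 enters only through \<open>2 * k + dim W\<close>. For \<open>k = 4\<close>
  it leaves \<open>dim W \<le> 2\<close>, where the family is zero; for \<open>k = 3\<close> it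
  leaves 4, where one isotropic line controls it; for \<open>k = 2\<close> it leaves 6, beyond the
  reach of the classification. There the plane of an isotropic kernel vector \<open>v\<close> and of
  the projected bracket \<open>w\<close> of the two generators is split off, and the classification
  is applied to its orthogonal complement. What tames small \<open>k\<close> is a second constraint:
  a nonzero common kernel vector pairs nontrivially with some bracket of two generators
  (\<open>generated\<close>), so \<open>k \<le> 1\<close> forces \<open>W = 0\<close> and
  \<open>k = 2\<close> leaves a common kernel of dimension at most one. Exactness is linear algebra
  on forms modulo exact ones. Wedging each closed coordinate with the contraction of \<omega> by its
  own generator, and summing, is an Euler operator: it multiplies a product of covectors by the
  number of its closed factors. The wedges of two covectors \<open>\<phi> p\<close> and
  \<open>\<phi> q\<close> supply further relations, and together they leave a nonzero multiple of a
  single class.\<close>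

lemma not_in_span_functional:
  fixes f :: "'a::real_vector \<Rightarrow> real"
  assumes "linear f" "\<And>t. t \<in> T \<Longrightarrow> f t = 0" "f x \<noteq> 0"
  shows "x \<notin> span T"
  using real_vector.linear_eq_0_on_span[OF assms(1), of T x] assms by blast

lemma span_disjoint_Int:
  fixes B :: "'a::real_vector set"
  assumes B: "independent B" and CD: "C \<subseteq> B" "D \<subseteq> B" "C \<inter> D = {}" and p: "p \<in> span C" "p \<in> span D"
  shows "p = 0"
proof -
  have iC: "independent C" using B CD real_vector.independent_mono by blast
  have 1: "representation B p = representation C p" "representation B p = representation D p"
    using real_vector.representation_extend[OF B] p CD by blast+
  have "representation C p b = 0" for b
    using 1 CD real_vector.representation_ne_zero[of C p b] real_vector.representation_ne_zero[of D p b]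
    by (metis IntI empty_iff)
  then show ?thesis using real_vector.sum_nonzero_representation_eq[OF iC p(1)] by simp
qed

lemma independent_card_empty: "independent ({} :: 'a::real_vector set) \<and> finite ({} :: 'a set) \<and> card ({} :: 'a set) = 0"
  by (simp add: real_vector.independent_empty)

text \<open>Kept as one conjunction so that insertions chain with \<open>OF\<close>: the dimension
  counts below add vectors one at a time, each separated from the span of the earlier ones, often by
  a functional \<open>\<phi> v\<close>.\<close>

lemma independent_card_insert:
  assumes "independent T \<and> finite T \<and> card T = n" "x \<notin> span T"
  shows "independent (insert x T) \<and> finite (insert x T) \<and> card (insert x T) = Suc n"
proof -
  have "x \<notin> T" using assms(2) real_vector.span_base by blast
  then show ?thesis using assms real_vector.independent_insertI[of x T] by simp
qed

text \<open>The argument behind Engel's theorem: if every \<open>f\<close> outside \<open>T\<close>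
  had a \<open>t\<close> with \<open>N t f\<close> outside \<open>T\<close>, words of any length
  would keep \<open>g\<close> outside, yet words of length \<open>n\<close> end in \<open>T\<close>.
  With \<open>T = {0}\<close> this yields common kernel vectors; with the preimage of a line as
  \<open>T\<close>, the last vector whose image leaves the line.\<close>

lemma nil_chain:
  assumes nil: "\<And>ts p. length ts = n \<Longrightarrow> Q p \<Longrightarrow> fold N ts p \<in> T"
    and "\<And>t p. Q p \<Longrightarrow> Q (N t p)" "Q g" "g \<notin> T"
  shows "\<exists>f. Q f \<and> f \<notin> T \<and> (\<forall>t. N t f \<in> T)"
proof (rule ccontr)
  assume "\<not> ?thesis"
  then have step: "\<exists>t. N t f \<notin> T" if "Q f" "f \<notin> T" for f using that by blast
  have "\<exists>ts. length ts = k \<and> fold N ts g \<notin> T \<and> Q (fold N ts g)" for k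
  proof (induction k)
    case (Suc k)
    then obtain ts where ts: "length ts = k" "fold N ts g \<notin> T" "Q (fold N ts g)" by blast
    obtain t where "N t (fold N ts g) \<notin> T" using step ts by blast
    then show ?case using ts assms(2) by (intro exI[of _ "ts @ [t]"]) auto
  qed (use assms in auto)
  then show False using nil assms(3) by blast
qed

section \<open>Dimension counts, Riesz representation and the structure of small skew
  families\<close>

locale fin_dim =
  fixes S :: "'a::real_vector set"
  assumes finite_S: "finite S" and span_S: "span S = UNIV"
begin

lemma finite_independent:
  assumes "independent (T :: 'a set)"
  shows "finite T"
  using real_vector.independent_span_bound[OF finite_S assms] span_S by auto

lemma independent_le_dim:
  assumes "independent (T :: 'a set)" "T \<subseteq> W"
  shows "card T \<le> dim W"
proof -
  obtain B where B: "B \<subseteq> W" "independent B" "W \<subseteq> span B" "card B = dim W"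
    using real_vector.basis_exists by blast
  show ?thesis
    using real_vector.independent_span_bound[of B T] B assms finite_independent by auto
qed

lemma independent_spans:
  assumes "independent (T :: 'a set)" "T \<subseteq> W" "dim W \<le> card T"
  shows "W \<subseteq> span T"
proof
  fix x assume "x \<in> W"
  show "x \<in> span T"
  proof (rule ccontr)
    assume x: "x \<notin> span T"
    then have "independent (insert x T)" using assms by (intro real_vector.independent_insertI)
    then have "card (insert x T) \<le> dim W" using \<open>x \<in> W\<close> assms by (intro independent_le_dim) auto
    moreover have "x \<notin> T" using x real_vector.span_base by blast
    ultimately show False using assms finite_independent by simp
  qed
qed

lemma sum_form_basis_eq_0:
  assumes "independent (B :: 'a set)" "(\<Sum>b\<in>B. u b *\<^sub>R b) = 0" "b \<in> B"
  shows "u b = 0"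
  using real_vector.independentD[OF assms(1) finite_independent[OF assms(1)] subset_refl] assms by blast

lemma Riesz:
  fixes \<phi> :: "'a \<Rightarrow> 'a \<Rightarrow> real"
  assumes \<phi>: "bilinear \<phi>" and W: "subspace W"
    and nondeg: "\<And>p. p \<in> W \<Longrightarrow> (\<And>q. q \<in> W \<Longrightarrow> \<phi> p q = 0) \<Longrightarrow> p = 0"
    and l: "linear l"
  shows "\<exists>p\<in>W. \<forall>q\<in>W. \<phi> p q = l q"
proof -
  obtain B where B: "B \<subseteq> W" "independent B" "W \<subseteq> span B" "card B = dim W"
    using real_vector.basis_exists by blast
  have spB: "span B = W" using B W by (metis real_vector.span_minimal subset_antisym)
  \<comment> \<open>The covector \<open>\<phi> p\<close> is stored as the vector of \<open>W\<close>
    with the same coordinates. An injective endomorphism of \<open>W\<close> thus replaces the map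
    into the dual, and \<open>independent_spans\<close> makes it onto.\<close>
  define T where "T p = (\<Sum>b\<in>B. \<phi> p b *\<^sub>R b)" for p
  have lT: "linear T"
    unfolding T_def
    by (rule linearI) (simp_all add: bilinear_ladd[OF \<phi>] bilinear_lmul[OF \<phi>] scaleR_left_distrib
        sum.distrib scaleR_sum_right)
  have ext: "\<phi> p q = l' q" if "\<And>b. b \<in> B \<Longrightarrow> \<phi> p b = l' b" "linear l'" "q \<in> W" for p q l'
  proof -
    have "linear (\<lambda>q. \<phi> p q - l' q)"
      using \<phi> that(2) by (intro linear_compose_sub) (auto simp: bilinear_def)
    from real_vector.linear_eq_0_on_span[OF this, of B q] that spB show ?thesis by simp
  qed
  have "inj_on T (span B)"
  proof (subst real_vector.linear_inj_on_iff_eq_0[OF lT real_vector.subspace_span], intro ballI impI)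
    fix p assume p: "p \<in> span B" "T p = 0"
    have "\<phi> p b = 0" if "b \<in> B" for b
      using sum_form_basis_eq_0[OF B(2) p(2)[unfolded T_def] that] .
    then have "\<phi> p q = 0" if "q \<in> W" for q
      using ext[of p "\<lambda>_. 0" q] that by (simp add: linear_iff)
    then show "p = 0" using nondeg p spB by blast
  qed
  then have ind: "independent (T ` B)"
    using real_vector.linear_independent_injective_image[OF lT B(2)] by blast
  have "T p \<in> W" for p
    unfolding T_def using B W by (intro real_vector.subspace_sum real_vector.subspace_scale) auto
  moreover have "card (T ` B) = card B"
    using \<open>inj_on T (span B)\<close> by (meson card_image inj_on_subset real_vector.span_superset)
  ultimately have "W \<subseteq> span (T ` B)"
    using independent_spans[OF ind, of W] B by auto
  also have "span (T ` B) = T ` W" using real_vector.linear_span_image[OF lT] spB by simp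
  finally have sub: "W \<subseteq> T ` W" .
  have "(\<Sum>b\<in>B. l b *\<^sub>R b) \<in> W"
    using B W by (intro real_vector.subspace_sum real_vector.subspace_scale) auto
  then obtain p where p: "p \<in> W" "T p = (\<Sum>b\<in>B. l b *\<^sub>R b)" using sub by auto
  then have "(\<Sum>b\<in>B. (\<phi> p b - l b) *\<^sub>R b) = 0"
    by (simp add: T_def scaleR_left_diff_distrib sum_subtractf)
  then have "\<phi> p b = l b" if "b \<in> B" for b
    using sum_form_basis_eq_0[OF B(2), of "\<lambda>b. \<phi> p b - l b"] that by fastforce
  then show ?thesis using ext[of p l] l p by blast
qed

text \<open>Rank-nullity: the coordinate map \<open>T\<close> takes values in \<open>span U\<close>,
  its kernel lies in the annihilator, and it is injective on the complement
  \<open>span C\<close>.\<close>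

lemma dim_annihilator:
  fixes \<phi> :: "'a \<Rightarrow> 'a \<Rightarrow> real"
  assumes \<phi>: "bilinear \<phi>"
  shows "dim (UNIV :: 'a set) \<le> dim {X. \<forall>u\<in>U. \<phi> X u = 0} + dim U"
proof -
  define Z where "Z = {X. \<forall>u\<in>U. \<phi> X u = 0}"
  obtain B where B: "B \<subseteq> U" "independent B" "U \<subseteq> span B" "card B = dim U"
    using real_vector.basis_exists by blast
  define T where "T p = (\<Sum>b\<in>B. \<phi> p b *\<^sub>R b)" for p
  have lT: "linear T"
    unfolding T_def
    by (rule linearI) (simp_all add: bilinear_ladd[OF \<phi>] bilinear_lmul[OF \<phi>] scaleR_left_distrib
        sum.distrib scaleR_sum_right)
  have kernel: "X \<in> Z" if "T X = 0" for X
  proof -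
    have 0: "\<phi> X b = 0" if "b \<in> B" for b
      using sum_form_basis_eq_0[OF B(2) \<open>T X = 0\<close>[unfolded T_def] that] .
    have "linear (\<phi> X)" using \<phi> by (simp add: bilinear_def)
    from real_vector.linear_eq_0_on_span[OF this, of B] 0 B(3) show ?thesis by (auto simp: Z_def)
  qed
  obtain BZ where BZ: "BZ \<subseteq> Z" "independent BZ" "Z \<subseteq> span BZ" "card BZ = dim Z"
    using real_vector.basis_exists by blast
  obtain B' where B': "BZ \<subseteq> B'" "independent B'" "UNIV \<subseteq> span B'"
    using real_vector.maximal_independent_subset_extend[of BZ UNIV] BZ by auto
  define C where "C = B' - BZ"
  have fB': "finite B'" using B' finite_independent by blast
  have iC: "independent C" using B' real_vector.independent_mono[of B' C] by (auto simp: C_def)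
  have "inj_on T (span C)"
  proof (subst real_vector.linear_inj_on_iff_eq_0[OF lT real_vector.subspace_span], intro ballI impI)
    fix p assume p: "p \<in> span C" "T p = 0"
    then have "p \<in> span BZ" using kernel BZ by blast
    then show "p = 0"
      using span_disjoint_Int[OF B'(2), of C BZ] p(1) B' by (auto simp: C_def)
  qed
  then have "independent (T ` C)" "card (T ` C) = card C"
    using real_vector.linear_independent_injective_image[OF lT iC]
    by (auto intro!: card_image intro: inj_on_subset[OF _ real_vector.span_superset])
  moreover have "T ` C \<subseteq> span U"
    unfolding T_def using B
    by (auto intro!: real_vector.span_sum real_vector.span_scale intro: real_vector.span_base)
  ultimately have "card C \<le> dim U" using independent_le_dim[of "T ` C" "span U"] by simp
  moreover have "card B' = card BZ + card C"
    using fB' B' by (simp add: C_def card_Diff_subset finite_subset card_mono)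
  moreover have "dim (UNIV :: 'a set) = card B'"
    using real_vector.basis_card_eq_dim[of B' UNIV] B' by auto
  ultimately show ?thesis using BZ by (simp add: Z_def)
qed


text \<open>Dimension four is used once, to show that \<open>N t\<close> maps the orthogonal space
  of \<open>v\<close> into the line of \<open>v\<close>; a failure would produce five independent
  vectors. As \<open>w\<close> spans a complement of that hyperplane, the formula follows. It is
  stated for every \<open>w\<close> pairing with \<open>v\<close>, so that \<open>w\<close> can
  later be a projected bracket.\<close>

lemma skew_nilpotent_family:
  fixes \<phi> :: "'a \<Rightarrow> 'a \<Rightarrow> real" and N :: "'t \<Rightarrow> 'a \<Rightarrow> 'a"
  assumes \<phi>: "bilinear \<phi>" and sym: "\<And>p q. \<phi> p q = \<phi> q p" and W: "subspace W"
    and nondeg: "\<And>p. p \<in> W \<Longrightarrow> (\<And>q. q \<in> W \<Longrightarrow> \<phi> p q = 0) \<Longrightarrow> p = 0"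
    and NW: "\<And>t p. p \<in> W \<Longrightarrow> N t p \<in> W" and lN: "\<And>t. linear (N t)"
    and skew: "\<And>t p q. p \<in> W \<Longrightarrow> q \<in> W \<Longrightarrow> \<phi> (N t p) q = - \<phi> p (N t q)"
    and nil: "\<And>ts p. length ts = n \<Longrightarrow> p \<in> W \<Longrightarrow> fold N ts p = 0"
    and dimW: "dim W \<le> 4" and nontriv: "p0 \<in> W" "N t0 p0 \<noteq> 0"
  shows "\<exists>v. v \<in> W \<and> v \<noteq> 0 \<and> \<phi> v v = 0 \<and> (\<forall>t. N t v = 0) \<and> (\<exists>t p. p \<in> W \<and> v = N t p) \<and>
    (\<forall>t p w. p \<in> W \<longrightarrow> w \<in> W \<longrightarrow> \<phi> v w \<noteq> 0 \<longrightarrow>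
        \<phi> v w *\<^sub>R N t p = \<phi> v p *\<^sub>R N t w - \<phi> (N t w) p *\<^sub>R v)"
proof -
  note lin = bilinear_ladd[OF \<phi>] bilinear_radd[OF \<phi>] bilinear_lsub[OF \<phi>] bilinear_rsub[OF \<phi>]
    bilinear_lmul[OF \<phi>] bilinear_rmul[OF \<phi>] bilinear_lzero[OF \<phi>] bilinear_rzero[OF \<phi>]
  have lin1: "linear (\<phi> X)" for X using \<phi> by (simp add: bilinear_def)
  \<comment> \<open>Carrying along that \<open>v\<close> is a value of the family makes it
    isotropic: \<open>\<phi> v v = - \<phi> p1 (N t1 v) = 0\<close>.\<close>
  have "\<exists>v. (v \<in> W \<and> (\<exists>t p. p \<in> W \<and> v = N t p)) \<and> v \<notin> {0} \<and> (\<forall>t. N t v \<in> {0})"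
    by (rule nil_chain[where n = n and g = "N t0 p0"]) (use nil NW nontriv in auto)
  then obtain v t1 p1 where v: "v \<in> W" "v \<noteq> 0" "\<And>t. N t v = 0" and p1: "p1 \<in> W" "v = N t1 p1"
    by blast
  have skew0: "\<phi> p (N t p) = 0" if "p \<in> W" for t p
    using skew[OF that that, of t] sym[of "N t p" p] by simp
  have vv: "\<phi> v v = 0" using skew[OF p1(1) v(1), of t1] v(3) p1 by (simp add: lin)
  have vN: "\<phi> v (N t p) = 0" if "p \<in> W" for t p
    using skew[OF v(1) that, of t] v(3) by (simp add: lin)
  have in_line: "N t p \<in> span {v}" if p: "p \<in> W" "\<phi> v p = 0" for t p
  proof (rule ccontr)
    assume no: "N t p \<notin> span {v}"
    let ?T = "{p. N t p \<in> span {v}}"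
    have fold_const: "fold (\<lambda>_::unit. N t) ts q = fold N (map (\<lambda>_. t) ts) q" for ts q
      by (simp add: fold_map comp_def)
    \<comment> \<open>Iterating the single map \<open>N t\<close> gives a last vector whose image
      avoids the line. Its image \<open>f\<close> is sent into the line, which makes
      \<open>f\<close> isotropic because \<open>p\<close> is orthogonal to \<open>v\<close>.\<close>
    have "\<exists>f. (f \<in> W \<and> \<phi> v f = 0) \<and> f \<notin> ?T \<and> (\<forall>_::unit. N t f \<in> ?T)"
      by (rule nil_chain[where n = n and g = p and N = "\<lambda>_::unit. N t"])
        (use nil NW p no vN in \<open>auto simp: fold_const linear_0[OF lN] real_vector.span_zero\<close>)
    then obtain p where p: "p \<in> W" "\<phi> v p = 0" "N t p \<notin> span {v}" "N t (N t p) \<in> span {v}" by auto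
    define f where "f = N t p"
    obtain k where k: "N t f = k *\<^sub>R v" using p(4) by (auto simp: f_def real_vector.span_singleton)
    have f: "f \<in> W" "f \<notin> span {v}" "\<phi> v f = 0" "\<phi> f p = 0"
      using p NW vN skew0 sym by (auto simp: f_def)
    have ff: "\<phi> f f = 0"
      using skew[OF p(1) f(1), of t] k p sym[of p v] by (simp add: f_def lin)
    have pspan: "p \<notin> span {f, v}"
    proof
      assume "p \<in> span {f, v}"
      then obtain a b where "p = a *\<^sub>R f + b *\<^sub>R v"
        by (metis (no_types, lifting) real_vector.span_breakdown_eq real_vector.span_singleton diff_eq_eq
            add.commute rangeE)
      then have "N t p = (a * k) *\<^sub>R v"
        using k v(3) by (simp add: linear_add[OF lN] linear_scale[OF lN])
      then show False using p(3) by (metis real_vector.span_base real_vector.span_scale singletonI)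
    qed
    obtain w0 where w0: "w0 \<in> W" "\<phi> v w0 \<noteq> 0" using nondeg v by blast
    define w where "w = (1 / \<phi> v w0) *\<^sub>R w0"
    have w: "w \<in> W" "\<phi> v w = 1" using w0 W by (auto simp: w_def lin real_vector.subspace_scale)
    \<comment> \<open>The functional \<open>\<phi> f'\<close> kills \<open>v\<close>,
      \<open>f\<close>, \<open>p\<close> and, by this correction, also \<open>w\<close>; a vector
      that it does not kill is the fifth independent one.\<close>
    define f' where "f' = f - \<phi> f w *\<^sub>R v"
    have "f' \<noteq> 0"
    proof
      assume "f' = 0"
      then have "f = \<phi> f w *\<^sub>R v" by (simp add: f'_def)
      then show False using f(2) by (metis real_vector.span_base real_vector.span_scale singletonI)
    qed
    moreover have "f' \<in> W" using f v W by (simp add: f'_def real_vector.subspace_diff real_vector.subspace_scale)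
    ultimately obtain u where u: "u \<in> W" "\<phi> f' u \<noteq> 0" using nondeg by blast
    have f'0: "\<phi> f' v = 0" "\<phi> f' f = 0" "\<phi> f' p = 0" "\<phi> f' w = 0"
      using f ff vv w p sym[of f v] by (simp_all add: f'_def lin)
    have n1: "w \<notin> span {p, f, v}"
      by (rule not_in_span_functional[OF lin1[of v]]) (use f p w vv in auto)
    have n2: "u \<notin> span {w, p, f, v}"
      by (rule not_in_span_functional[OF lin1[of f']]) (use f'0 u in auto)
    have "v \<notin> span {}" using v by simp
    note independent_card_insert[OF independent_card_insert[OF independent_card_insert[OF
      independent_card_insert[OF independent_card_insert[OF independent_card_empty this] f(2)] pspan] n1] n2]
    then have "5 \<le> dim W" using independent_le_dim[of "{u, w, p, f, v}" W] u w p f v by simp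
    then show False using dimW by simp
  qed
  have formula: "\<phi> v w *\<^sub>R N t p = \<phi> v p *\<^sub>R N t w - \<phi> (N t w) p *\<^sub>R v"
    if p: "p \<in> W" and w: "w \<in> W" "\<phi> v w \<noteq> 0" for t p w
  proof -
    \<comment> \<open>The part of \<open>p\<close> orthogonal to \<open>v\<close>, scaled to avoid a
      division. Pairing its image with \<open>w\<close> determines the multiple of
      \<open>v\<close>.\<close>
    define p' where "p' = \<phi> v w *\<^sub>R p - \<phi> v p *\<^sub>R w"
    have p': "p' \<in> W" "\<phi> v p' = 0"
      using p w W by (auto simp: p'_def lin real_vector.subspace_diff real_vector.subspace_scale)
    obtain k where k: "N t p' = k *\<^sub>R v" using in_line[OF p'] by (auto simp: real_vector.span_singleton)
    have "k * \<phi> v w = \<phi> (N t p') w" using k by (simp add: lin)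
    also have "\<dots> = - \<phi> v w * \<phi> p (N t w)" using skew[OF p'(1) w(1)] skew0[OF w(1)] by (simp add: p'_def lin)
    finally have "k * \<phi> v w = - \<phi> (N t w) p * \<phi> v w" by (simp add: sym[of p] mult.commute)
    then have "k = - \<phi> (N t w) p" using w(2) mult_right_cancel by blast
    moreover have "\<phi> v w *\<^sub>R N t p = \<phi> v p *\<^sub>R N t w + N t p'"
      by (simp add: p'_def linear_diff[OF lN] linear_scale[OF lN])
    ultimately show ?thesis using k by simp
  qed
  show ?thesis using v vv p1 formula by blast
qed

end

subsection \<open>Exact 3-forms\<close>

text \<open>The wedge product of three covectors, that is the 3 by 3 determinant expanded along
  \<open>f\<close>, without a factor 1/6.\<close>

definition wedge3 :: "('a \<Rightarrow> real) \<Rightarrow> ('a \<Rightarrow> real) \<Rightarrow> ('a \<Rightarrow> real) \<Rightarrow> 'a \<Rightarrow> 'a \<Rightarrow> 'a \<Rightarrow> real" where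
  "wedge3 f g h X Y Z =
     f X * (g Y * h Z - g Z * h Y) + f Y * (g Z * h X - g X * h Z) + f Z * (g X * h Y - g Y * h X)"

locale invariant_form = lie_algebra br
  for br :: "'a::real_vector \<Rightarrow> 'a \<Rightarrow> 'a" +
  fixes \<phi> :: "'a \<Rightarrow> 'a \<Rightarrow> real"
  assumes bilinear_form: "bilinear \<phi>"
    and form_sym: "\<phi> X Y = \<phi> Y X"
    and form_inv: "ad_invariant_form br \<phi>"
begin

lemmas form_linear =
  bilinear_ladd[OF bilinear_form] bilinear_radd[OF bilinear_form]
  bilinear_lsub[OF bilinear_form] bilinear_rsub[OF bilinear_form]
  bilinear_lneg[OF bilinear_form] bilinear_rneg[OF bilinear_form]
  bilinear_lmul[OF bilinear_form] bilinear_rmul[OF bilinear_form]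
  bilinear_lzero[OF bilinear_form] bilinear_rzero[OF bilinear_form]

lemmas br_linear =
  bilinear_ladd[OF bilinear_br] bilinear_radd[OF bilinear_br]
  bilinear_lsub[OF bilinear_br] bilinear_rsub[OF bilinear_br]
  bilinear_lneg[OF bilinear_br] bilinear_rneg[OF bilinear_br]
  bilinear_lmul[OF bilinear_br] bilinear_rmul[OF bilinear_br]
  bilinear_lzero[OF bilinear_br] bilinear_rzero[OF bilinear_br]

lemma br_skew: "br X Y = - br Y X"
proof -
  have "br (X + Y) (X + Y) = br X X + br Y X + (br X Y + br Y Y)"
    by (simp only: br_linear)
  then have "br X Y + br Y X = 0" by (simp add: br_self add.commute)
  then show ?thesis by (simp add: eq_neg_iff_add_eq_0)
qed

definition \<omega> :: "'a \<Rightarrow> 'a \<Rightarrow> 'a \<Rightarrow> real" where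
  "\<omega> X Y Z = \<phi> (br X Y) Z"

lemma form_br: "\<phi> (br X Y) Z = - \<phi> Y (br X Z)"
  using form_inv by (simp add: ad_invariant_form_def)

lemma \<omega>_swap12: "\<omega> Y X Z = - \<omega> X Y Z"
  by (simp add: \<omega>_def br_skew[of Y X] form_linear)

lemma \<omega>_swap23: "\<omega> X Z Y = - \<omega> X Y Z"
  unfolding \<omega>_def by (simp add: form_br[of X Z Y] form_sym[of Z])

lemma \<omega>_cyclic: "\<omega> Y Z X = \<omega> X Y Z"
  using \<omega>_swap12 \<omega>_swap23 by metis

lemma \<omega>_self [simp]: "\<omega> X X Y = 0" "\<omega> Y X X = 0" "\<omega> X Y X = 0"
  using \<omega>_swap12[of X X Y] \<omega>_swap23[of Y X X] \<omega>_cyclic[of X Y X] by auto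

lemma form_br_eq: "\<phi> (br X Y) Z = \<omega> Z X Y" "\<phi> Z (br X Y) = \<omega> Z X Y"
  using \<omega>_cyclic[of X Y Z] form_sym[of Z "br X Y"] by (simp_all add: \<omega>_def)

lemma \<omega>_linear:
  "\<omega> (X + X') Y Z = \<omega> X Y Z + \<omega> X' Y Z" "\<omega> X (Y + Y') Z = \<omega> X Y Z + \<omega> X Y' Z"
  "\<omega> X Y (Z + Z') = \<omega> X Y Z + \<omega> X Y Z'"
  "\<omega> (X - X') Y Z = \<omega> X Y Z - \<omega> X' Y Z" "\<omega> X (Y - Y') Z = \<omega> X Y Z - \<omega> X Y' Z"
  "\<omega> X Y (Z - Z') = \<omega> X Y Z - \<omega> X Y Z'"
  "\<omega> (r *\<^sub>R X) Y Z = r * \<omega> X Y Z" "\<omega> X (r *\<^sub>R Y) Z = r * \<omega> X Y Z"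
  "\<omega> X Y (r *\<^sub>R Z) = r * \<omega> X Y Z"
  "\<omega> 0 Y Z = 0" "\<omega> X 0 Z = 0" "\<omega> X Y 0 = 0"
  "\<omega> (- X) Y Z = - \<omega> X Y Z" "\<omega> X (- Y) Z = - \<omega> X Y Z" "\<omega> X Y (- Z) = - \<omega> X Y Z"
  by (simp_all add: \<omega>_def form_linear br_linear)

text \<open>The Chevalley-Eilenberg differential of \<sigma> up to a sign, which replacing \<sigma>
  by its negative absorbs.\<close>

definition exact :: "('a \<Rightarrow> 'a \<Rightarrow> 'a \<Rightarrow> real) \<Rightarrow> bool" where
  "exact \<tau> \<longleftrightarrow> (\<exists>\<sigma>. bilinear \<sigma> \<and> (\<forall>X Y. \<sigma> X Y = - \<sigma> Y X) \<and>
     (\<forall>X Y Z. \<tau> X Y Z = \<sigma> (br X Y) Z + \<sigma> (br Y Z) X + \<sigma> (br Z X) Y))"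

text \<open>The workhorse: relations between forms are combined with numerical coefficients, and
  leaving \<upsilon> free up to a pointwise identity lets \<open>simp\<close> check the
  bookkeeping.\<close>

lemma exact_comb:
  assumes "exact \<tau>" "exact \<tau>'" "\<And>X Y Z. \<upsilon> X Y Z = r * \<tau> X Y Z + s * \<tau>' X Y Z"
  shows "exact \<upsilon>"
proof -
  obtain \<sigma> where \<sigma>: "bilinear \<sigma>" "\<And>X Y. \<sigma> X Y = - \<sigma> Y X"
     "\<And>X Y Z. \<tau> X Y Z = \<sigma> (br X Y) Z + \<sigma> (br Y Z) X + \<sigma> (br Z X) Y"
    using assms(1) unfolding exact_def by blast
  obtain \<sigma>' where \<sigma>': "bilinear \<sigma>'" "\<And>X Y. \<sigma>' X Y = - \<sigma>' Y X"
     "\<And>X Y Z. \<tau>' X Y Z = \<sigma>' (br X Y) Z + \<sigma>' (br Y Z) X + \<sigma>' (br Z X) Y"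
    using assms(2) unfolding exact_def by blast
  show ?thesis unfolding exact_def
  proof (intro exI[of _ "\<lambda>X Y. r * \<sigma> X Y + s * \<sigma>' X Y"] conjI allI)
    show "bilinear (\<lambda>X Y. r * \<sigma> X Y + s * \<sigma>' X Y)"
      using \<sigma>(1) \<sigma>'(1) unfolding bilinear_def linear_iff by (auto simp: algebra_simps)
    show "r * \<sigma> X Y + s * \<sigma>' X Y = - (r * \<sigma> Y X + s * \<sigma>' Y X)" for X Y
      using \<sigma>(2)[of X Y] \<sigma>'(2)[of X Y] by simp
  qed (simp add: assms(3) \<sigma>(3) \<sigma>'(3) algebra_simps)
qed

lemma exact_0: "exact (\<lambda>X Y Z. 0)"
  unfolding exact_def by (intro exI[of _ "\<lambda>X Y. 0"]) (simp add: bilinear_def linear_iff)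

lemma exact_scale:
  assumes "exact \<tau>" "\<And>X Y Z. \<upsilon> X Y Z = r * \<tau> X Y Z"
  shows "exact \<upsilon>"
  using assms(1) exact_0 by (rule exact_comb[where r = r and s = 0]) (simp add: assms(2))

lemma exact_sum:
  assumes "\<And>i. i \<in> I \<Longrightarrow> exact (\<tau> i)"
  shows "exact (\<lambda>X Y Z. \<Sum>i\<in>I. \<tau> i X Y Z)"
  using assms
proof (induction I rule: infinite_finite_induct)
  case (insert i I)
  have "exact (\<tau> i)" "exact (\<lambda>X Y Z. \<Sum>i\<in>I. \<tau> i X Y Z)" using insert by auto
  then show ?case by (rule exact_comb[where r = 1 and s = 1]) (simp add: insert)
qed (simp_all add: exact_0)

lemma exact_2form:
  assumes "bilinear \<sigma>" "\<And>X Y. \<sigma> X Y = - \<sigma> Y X"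
  shows "exact (\<lambda>X Y Z. \<sigma> (br X Y) Z + \<sigma> (br Y Z) X + \<sigma> (br Z X) Y)"
  using assms unfolding exact_def by blast

lemma exact_cong:
  assumes "exact \<tau>" "\<And>X Y Z. \<upsilon> X Y Z = \<tau> X Y Z"
  shows "exact \<upsilon>"
  using assms(1) by (rule exact_scale[where r = 1]) (simp add: assms(2))

text \<open>The potential is the wedge of \<open>\<phi> u\<close> and \<open>a\<close>: since
  \<open>a\<close> kills brackets, only \<open>\<phi> u (br X Y) = \<omega> u X Y\<close> survives
  in the differential.\<close>

lemma exact_closed_wedge:
  assumes "linear a" "\<And>X Y. a (br X Y) = 0"
  shows "exact (\<lambda>X Y Z. a X * \<omega> u Y Z + a Y * \<omega> u Z X + a Z * \<omega> u X Y)"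
proof -
  interpret a: linear a by fact
  have b: "bilinear (\<lambda>X Y. \<phi> u X * a Y - a X * \<phi> u Y)"
    by (auto simp: bilinear_def linear_iff form_linear a.add a.scale algebra_simps)
  show ?thesis
    by (rule exact_scale[OF exact_2form[OF b], where r = 1])
      (simp_all add: assms form_br_eq algebra_simps)
qed

definition closed1 :: "('a \<Rightarrow> real) \<Rightarrow> bool" where
  "closed1 a \<longleftrightarrow> linear a \<and> (\<forall>X Y. a (br X Y) = 0)"

lemma exact_wedge1:
  "closed1 a \<Longrightarrow> exact (\<lambda>X Y Z. a X * \<omega> u Y Z + a Y * \<omega> u Z X + a Z * \<omega> u X Y)"
  unfolding closed1_def by (intro exact_closed_wedge) auto

lemma exact_form_wedge:
  "exact (\<lambda>X Y Z. \<phi> q X * \<omega> p Y Z + \<phi> q Y * \<omega> p Z X + \<phi> q Z * \<omega> p X Y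
     - (\<phi> p X * \<omega> q Y Z + \<phi> p Y * \<omega> q Z X + \<phi> p Z * \<omega> q X Y))"
proof -
  have b: "bilinear (\<lambda>X Y. \<phi> p X * \<phi> q Y - \<phi> q X * \<phi> p Y)"
    by (auto simp: bilinear_def linear_iff form_linear algebra_simps)
  show ?thesis
    by (rule exact_scale[OF exact_2form[OF b], where r = 1])
      (simp_all add: form_br_eq algebra_simps)
qed

lemma exact_imp_dual_derivation:
  assumes "exact \<omega>"
  shows "\<exists>D. dual_derivation br D \<and> \<phi> = (\<lambda>X Y. D X Y + dual_transpose D X Y)"
proof -
  obtain \<sigma> where \<sigma>: "bilinear \<sigma>" "\<And>X Y. \<sigma> X Y = - \<sigma> Y X"
     "\<And>X Y Z. \<omega> X Y Z = \<sigma> (br X Y) Z + \<sigma> (br Y Z) X + \<sigma> (br Z X) Y"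
    using assms unfolding exact_def by blast
  define D where "D = (\<lambda>X Y. (\<phi> X Y + \<sigma> X Y) / 2)"
  have "bilinear D"
    using \<sigma>(1) bilinear_form unfolding bilinear_def linear_iff D_def
    by (auto simp: algebra_simps add_divide_distrib)
  \<comment> \<open>The \<phi>-half of \<open>D\<close> contributes \<omega> once on the left and
    twice on the right; the differential of \<sigma> makes up the difference.\<close>
  moreover have "D (br X Y) Z = D X (br Y Z) - D Y (br X Z)" for X Y Z
  proof -
    have "\<sigma> (br X Y) Z = \<omega> X Y Z + \<sigma> X (br Y Z) - \<sigma> Y (br X Z)"
      using \<sigma>(3)[of X Y Z] \<sigma>(2)[of X "br Y Z"] \<sigma>(2)[of Y "br X Z"]
      by (simp add: br_skew[of Z X] bilinear_lneg[OF \<sigma>(1)])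
    moreover have "\<phi> (br X Y) Z = \<omega> X Y Z" "\<phi> X (br Y Z) = \<omega> X Y Z" "\<phi> Y (br X Z) = - \<omega> X Y Z"
      using \<omega>_cyclic[of X Y Z] \<omega>_swap12[of X Y Z] by (simp_all add: form_br_eq)
    ultimately show ?thesis by (simp add: D_def field_simps)
  qed
  moreover have "\<phi> = (\<lambda>X Y. D X Y + dual_transpose D X Y)"
  proof (intro ext)
    fix X Y
    show "\<phi> X Y = D X Y + dual_transpose D X Y"
      using \<sigma>(2)[of X Y] form_sym[of X Y] by (simp add: D_def dual_transpose_def field_simps)
  qed
  ultimately show ?thesis unfolding dual_derivation_def by blast
qed


end

subsection \<open>Exactness of 3-forms in normal form\<close>

text \<open>Below \<open>a, b, c\<close> are the closed coordinates on the generators \<open>x, y, z\<close>; all other covectors are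
  of the form \<open>\<phi> p\<close> with \<open>p\<close> in the derived algebra.\<close>

context invariant_form
begin

text \<open>Let \<open>A\<close>, \<open>R\<close>, \<open>R'\<close> be the three terms of
  \<omega>. Contractions by \<open>x\<close> and \<open>y\<close> give \<open>A + R\<close> and
  \<open>A + R'\<close>; the pair \<open>v\<close>, \<open>w\<close> gives \<open>R + R' - A\<close>
  up to the product of \<open>a\<close>, \<open>b\<close>, \<open>\<phi> v\<close>, which
  \<open>u\<close> shows to be exact. Hence \<open>3 * A\<close> is exact, and with it
  \<omega>.\<close>

lemma exact_two_frame_rank_one:
  assumes ab: "closed1 a" "closed1 b"
    and om: "\<And>X Y Z. \<omega> X Y Z = wedge3 a b (\<phi> w) X Y Z + wedge3 a (\<phi> v) (\<phi> e) X Y Z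
       + wedge3 b (\<phi> v) (\<phi> e') X Y Z"
    and xy: "a x = 1" "b x = 0" "a y = 0" "b y = 1"
    and W: "\<And>p. p \<in> {v, w, e, e', u} \<Longrightarrow> a p = 0 \<and> b p = 0 \<and> \<phi> p x = 0 \<and> \<phi> p y = 0"
    and g: "\<phi> v v = 0" "\<phi> v w = 1" "\<phi> v e = 0" "\<phi> v e' = 0" "\<phi> w e = 0" "\<phi> w e' = 0"
    and u: "\<phi> e u = 1 \<or> \<phi> e' u = 1"
  shows "exact \<omega>"
proof -
  have g': "\<phi> w v = 1" "\<phi> e v = 0" "\<phi> e' v = 0" "\<phi> e w = 0" "\<phi> e' w = 0"
    using g by (metis form_sym)+
  have W': "a v = 0" "b v = 0" "a w = 0" "b w = 0" "a u = 0" "b u = 0"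
     "\<phi> v x = 0" "\<phi> v y = 0" "\<phi> w x = 0" "\<phi> w y = 0" "\<phi> e x = 0" "\<phi> e y = 0" "\<phi> e' x = 0" "\<phi> e' y = 0"
    using W by auto
  note defs = om xy g g' W' wedge3_def algebra_simps
  have abe: "exact (wedge3 a b (\<phi> e))"
    by (rule exact_scale[OF exact_wedge1[OF ab(2), of w], where r = 1]) (simp add: defs)
  have abe': "exact (wedge3 a b (\<phi> e'))"
    by (rule exact_scale[OF exact_wedge1[OF ab(1), of w], where r = "-1"]) (simp add: defs)
  have "exact (\<lambda>X Y Z. wedge3 a b (\<phi> v) X Y Z * \<phi> e u - \<phi> v u * wedge3 a b (\<phi> e) X Y Z)"
    by (rule exact_scale[OF exact_wedge1[OF ab(2), of u], where r = "-1"]) (simp add: defs)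
  from exact_comb[OF this abe, where r = 1 and s = "\<phi> v u"]
  have 1: "exact (\<lambda>X Y Z. \<phi> e u * wedge3 a b (\<phi> v) X Y Z)" by (simp add: mult.commute)
  have "exact (\<lambda>X Y Z. wedge3 a b (\<phi> v) X Y Z * \<phi> e' u - \<phi> v u * wedge3 a b (\<phi> e') X Y Z)"
    by (rule exact_scale[OF exact_wedge1[OF ab(1), of u], where r = 1]) (simp add: defs)
  from exact_comb[OF this abe', where r = 1 and s = "\<phi> v u"]
  have 2: "exact (\<lambda>X Y Z. \<phi> e' u * wedge3 a b (\<phi> v) X Y Z)" by (simp add: mult.commute)
  have abv: "exact (wedge3 a b (\<phi> v))"
    using u 1 2 by auto
  have wv: "exact (\<lambda>X Y Z. wedge3 a (\<phi> v) (\<phi> e) X Y Z + wedge3 b (\<phi> v) (\<phi> e') X Y Z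
      - wedge3 a b (\<phi> w) X Y Z + \<phi> w w * wedge3 a b (\<phi> v) X Y Z)"
    by (rule exact_cong[OF exact_form_wedge[of v w]]) (simp add: defs)
  have xx: "exact (\<lambda>X Y Z. wedge3 a b (\<phi> w) X Y Z + wedge3 a (\<phi> v) (\<phi> e) X Y Z)"
    by (rule exact_cong[OF exact_wedge1[OF ab(1), of x]]) (simp add: defs)
  have yy: "exact (\<lambda>X Y Z. wedge3 a b (\<phi> w) X Y Z + wedge3 b (\<phi> v) (\<phi> e') X Y Z)"
    by (rule exact_cong[OF exact_wedge1[OF ab(2), of y]]) (simp add: defs)
  have s: "exact (\<lambda>X Y Z. 2 * wedge3 a b (\<phi> w) X Y Z + wedge3 a (\<phi> v) (\<phi> e) X Y Z
      + wedge3 b (\<phi> v) (\<phi> e') X Y Z)"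
    by (rule exact_comb[OF xx yy, where r = 1 and s = 1]) simp
  have "exact (\<lambda>X Y Z. 3 * wedge3 a b (\<phi> w) X Y Z - \<phi> w w * wedge3 a b (\<phi> v) X Y Z)"
    by (rule exact_comb[OF s wv, where r = 1 and s = "-1"]) simp
  from exact_comb[OF this abv, where r = "1/3" and s = "\<phi> w w / 3"]
  have abw: "exact (wedge3 a b (\<phi> w))" by (simp add: field_simps)
  show ?thesis
    by (rule exact_comb[OF s abw, where r = 1 and s = "-1"]) (simp add: om)
qed

text \<open>The pair \<open>v'\<close>, \<open>w'\<close> repeats the pattern of \<open>v\<close>,
  \<open>w\<close> one level down. \<open>?D\<close>, \<open>?E\<close>, \<open>?F\<close> are error
  terms of the relations, and \<open>?E\<close> is reached by dividing by \<open>\<phi> f f\<close>.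
  The dichotomy on \<open>r\<close> supplies the last relation: \<open>r = 0\<close> removes
  \<open>?B\<close>, while an anisotropic \<open>r\<close> makes \<open>?C\<close> exact.\<close>

lemma exact_two_frame_rank_two:
  assumes ab: "closed1 a" "closed1 b"
    and om: "\<And>X Y Z. \<omega> X Y Z = wedge3 a b (\<phi> w) X Y Z + wedge3 a (\<phi> v) (\<phi> w') X Y Z
       + wedge3 a (\<phi> v') (\<phi> f) X Y Z + \<alpha> * wedge3 b (\<phi> v) (\<phi> v') X Y Z + wedge3 b (\<phi> v) (\<phi> r) X Y Z"
    and xy: "a x = 1" "b x = 0" "a y = 0" "b y = 1"
    and W: "\<And>p. p \<in> {v, w, v', w', f, r} \<Longrightarrow> a p = 0 \<and> b p = 0 \<and> \<phi> p x = 0 \<and> \<phi> p y = 0"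
    and g: "\<phi> v v = 0" "\<phi> v w = 1" "\<phi> v v' = 0" "\<phi> v w' = 0" "\<phi> v f = 0" "\<phi> v r = 0"
      "\<phi> w v' = 0" "\<phi> w w' = 0" "\<phi> w f = 0" "\<phi> w r = 0"
      "\<phi> v' v' = 0" "\<phi> v' w' = 1" "\<phi> v' f = 0" "\<phi> v' r = 0" "\<phi> w' f = 0" "\<phi> w' r = 0" "\<phi> f r = 0"
    and f: "\<phi> f f \<noteq> 0"
    and r: "r = 0 \<or> \<phi> r r \<noteq> 0"
  shows "exact \<omega>"
proof -
  have g': "\<phi> w v = 1" "\<phi> v' v = 0" "\<phi> w' v = 0" "\<phi> f v = 0" "\<phi> r v = 0"
      "\<phi> v' w = 0" "\<phi> w' w = 0" "\<phi> f w = 0" "\<phi> r w = 0"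
      "\<phi> w' v' = 1" "\<phi> f v' = 0" "\<phi> r v' = 0" "\<phi> f w' = 0" "\<phi> r w' = 0" "\<phi> r f = 0"
    using g by (metis form_sym)+
  have W': "a v = 0" "b v = 0" "a w = 0" "b w = 0" "a v' = 0" "b v' = 0" "a w' = 0" "b w' = 0"
     "a f = 0" "b f = 0" "a r = 0" "b r = 0"
     "\<phi> v x = 0" "\<phi> v y = 0" "\<phi> w x = 0" "\<phi> w y = 0" "\<phi> v' x = 0" "\<phi> v' y = 0"
     "\<phi> w' x = 0" "\<phi> w' y = 0" "\<phi> f x = 0" "\<phi> f y = 0" "\<phi> r x = 0" "\<phi> r y = 0"
    using W by auto
  note defs = om xy g g' W' wedge3_def algebra_simps
  let ?A = "wedge3 a b (\<phi> w)" and ?H = "wedge3 a (\<phi> v) (\<phi> w')" and ?L = "wedge3 a (\<phi> v') (\<phi> f)"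
    and ?C = "wedge3 b (\<phi> v) (\<phi> v')" and ?B = "wedge3 b (\<phi> v) (\<phi> r)" and ?E = "wedge3 a (\<phi> v) (\<phi> v')"
    and ?D = "wedge3 a b (\<phi> v)" and ?F = "wedge3 a b (\<phi> f)" and ?R = "wedge3 a (\<phi> v) (\<phi> r)"
  have D: "exact ?D"
    by (rule exact_scale[OF exact_wedge1[OF ab(2), of v'], where r = "-1"]) (simp add: defs)
  have "exact (\<lambda>X Y Z. ?F X Y Z - \<phi> w' w' * ?D X Y Z)"
    by (rule exact_cong[OF exact_wedge1[OF ab(2), of w']]) (simp add: defs)
  from exact_comb[OF this D, where r = 1 and s = "\<phi> w' w'"] have F: "exact ?F" by simp
  have xx: "exact (\<lambda>X Y Z. ?A X Y Z + ?H X Y Z + ?L X Y Z)"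
    by (rule exact_cong[OF exact_wedge1[OF ab(1), of x]]) (simp add: defs)
  have yy: "exact (\<lambda>X Y Z. ?A X Y Z + \<alpha> * ?C X Y Z + ?B X Y Z)"
    by (rule exact_cong[OF exact_wedge1[OF ab(2), of y]]) (simp add: defs)
  \<comment> \<open>A mixed relation, \<open>a\<close> with the contraction by the other generator;
    it cancels \<open>?R\<close> when \<open>r\<close> is anisotropic.\<close>
  have xy': "exact (\<lambda>X Y Z. \<alpha> * ?E X Y Z + ?R X Y Z)"
    by (rule exact_cong[OF exact_wedge1[OF ab(1), of y]]) (simp add: defs)
  have "exact (\<lambda>X Y Z. \<phi> f f * ?E X Y Z + ?F X Y Z)"
    by (rule exact_scale[OF exact_form_wedge[of v f], where r = "-1"]) (simp add: defs)
  from exact_comb[OF this F, where r = "1 / \<phi> f f" and s = "- 1 / \<phi> f f"]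
  have E: "exact ?E" using f by (simp add: field_simps)
  have "exact (\<lambda>X Y Z. \<phi> w w * ?D X Y Z + ?H X Y Z + \<alpha> * ?C X Y Z + ?B X Y Z - ?A X Y Z)"
    by (rule exact_cong[OF exact_form_wedge[of v w]]) (simp add: defs)
  from exact_comb[OF this D, where r = 1 and s = "- \<phi> w w"]
  have wv: "exact (\<lambda>X Y Z. ?H X Y Z + \<alpha> * ?C X Y Z + ?B X Y Z - ?A X Y Z)" by simp
  have "exact (\<lambda>X Y Z. \<phi> w' w' * ?E X Y Z + ?L X Y Z + \<alpha> * ?C X Y Z - ?H X Y Z)"
    by (rule exact_cong[OF exact_form_wedge[of v' w']]) (simp add: defs)
  from exact_comb[OF this E, where r = 1 and s = "- \<phi> w' w'"]
  have wv': "exact (\<lambda>X Y Z. ?L X Y Z + \<alpha> * ?C X Y Z - ?H X Y Z)" by simp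
  \<comment> \<open>The relations express every term by \<open>?A\<close>: \<open>?H = 2 ?A\<close>, \<open>?L = - 3 ?A\<close>, \<open>\<alpha> ?C = 5 ?A\<close> and
    \<open>?B = - 6 ?A\<close>, while \<open>?B\<close> or \<open>\<alpha> ?C\<close> vanishes.\<close>
  have H2A: "exact (\<lambda>X Y Z. ?H X Y Z - 2 * ?A X Y Z)"
    by (rule exact_comb[OF wv yy, where r = 1 and s = "-1"]) simp
  have L3A: "exact (\<lambda>X Y Z. ?L X Y Z + 3 * ?A X Y Z)"
    by (rule exact_comb[OF xx H2A, where r = 1 and s = "-1"]) simp
  have "exact (\<lambda>X Y Z. \<alpha> * ?C X Y Z - ?H X Y Z - 3 * ?A X Y Z)"
    by (rule exact_comb[OF wv' L3A, where r = 1 and s = "-1"]) simp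
  from exact_comb[OF this H2A, where r = 1 and s = 1]
  have C5A: "exact (\<lambda>X Y Z. \<alpha> * ?C X Y Z - 5 * ?A X Y Z)" by (simp add: algebra_simps)
  have A: "exact ?A"
  proof (cases "r = 0")
    case True
    then have "\<And>X Y Z. ?B X Y Z = 0" by (simp add: wedge3_def form_linear)
    then show ?thesis
      using exact_comb[OF yy C5A, of ?A "1/6" "-1/6"] by (simp add: field_simps)
  next
    case False
    then have rr: "\<phi> r r \<noteq> 0" using r by simp
    have "exact (\<lambda>X Y Z. \<phi> r r * ?C X Y Z - ?R X Y Z)"
      by (rule exact_cong[OF exact_form_wedge[of v' r]]) (simp add: defs)
    from exact_comb[OF this xy', where r = 1 and s = 1]
    have "exact (\<lambda>X Y Z. \<phi> r r * ?C X Y Z + \<alpha> * ?E X Y Z)" by simp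
    from exact_comb[OF this E, where r = "1 / \<phi> r r" and s = "- \<alpha> / \<phi> r r"]
    have "exact ?C" using rr by (simp add: field_simps)
    from exact_comb[OF C5A this, of ?A "-1/5" "\<alpha> / 5"] show ?thesis by (simp add: field_simps)
  qed
  have "exact (\<lambda>X Y Z. ?A X Y Z + \<omega> X Y Z)"
    by (rule exact_comb[OF xx yy, where r = 1 and s = 1]) (simp add: om)
  from exact_comb[OF this A, of \<omega> 1 "-1"] show ?thesis by simp
qed

text \<open>The Euler operator counts closed factors: the mixed terms appear twice and the product
  of \<open>a\<close>, \<open>b\<close>, \<open>c\<close> three times. The surplus copy of that
  product is exact because contraction by \<open>f\<close> isolates it.\<close>

lemma exact_three_frame_trivial:
  assumes abc: "closed1 a" "closed1 b" "closed1 c"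
    and om: "\<And>X Y Z. \<omega> X Y Z = \<theta> * wedge3 a b c X Y Z + wedge3 a b (\<phi> r) X Y Z
       + wedge3 a c (\<phi> p) X Y Z + wedge3 b c (\<phi> q) X Y Z"
    and xyz: "a x = 1" "b x = 0" "c x = 0" "a y = 0" "b y = 1" "c y = 0" "a z = 0" "b z = 0" "c z = 1"
    and W: "\<And>t. t \<in> {r, p, q, f} \<Longrightarrow> a t = 0 \<and> b t = 0 \<and> c t = 0 \<and> \<phi> t x = 0 \<and> \<phi> t y = 0 \<and> \<phi> t z = 0"
    and f: "\<phi> r f \<noteq> 0 \<or> \<phi> p f \<noteq> 0 \<or> \<phi> q f \<noteq> 0"
  shows "exact \<omega>"
proof -
  have W': "a f = 0" "b f = 0" "c f = 0" "\<phi> r x = 0" "\<phi> r y = 0" "\<phi> r z = 0"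
     "\<phi> p x = 0" "\<phi> p y = 0" "\<phi> p z = 0" "\<phi> q x = 0" "\<phi> q y = 0" "\<phi> q z = 0"
    using W by auto
  note defs = om xyz W' wedge3_def algebra_simps
  have "exact (\<lambda>X Y Z. \<phi> r f * wedge3 a b c X Y Z)"
    by (rule exact_cong[OF exact_wedge1[OF abc(3), of f]]) (simp add: defs)
  moreover have "exact (\<lambda>X Y Z. \<phi> p f * wedge3 a b c X Y Z)"
    by (rule exact_scale[OF exact_wedge1[OF abc(2), of f], where r = "-1"]) (simp add: defs)
  moreover have "exact (\<lambda>X Y Z. \<phi> q f * wedge3 a b c X Y Z)"
    by (rule exact_cong[OF exact_wedge1[OF abc(1), of f]]) (simp add: defs)
  moreover have "exact (wedge3 a b c)" if "exact (\<lambda>X Y Z. k * wedge3 a b c X Y Z)" "k \<noteq> 0" for k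
    using exact_scale[OF that(1), of "wedge3 a b c" "1/k"] that(2) by simp
  ultimately have 0: "exact (wedge3 a b c)" using f by blast
  have 1: "exact (\<lambda>X Y Z. \<theta> * wedge3 a b c X Y Z + wedge3 a b (\<phi> r) X Y Z + wedge3 a c (\<phi> p) X Y Z)"
    by (rule exact_cong[OF exact_wedge1[OF abc(1), of x]]) (simp add: defs)
  have 2: "exact (\<lambda>X Y Z. \<theta> * wedge3 a b c X Y Z + wedge3 a b (\<phi> r) X Y Z + wedge3 b c (\<phi> q) X Y Z)"
    by (rule exact_cong[OF exact_wedge1[OF abc(2), of y]]) (simp add: defs)
  have 3: "exact (\<lambda>X Y Z. \<theta> * wedge3 a b c X Y Z + wedge3 a c (\<phi> p) X Y Z + wedge3 b c (\<phi> q) X Y Z)"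
    by (rule exact_cong[OF exact_wedge1[OF abc(3), of z]]) (simp add: defs)
  from exact_comb[OF exact_comb[OF 1 2 refl, of 1 1] 3, of "\<lambda>X Y Z. 2 * \<omega> X Y Z + \<theta> * wedge3 a b c X Y Z" 1 1]
  have "exact (\<lambda>X Y Z. 2 * \<omega> X Y Z + \<theta> * wedge3 a b c X Y Z)" by (simp add: om algebra_simps)
  from exact_comb[OF this 0, of \<omega> "1/2" "- \<theta>/2"] show ?thesis by (simp add: field_simps)
qed


text \<open>All terms involving \<open>p2\<close>, \<open>p3\<close>, \<open>p4\<close> contain
  \<open>a1\<close>, so wedging \<open>a1\<close> with the contractions by \<open>x2\<close>,
  \<open>x3\<close>, \<open>x4\<close> leaves multiples of \<open>t234\<close> only. If
  \<open>t234 = 0\<close>, \<omega> is already \<open>a1\<close> times its contraction by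
  \<open>x1\<close>; otherwise the products of \<open>a1\<close> with two other coordinates are
  exact, and the Euler count over the remaining generators finishes.\<close>

lemma exact_four_frame_divisible:
  assumes a: "closed1 a1" "closed1 a2" "closed1 a3" "closed1 a4"
    and om: "\<And>X Y Z. \<omega> X Y Z = t123 * wedge3 a1 a2 a3 X Y Z + t124 * wedge3 a1 a2 a4 X Y Z
       + t134 * wedge3 a1 a3 a4 X Y Z + t234 * wedge3 a2 a3 a4 X Y Z
       + wedge3 a1 a2 (\<phi> p2) X Y Z + wedge3 a1 a3 (\<phi> p3) X Y Z + wedge3 a1 a4 (\<phi> p4) X Y Z"
    and x: "a1 x1 = 1" "a1 x2 = 0" "a1 x3 = 0" "a1 x4 = 0" "a2 x1 = 0" "a2 x2 = 1" "a2 x3 = 0" "a2 x4 = 0"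
      "a3 x1 = 0" "a3 x2 = 0" "a3 x3 = 1" "a3 x4 = 0" "a4 x1 = 0" "a4 x2 = 0" "a4 x3 = 0" "a4 x4 = 1"
    and W: "\<And>t. t \<in> {p2, p3, p4} \<Longrightarrow> \<phi> t x1 = 0 \<and> \<phi> t x2 = 0 \<and> \<phi> t x3 = 0 \<and> \<phi> t x4 = 0"
  shows "exact \<omega>"
proof -
  have W': "\<phi> p2 x1 = 0" "\<phi> p3 x1 = 0" "\<phi> p4 x1 = 0" "\<phi> p2 x2 = 0" "\<phi> p3 x2 = 0" "\<phi> p4 x2 = 0"
    "\<phi> p2 x3 = 0" "\<phi> p3 x3 = 0" "\<phi> p4 x3 = 0" "\<phi> p2 x4 = 0" "\<phi> p3 x4 = 0" "\<phi> p4 x4 = 0"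
    using W by auto
  note defs = om x W' wedge3_def algebra_simps
  let ?T = "\<lambda>X Y Z. t123 * wedge3 a1 a2 a3 X Y Z + t124 * wedge3 a1 a2 a4 X Y Z + t134 * wedge3 a1 a3 a4 X Y Z"
  let ?B = "\<lambda>X Y Z. wedge3 a1 a2 (\<phi> p2) X Y Z + wedge3 a1 a3 (\<phi> p3) X Y Z + wedge3 a1 a4 (\<phi> p4) X Y Z"
  have TB: "exact (\<lambda>X Y Z. ?T X Y Z + ?B X Y Z)"
    by (rule exact_cong[OF exact_wedge1[OF a(1), of x1]]) (simp add: defs)
  show ?thesis
  proof (cases "t234 = 0")
    case True
    show ?thesis by (rule exact_cong[OF TB]) (simp add: om True)
  next
    case False
    have *: "exact \<tau>" if "exact (\<lambda>X Y Z. t234 * \<tau> X Y Z)" for \<tau>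
      by (rule exact_scale[OF that, where r = "1 / t234"]) (simp add: False)
    have e1: "exact (wedge3 a1 a3 a4)"
      by (rule *, rule exact_cong[OF exact_wedge1[OF a(1), of x2]]) (simp add: defs)
    have e2: "exact (wedge3 a1 a2 a4)"
      by (rule *, rule exact_scale[OF exact_wedge1[OF a(1), of x3], where r = "-1"]) (simp add: defs)
    have e3: "exact (wedge3 a1 a2 a3)"
      by (rule *, rule exact_cong[OF exact_wedge1[OF a(1), of x4]]) (simp add: defs)
    have T: "exact ?T"
      by (rule exact_comb[OF exact_comb[OF e3 e2 refl, of t123 t124] e1, of _ 1 t134]) simp
    have B: "exact ?B" by (rule exact_comb[OF TB T, where r = 1 and s = "-1"]) simp
    have 2: "exact (\<lambda>X Y Z. t123 * wedge3 a1 a2 a3 X Y Z + t124 * wedge3 a1 a2 a4 X Y Z + t234 * wedge3 a2 a3 a4 X Y Z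
        + wedge3 a1 a2 (\<phi> p2) X Y Z)"
      by (rule exact_cong[OF exact_wedge1[OF a(2), of x2]]) (simp add: defs)
    have 3: "exact (\<lambda>X Y Z. t123 * wedge3 a1 a2 a3 X Y Z + t134 * wedge3 a1 a3 a4 X Y Z + t234 * wedge3 a2 a3 a4 X Y Z
        + wedge3 a1 a3 (\<phi> p3) X Y Z)"
      by (rule exact_cong[OF exact_wedge1[OF a(3), of x3]]) (simp add: defs)
    have 4: "exact (\<lambda>X Y Z. t124 * wedge3 a1 a2 a4 X Y Z + t134 * wedge3 a1 a3 a4 X Y Z + t234 * wedge3 a2 a3 a4 X Y Z
        + wedge3 a1 a4 (\<phi> p4) X Y Z)"
      by (rule exact_cong[OF exact_wedge1[OF a(4), of x4]]) (simp add: defs)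
    have S: "exact (\<lambda>X Y Z. 3 * \<omega> X Y Z - ?T X Y Z - 2 * ?B X Y Z)"
      by (rule exact_comb[OF exact_comb[OF 2 3 refl, of 1 1] 4, of _ 1 1]) (simp add: om algebra_simps)
    from exact_comb[OF S T, of "\<lambda>X Y Z. 3 * \<omega> X Y Z - 2 * ?B X Y Z" 1 1]
    have "exact (\<lambda>X Y Z. 3 * \<omega> X Y Z - 2 * ?B X Y Z)" by simp
    from exact_comb[OF this B, of \<omega> "1/3" "2/3"] show ?thesis by (simp add: field_simps)
  qed
qed

text \<open>The Euler count over four generators weighs purely closed terms by three and mixed ones
  by two; \<open>T\<close> disposes of the surplus.\<close>

lemma exact_four_frame_total:
  assumes a: "closed1 a1" "closed1 a2" "closed1 a3" "closed1 a4"
    and om: "\<And>X Y Z. \<omega> X Y Z = t123 * wedge3 a1 a2 a3 X Y Z + t124 * wedge3 a1 a2 a4 X Y Z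
       + t134 * wedge3 a1 a3 a4 X Y Z + t234 * wedge3 a2 a3 a4 X Y Z
       + wedge3 a1 a2 (\<phi> p12) X Y Z + wedge3 a1 a3 (\<phi> p13) X Y Z + wedge3 a1 a4 (\<phi> p14) X Y Z
       + wedge3 a2 a3 (\<phi> p23) X Y Z + wedge3 a2 a4 (\<phi> p24) X Y Z + wedge3 a3 a4 (\<phi> p34) X Y Z"
    and x: "a1 x1 = 1" "a1 x2 = 0" "a1 x3 = 0" "a1 x4 = 0" "a2 x1 = 0" "a2 x2 = 1" "a2 x3 = 0" "a2 x4 = 0"
      "a3 x1 = 0" "a3 x2 = 0" "a3 x3 = 1" "a3 x4 = 0" "a4 x1 = 0" "a4 x2 = 0" "a4 x3 = 0" "a4 x4 = 1"
    and W: "\<And>t. t \<in> {p12, p13, p14, p23, p24, p34} \<Longrightarrow> \<phi> t x1 = 0 \<and> \<phi> t x2 = 0 \<and> \<phi> t x3 = 0 \<and> \<phi> t x4 = 0"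
    and T: "exact (wedge3 a1 a2 a3)" "exact (wedge3 a1 a2 a4)" "exact (wedge3 a1 a3 a4)" "exact (wedge3 a2 a3 a4)"
  shows "exact \<omega>"
proof -
  have W': "\<phi> t x1 = 0" "\<phi> t x2 = 0" "\<phi> t x3 = 0" "\<phi> t x4 = 0"
    if "t = p12 \<or> t = p13 \<or> t = p14 \<or> t = p23 \<or> t = p24 \<or> t = p34" for t
    using W[of t] that by auto
  note defs = om x W' wedge3_def algebra_simps
  let ?T = "\<lambda>X Y Z. t123 * wedge3 a1 a2 a3 X Y Z + t124 * wedge3 a1 a2 a4 X Y Z
       + t134 * wedge3 a1 a3 a4 X Y Z + t234 * wedge3 a2 a3 a4 X Y Z"
  have T': "exact ?T"
    by (rule exact_comb[OF exact_comb[OF exact_comb[OF T(1) T(2) refl, of t123 t124] T(3) refl, of 1 t134] T(4), of _ 1 t234]) simp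
  have 1: "exact (\<lambda>X Y Z. t123 * wedge3 a1 a2 a3 X Y Z + t124 * wedge3 a1 a2 a4 X Y Z + t134 * wedge3 a1 a3 a4 X Y Z
      + wedge3 a1 a2 (\<phi> p12) X Y Z + wedge3 a1 a3 (\<phi> p13) X Y Z + wedge3 a1 a4 (\<phi> p14) X Y Z)"
    by (rule exact_cong[OF exact_wedge1[OF a(1), of x1]]) (simp add: defs)
  have 2: "exact (\<lambda>X Y Z. t123 * wedge3 a1 a2 a3 X Y Z + t124 * wedge3 a1 a2 a4 X Y Z + t234 * wedge3 a2 a3 a4 X Y Z
      + wedge3 a1 a2 (\<phi> p12) X Y Z + wedge3 a2 a3 (\<phi> p23) X Y Z + wedge3 a2 a4 (\<phi> p24) X Y Z)"
    by (rule exact_cong[OF exact_wedge1[OF a(2), of x2]]) (simp add: defs)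
  have 3: "exact (\<lambda>X Y Z. t123 * wedge3 a1 a2 a3 X Y Z + t134 * wedge3 a1 a3 a4 X Y Z + t234 * wedge3 a2 a3 a4 X Y Z
      + wedge3 a1 a3 (\<phi> p13) X Y Z + wedge3 a2 a3 (\<phi> p23) X Y Z + wedge3 a3 a4 (\<phi> p34) X Y Z)"
    by (rule exact_cong[OF exact_wedge1[OF a(3), of x3]]) (simp add: defs)
  have 4: "exact (\<lambda>X Y Z. t124 * wedge3 a1 a2 a4 X Y Z + t134 * wedge3 a1 a3 a4 X Y Z + t234 * wedge3 a2 a3 a4 X Y Z
      + wedge3 a1 a4 (\<phi> p14) X Y Z + wedge3 a2 a4 (\<phi> p24) X Y Z + wedge3 a3 a4 (\<phi> p34) X Y Z)"
    by (rule exact_cong[OF exact_wedge1[OF a(4), of x4]]) (simp add: defs)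
  have "exact (\<lambda>X Y Z. 2 * \<omega> X Y Z + ?T X Y Z)"
    by (rule exact_comb[OF exact_comb[OF 1 2 refl, of 1 1] exact_comb[OF 3 4 refl, of 1 1], of _ 1 1])
      (simp add: om algebra_simps)
  from exact_comb[OF this T', of \<omega> "1/2" "-1/2"] show ?thesis by (simp add: field_simps)
qed

end

text \<open>The normal form in which \<open>z\<close> acts trivially on \<open>W\<close>. It arises
  with \<open>w\<close>, \<open>p\<close>, \<open>q\<close> the projected brackets of
  \<open>x y\<close>, \<open>x z\<close>, \<open>y z\<close>, and \<open>e\<close>,
  \<open>e'\<close> the images of \<open>w\<close> under \<open>x\<close> and
  \<open>y\<close>.\<close>

locale three_frame = invariant_form +
  fixes x y z v w e e' p q and a b c and \<theta> :: real
  assumes closed: "closed1 a" "closed1 b" "closed1 c"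
    and om: "\<And>X Y Z. \<omega> X Y Z = \<theta> * wedge3 a b c X Y Z + wedge3 a b (\<phi> w) X Y Z
       + wedge3 a c (\<phi> p) X Y Z + wedge3 b c (\<phi> q) X Y Z
       + wedge3 a (\<phi> v) (\<phi> e) X Y Z + wedge3 b (\<phi> v) (\<phi> e') X Y Z"
    and xyz: "a x = 1" "b x = 0" "c x = 0" "a y = 0" "b y = 1" "c y = 0" "a z = 0" "b z = 0" "c z = 1"
    and W: "\<And>t. t \<in> {v, w, e, e', p, q} \<Longrightarrow> a t = 0 \<and> b t = 0 \<and> c t = 0 \<and> \<phi> t x = 0 \<and> \<phi> t y = 0 \<and> \<phi> t z = 0"
    and g: "\<phi> v v = 0" "\<phi> v w = 1" "\<phi> v e = 0" "\<phi> v e' = 0" "\<phi> w e = 0" "\<phi> w e' = 0" "\<phi> v p = 0" "\<phi> v q = 0"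
begin

lemma form_values: "\<phi> w v = 1" "\<phi> e v = 0" "\<phi> e' v = 0" "\<phi> e w = 0" "\<phi> e' w = 0" "\<phi> p v = 0" "\<phi> q v = 0"
  using g by (metis form_sym)+

lemma frame_values:
  "a v = 0" "a w = 0" "a e = 0" "a e' = 0" "a p = 0" "a q = 0"
  "b v = 0" "b w = 0" "b e = 0" "b e' = 0" "b p = 0" "b q = 0"
  "c v = 0" "c w = 0" "c e = 0" "c e' = 0" "c p = 0" "c q = 0"
  "\<phi> v x = 0" "\<phi> w x = 0" "\<phi> e x = 0" "\<phi> e' x = 0" "\<phi> p x = 0" "\<phi> q x = 0"
  "\<phi> v y = 0" "\<phi> w y = 0" "\<phi> e y = 0" "\<phi> e' y = 0" "\<phi> p y = 0" "\<phi> q y = 0"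
  "\<phi> v z = 0" "\<phi> w z = 0" "\<phi> e z = 0" "\<phi> e' z = 0" "\<phi> p z = 0" "\<phi> q z = 0"
  using W by auto

lemmas expand = om xyz g form_values frame_values wedge3_def algebra_simps

text \<open>Contraction by \<open>v\<close> leaves the product of \<open>a\<close> and
  \<open>b\<close>, as \<open>v\<close> pairs to 1 with \<open>w\<close> and to 0 with
  \<open>p\<close> and \<open>q\<close>. All later relations are read modulo this form.\<close>

lemma exact_abc: "exact (wedge3 a b c)"
  by (rule exact_cong[OF exact_wedge1[OF closed(3), of v]]) (simp add: expand)

lemma drop_abc:
  assumes "exact (\<lambda>X Y Z. r * wedge3 a b c X Y Z + \<tau> X Y Z)"
  shows "exact \<tau>"
  by (rule exact_comb[OF assms exact_abc, where r = 1 and s = "-r"]) simp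

lemma exact_zz: "exact (\<lambda>X Y Z. wedge3 a c (\<phi> p) X Y Z + wedge3 b c (\<phi> q) X Y Z)"
  by (rule drop_abc[where r = \<theta>], rule exact_cong[OF exact_wedge1[OF closed(3), of z]]) (simp add: expand)

lemma exact_xx: "exact (\<lambda>X Y Z. wedge3 a b (\<phi> w) X Y Z + wedge3 a c (\<phi> p) X Y Z + wedge3 a (\<phi> v) (\<phi> e) X Y Z)"
  by (rule drop_abc[where r = \<theta>], rule exact_cong[OF exact_wedge1[OF closed(1), of x]]) (simp add: expand)

lemma exact_yy: "exact (\<lambda>X Y Z. wedge3 a b (\<phi> w) X Y Z + wedge3 b c (\<phi> q) X Y Z + wedge3 b (\<phi> v) (\<phi> e') X Y Z)"
  by (rule drop_abc[where r = \<theta>], rule exact_cong[OF exact_wedge1[OF closed(2), of y]]) (simp add: expand)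

lemma exact_xy: "exact (\<lambda>X Y Z. wedge3 a c (\<phi> q) X Y Z + wedge3 a (\<phi> v) (\<phi> e') X Y Z)"
  by (rule exact_cong[OF exact_wedge1[OF closed(1), of y]]) (simp add: expand)

lemma exact_zw: "exact (\<lambda>X Y Z. wedge3 a c (\<phi> e) X Y Z + wedge3 b c (\<phi> e') X Y Z)"
  by (rule drop_abc[where r = "\<phi> w w"], rule exact_cong[OF exact_wedge1[OF closed(3), of w]]) (simp add: expand)

lemma exact_yw: "exact (wedge3 a b (\<phi> e))"
  by (rule drop_abc[where r = "- \<phi> p w"], rule exact_cong[OF exact_wedge1[OF closed(2), of w]]) (simp add: expand)

lemma exact_wv: "exact (\<lambda>X Y Z. wedge3 a (\<phi> v) (\<phi> e) X Y Z + wedge3 b (\<phi> v) (\<phi> e') X Y Z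
    - wedge3 a b (\<phi> w) X Y Z + \<phi> w w * wedge3 a b (\<phi> v) X Y Z
    + \<phi> p w * wedge3 a c (\<phi> v) X Y Z + \<phi> q w * wedge3 b c (\<phi> v) X Y Z)"
  by (rule exact_cong[OF exact_form_wedge[of v w]]) (simp add: expand)

lemma exact_yu:
  assumes "a u = 0" "b u = 0" "c u = 0" and u: "\<phi> e u = 1"
  shows "exact (wedge3 a b (\<phi> v))"
proof -
  have "exact (\<lambda>X Y Z. \<phi> v u * wedge3 a b (\<phi> e) X Y Z - wedge3 a b (\<phi> v) X Y Z)"
    by (rule drop_abc[where r = "- \<phi> p u"], rule exact_cong[OF exact_wedge1[OF closed(2), of u]])
      (simp add: expand assms)
  from exact_comb[OF this exact_yw, of "wedge3 a b (\<phi> v)" "-1" "\<phi> v u"] show ?thesis by simp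
qed

lemma exact_zu:
  assumes "a u = 0" "b u = 0" "c u = 0"
  shows "exact (\<lambda>X Y Z. \<phi> e u * wedge3 a c (\<phi> v) X Y Z + \<phi> e' u * wedge3 b c (\<phi> v) X Y Z)"
proof -
  have "exact (\<lambda>X Y Z. \<phi> v u * (wedge3 a c (\<phi> e) X Y Z + wedge3 b c (\<phi> e') X Y Z)
     - (\<phi> e u * wedge3 a c (\<phi> v) X Y Z + \<phi> e' u * wedge3 b c (\<phi> v) X Y Z))"
    by (rule drop_abc[where r = "\<phi> w u"], rule exact_cong[OF exact_wedge1[OF closed(3), of u]])
      (simp add: expand assms)
  from exact_comb[OF this exact_zw, of _ "-1" "\<phi> v u"] show ?thesis by simp
qed

text \<open>Vectors dual to \<open>e\<close> and \<open>e'\<close> make the three error terms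
  containing \<open>\<phi> v\<close> exact. What remains is the count for two generators, ending in
  three times the product of \<open>a\<close>, \<open>b\<close>, \<open>\<phi> w\<close>.\<close>

lemma exact_rank_two:
  assumes u: "a u = 0" "b u = 0" "c u = 0" "\<phi> e u = 1" "\<phi> e' u = 0"
    and u': "a u' = 0" "b u' = 0" "c u' = 0" "\<phi> e u' = 0" "\<phi> e' u' = 1"
  shows "exact \<omega>"
proof -
  have acv: "exact (wedge3 a c (\<phi> v))" using exact_zu[OF u(1-3)] u by simp
  have bcv: "exact (wedge3 b c (\<phi> v))" using exact_zu[OF u'(1-3)] u' by simp
  have 1: "exact (\<lambda>X Y Z. wedge3 a (\<phi> v) (\<phi> e) X Y Z + wedge3 b (\<phi> v) (\<phi> e') X Y Z
    - wedge3 a b (\<phi> w) X Y Z)"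
    by (rule exact_comb[OF exact_comb[OF exact_comb[OF exact_wv exact_yu[OF u(1-4)] refl, of 1 "- \<phi> w w"]
           acv refl, of 1 "- \<phi> p w"] bcv, of _ 1 "- \<phi> q w"]) simp
  have 2: "exact (\<lambda>X Y Z. 2 * wedge3 a b (\<phi> w) X Y Z + wedge3 a (\<phi> v) (\<phi> e) X Y Z + wedge3 b (\<phi> v) (\<phi> e') X Y Z)"
    by (rule exact_comb[OF exact_comb[OF exact_xx exact_yy refl, of 1 1] exact_zz, of _ 1 "-1"]) simp
  have 3: "exact (wedge3 a b (\<phi> w))"
    by (rule exact_comb[OF 2 1, where r = "1/3" and s = "-1/3"]) (simp add: field_simps)
  show ?thesis
    by (rule exact_comb[OF exact_comb[OF exact_comb[OF 2 3 refl, of 1 "-1"] exact_zz refl, of 1 1] exact_abc, of _ 1 \<theta>])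
      (simp add: om)
qed

text \<open>Modulo exact forms \<open>?P = ?A\<close>, \<open>?Q = - ?A\<close>,
  \<open>?R = - 2 ?A\<close> and \<open>\<phi> q w * ?B = 3 ?A\<close>. Each alternative in
  \<open>cases\<close> adds a relation that only \<open>?A = 0\<close> satisfies; the final
  coefficients are 1, 4 and 7.\<close>

lemma exact_rank_one:
  assumes u: "a u = 0" "b u = 0" "c u = 0" "\<phi> e u = 1" and e': "e' = 0" and qe: "\<phi> q e = 0"
    and cases: "p = \<alpha> *\<^sub>R v + \<beta> *\<^sub>R e + \<gamma> *\<^sub>R q \<or> q = \<alpha> *\<^sub>R v \<or>
      q = \<alpha> *\<^sub>R v + \<kappa> *\<^sub>R e \<and> \<phi> e e = 0 \<and> \<phi> e p \<noteq> 0"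
  shows "exact \<omega>"
proof -
  let ?A = "wedge3 a b (\<phi> w)" and ?P = "wedge3 a c (\<phi> p)" and ?Q = "wedge3 b c (\<phi> q)"
    and ?R = "wedge3 a (\<phi> v) (\<phi> e)" and ?B = "wedge3 b c (\<phi> v)"
  have e'0: "wedge3 f g (\<phi> e') X Y Z = 0" for f g X Y Z
    by (simp add: wedge3_def e' form_linear)
  have acv: "exact (wedge3 a c (\<phi> v))" using exact_zu[OF u(1-3)] u by (simp add: e' form_linear)
  have ace: "exact (wedge3 a c (\<phi> e))" using exact_zw by (simp add: e'0)
  have acq: "exact (wedge3 a c (\<phi> q))" using exact_xy by (simp add: e'0)
  have PA: "exact (\<lambda>X Y Z. ?P X Y Z - ?A X Y Z)"
    by (rule exact_comb[OF exact_zz exact_yy, where r = 1 and s = "-1"]) (simp add: e'0)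
  have QA: "exact (\<lambda>X Y Z. ?Q X Y Z + ?A X Y Z)"
    by (rule exact_cong[OF exact_yy]) (simp add: e'0)
  have RA: "exact (\<lambda>X Y Z. ?R X Y Z + 2 * ?A X Y Z)"
    by (rule exact_comb[OF exact_xx PA, where r = 1 and s = "-1"]) simp
  have wv: "exact (\<lambda>X Y Z. ?R X Y Z - ?A X Y Z + \<phi> q w * ?B X Y Z)"
    by (rule exact_comb[OF exact_comb[OF exact_wv exact_yu[OF u] refl, of 1 "- \<phi> w w"]
           acv, of _ 1 "- \<phi> p w"]) (simp add: e'0)
  have BA: "exact (\<lambda>X Y Z. \<phi> q w * ?B X Y Z - 3 * ?A X Y Z)"
    by (rule exact_comb[OF wv RA, where r = 1 and s = "-1"]) simp
  have A: "exact ?A"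
    using cases
  proof (elim disjE conjE)
    assume p: "p = \<alpha> *\<^sub>R v + \<beta> *\<^sub>R e + \<gamma> *\<^sub>R q"
    have "?P X Y Z = \<alpha> * wedge3 a c (\<phi> v) X Y Z + \<beta> * wedge3 a c (\<phi> e) X Y Z + \<gamma> * wedge3 a c (\<phi> q) X Y Z" for X Y Z
      by (simp add: p wedge3_def form_linear algebra_simps)
    then have "exact ?P"
      by (intro exact_comb[OF exact_comb[OF acv ace refl, of \<alpha> \<beta>] acq, of _ 1 \<gamma>]) simp
    from exact_comb[OF PA this, of ?A "-1" 1] show ?thesis by simp
  next
    assume q: "q = \<alpha> *\<^sub>R v"
    have "?Q X Y Z = \<phi> q w * ?B X Y Z" for X Y Z
      using g by (simp add: q wedge3_def form_linear algebra_simps)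
    then show ?thesis
      using exact_comb[OF QA BA, of ?A "1/4" "-1/4"] by (simp add: field_simps)
  next
    assume q: "q = \<alpha> *\<^sub>R v + \<kappa> *\<^sub>R e" and ee: "\<phi> e e = 0" and ep: "\<phi> e p \<noteq> 0"
    have qw: "\<phi> q w = \<alpha>" by (simp add: q form_linear g form_values)
    have pe: "\<phi> p e = \<phi> e p" by (rule form_sym)
    have qp: "\<phi> q p = \<kappa> * \<phi> e p" by (simp add: q form_linear g)
    have Q: "?Q X Y Z = \<alpha> * ?B X Y Z + \<kappa> * wedge3 b c (\<phi> e) X Y Z" for X Y Z
      by (simp add: q wedge3_def form_linear algebra_simps)
    have "exact (\<lambda>X Y Z. \<phi> e p * (?P X Y Z - \<kappa> * wedge3 b c (\<phi> e) X Y Z - ?R X Y Z)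
        - \<phi> w p * wedge3 a b (\<phi> e) X Y Z - \<phi> p p * wedge3 a c (\<phi> e) X Y Z)"
      by (rule exact_cong[OF exact_form_wedge[of p e]])
        (simp add: om xyz g form_values frame_values wedge3_def ee pe qp qe e' form_linear algebra_simps)
    from exact_comb[OF exact_comb[OF this exact_yw refl, of 1 "\<phi> w p"] ace, of _ "1 / \<phi> e p" "\<phi> p p / \<phi> e p"]
    have "exact (\<lambda>X Y Z. ?P X Y Z - \<kappa> * wedge3 b c (\<phi> e) X Y Z - ?R X Y Z)"
      using ep by (simp add: field_simps)
    \<comment> \<open>With \<open>?Q = \<alpha> ?B + \<kappa> wedge3 b c (\<phi> e)\<close> these relations add up to \<open>7 ?A\<close>.\<close>
    from exact_comb[OF exact_comb[OF exact_comb[OF exact_comb[OF this PA refl, of 1 "-1"] QA refl, of 1 1] BA refl, of 1 "-1"] RA, of ?A "1/7" "1/7"]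
    show ?thesis by (simp add: Q qw field_simps)
  qed
  show ?thesis
    by (rule exact_comb[OF exact_comb[OF exact_comb[OF exact_comb[OF RA A refl, of 1 "-1"] QA refl, of 1 1]
          PA refl, of 1 1] exact_comb[OF A exact_abc refl, of 0 1], of _ 1 \<theta>])
      (simp add: om e'0)
qed

end

subsection \<open>Reduction to the action on the derived algebra\<close>

text \<open>In \<open>reduced_form\<close> the vectors \<open>x i\<close> span a complement of \<open>G + Z\<close>, \<open>a i\<close> are the dual coordinates
  and \<open>\<pi>\<close> is the orthogonal projection onto \<open>W\<close>. A vector is determined modulo \<open>Z\<close> by its \<open>a\<close>-coordinates
  and its projection, which is all that \<open>\<omega>\<close> sees. Only \<open>i < k\<close> is meaningful.\<close>

locale nilpotent_form = invariant_form br \<phi> + fin_dim S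
  for br :: "'a::real_vector \<Rightarrow> 'a \<Rightarrow> 'a" and \<phi> and S :: "'a set" +
  assumes nilpotent: "nilpotent_lie br"

locale reduced_form = nilpotent_form +
  fixes W \<pi> and k :: nat and x :: "nat \<Rightarrow> 'a" and a :: "nat \<Rightarrow> 'a \<Rightarrow> real"
  assumes subspace_W: "subspace W"
    and nondeg: "\<And>p. p \<in> W \<Longrightarrow> (\<And>q. q \<in> W \<Longrightarrow> \<phi> p q = 0) \<Longrightarrow> p = 0"
    and linear_\<pi>: "linear \<pi>" and \<pi>_W: "\<And>X. \<pi> X \<in> W"
    and form_\<pi>: "\<And>X p. p \<in> W \<Longrightarrow> \<phi> (\<pi> X) p = \<phi> X p"
    and closed_a: "\<And>i. i < k \<Longrightarrow> closed1 (a i)"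
    and a_W: "\<And>i p. i < k \<Longrightarrow> p \<in> W \<Longrightarrow> a i p = 0"
    and a_x: "\<And>i j. i < k \<Longrightarrow> j < k \<Longrightarrow> a i (x j) = (if i = j then 1 else 0)"
    and W_x: "\<And>i p. i < k \<Longrightarrow> p \<in> W \<Longrightarrow> \<phi> p (x i) = 0"
    and \<omega>_decomp: "\<And>X Y Z. \<omega> X Y Z = \<omega> ((\<Sum>i<k. a i X *\<^sub>R x i) + \<pi> X) Y Z"
    and \<omega>_br: "\<And>X Y U V. \<omega> (br X Y) U V = \<omega> (\<pi> (br X Y)) U V"
    and radical_W: "\<And>X p. (\<And>U V. \<omega> X U V = 0) \<Longrightarrow> p \<in> W \<Longrightarrow> \<phi> X p = 0"

section \<open>Construction of a reduced form\<close>

context nilpotent_form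
begin

lemma reduced_form_exists:
  obtains W \<pi> k x a where "reduced_form br \<phi> S W \<pi> k x a" "2 * k + dim W \<le> dim (UNIV :: 'a set)"
proof -
  have lin1: "linear (\<phi> X)" for X using bilinear_form by (simp add: bilinear_def)
  define G where "G = {br X Y | X Y. True}"
  define Z where "Z = {X. \<forall>u\<in>G. \<phi> X u = 0}"
  have Z_iff: "X \<in> Z \<longleftrightarrow> (\<forall>U V. \<omega> X U V = 0)" for X
    unfolding Z_def G_def form_br_eq(2)[symmetric] by blast
  have sZ: "subspace Z"
    unfolding Z_def real_vector.subspace_def by (auto simp: form_linear)
  obtain BZ where BZ: "BZ \<subseteq> Z" "independent BZ" "Z \<subseteq> span BZ" "card BZ = dim Z"
    using real_vector.basis_exists by blast
  have spZ: "span BZ = Z" using BZ sZ by (metis real_vector.span_minimal subset_antisym)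
  \<comment> \<open>Completing the basis of \<open>Z\<close> by brackets puts \<open>W\<close>, the
    span of the added vectors, inside the derived algebra. \<open>G\<close> is just the set of
    brackets; \<open>span B1\<close> is the sum of \<open>Z\<close> and
    \<open>span G\<close>.\<close>
  obtain B1 where B1: "BZ \<subseteq> B1" "B1 \<subseteq> BZ \<union> G" "independent B1" "BZ \<union> G \<subseteq> span B1"
    using real_vector.maximal_independent_subset_extend[of BZ "BZ \<union> G"] BZ by auto
  obtain B where B: "B1 \<subseteq> B" "independent B" "UNIV \<subseteq> span B"
    using real_vector.maximal_independent_subset_extend[of B1 UNIV] B1 by auto
  have fB: "finite B" "finite B1" "finite BZ" using B(2) B1(3) BZ(2) by (simp_all add: finite_independent)
  define BW where "BW = B1 - BZ"
  define BV where "BV = B - B1"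
  define W where "W = span BW"
  define k where "k = card BV"
  have BWG: "BW \<subseteq> G" using B1 by (auto simp: BW_def)
  have iW: "independent BW" using real_vector.independent_mono[OF B1(3), of BW] by (auto simp: BW_def)
  have sW: "subspace W" by (simp add: W_def real_vector.subspace_span)
  have c1: "card B1 = card BZ + card BW"
    using fB B1 by (simp add: BW_def card_Diff_subset card_mono)
  have c2: "card B = k + card B1"
    using fB B by (simp add: BV_def k_def card_Diff_subset card_mono)
  have dU: "dim (UNIV :: 'a set) = card B" using real_vector.basis_card_eq_dim[of B UNIV] B by auto
  have dW: "dim W = card BW" using iW by (simp add: W_def real_vector.dim_eq_card_independent)
  have dG: "dim G \<le> card B1" using real_vector.dim_le_card[of G B1] B1 fB by auto
  \<comment> \<open>With \<open>n\<close> the full dimension, \<open>n \<le> dim Z + dim G\<close>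
    and \<open>dim G \<le> n - k\<close> give \<open>k \<le> dim Z\<close>, while
    \<open>n = k + dim Z + dim W\<close>.\<close>
  have dims: "2 * k + dim W \<le> dim (UNIV :: 'a set)"
    using dim_annihilator[OF bilinear_form, of G] BZ(4) c1 c2 dU dW dG by (simp add: Z_def)
  have ZW: "\<phi> X p = 0" if "X \<in> Z" "p \<in> W" for X p
    using real_vector.linear_eq_0_on_span[OF lin1[of X], of BW p] that BWG by (auto simp: W_def Z_def)
  \<comment> \<open>Since \<open>Z\<close> is orthogonal to \<open>W\<close>, a \<open>p\<close>
    orthogonal to \<open>W\<close> is orthogonal to \<open>span B1\<close>, hence to all brackets;
    so it lies in \<open>Z\<close>, which meets \<open>W\<close> in 0.\<close>
  have nondeg: "p = 0" if p: "p \<in> W" "\<And>q. q \<in> W \<Longrightarrow> \<phi> p q = 0" for p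
  proof -
    have "\<phi> p b = 0" if "b \<in> B1" for b
      using that p(1) p(2)[of b] ZW[of b p] BZ form_sym[of b p]
      by (cases "b \<in> BZ") (auto simp: BW_def W_def intro: real_vector.span_base)
    then have "\<phi> p u = 0" if "u \<in> G" for u
      using real_vector.linear_eq_0_on_span[OF lin1[of p], of B1 u] that B1 by auto
    then have "p \<in> span BZ" by (simp add: spZ Z_def)
    then show ?thesis using span_disjoint_Int[OF B1(3), of BW BZ p] p(1) B1 by (auto simp: BW_def W_def)
  qed
  have "\<forall>X. \<exists>p\<in>W. \<forall>q\<in>W. \<phi> p q = \<phi> X q"
    using Riesz[OF bilinear_form sW nondeg lin1] by blast
  then obtain \<pi> where \<pi>: "\<And>X. \<pi> X \<in> W" "\<And>X q. q \<in> W \<Longrightarrow> \<phi> (\<pi> X) q = \<phi> X q" by metis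
  have \<pi>_eq: "\<pi> X = p" if "p \<in> W" "\<And>q. q \<in> W \<Longrightarrow> \<phi> p q = \<phi> X q" for X p
  proof -
    have "\<pi> X - p = 0"
      using that \<pi> sW by (intro nondeg) (auto simp: form_linear real_vector.subspace_diff)
    then show ?thesis by simp
  qed
  have l\<pi>: "linear \<pi>"
    using \<pi> sW by (intro linearI \<pi>_eq) (auto simp: form_linear real_vector.subspace_add real_vector.subspace_scale)
  obtain x0 where x0: "bij_betw x0 {..<k} BV"
    using ex_bij_betw_nat_finite[of BV] fB by (auto simp: k_def BV_def lessThan_atLeast0)
  have x0B: "x0 i \<in> B" "x0 i \<notin> B1" if "i < k" for i
    using bij_betw_apply[OF x0] that by (auto simp: BV_def)
  define a where "a i X = representation B X (x0 i)" for i X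
  \<comment> \<open>Subtracting the projection makes the generators orthogonal to \<open>W\<close>
    and keeps their \<open>a\<close>-coordinates, which vanish on \<open>W\<close>.\<close>
  define x where "x i = x0 i - \<pi> (x0 i)" for i
  have spB: "span B = UNIV" using B by auto
  have la: "linear (a i)" for i
    using real_vector.linear_representation[OF B(2) spB, of "x0 i"]
    by (simp add: a_def[abs_def] linear_def real_scaleR_def[abs_def])
  have aB1: "a i X = 0" if "i < k" "X \<in> span B1" for i X
  proof -
    have "representation B X = representation B1 X"
      using real_vector.representation_extend[OF B(2) that(2) B(1)] .
    then show ?thesis using x0B[OF that(1)] real_vector.representation_ne_zero[of B1 X "x0 i"] by (auto simp: a_def)
  qed
  have aW: "a i p = 0" if "i < k" "p \<in> W" for i p
    using aB1[OF that(1)] that(2) real_vector.span_mono[of BW B1] by (auto simp: W_def BW_def)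
  have W_x: "\<phi> p (x i) = 0" if "p \<in> W" for i p
    using \<pi>(2)[OF that, of "x0 i"] by (simp add: x_def form_linear form_sym)
  have decomp: "X - ((\<Sum>i<k. a i X *\<^sub>R x i) + \<pi> X) \<in> Z" for X
  proof -
    have "X = (\<Sum>b\<in>B. representation B X b *\<^sub>R b)"
      using real_vector.sum_representation_eq[OF B(2), of X B] fB spB by simp
    also have "\<dots> = (\<Sum>b\<in>BV. representation B X b *\<^sub>R b) + (\<Sum>b\<in>B1. representation B X b *\<^sub>R b)"
      using fB B by (simp add: BV_def sum.subset_diff)
    also have "(\<Sum>b\<in>B1. representation B X b *\<^sub>R b) =
        (\<Sum>b\<in>BW. representation B X b *\<^sub>R b) + (\<Sum>b\<in>BZ. representation B X b *\<^sub>R b)"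
      using fB B1 by (simp add: BW_def sum.subset_diff)
    also have "(\<Sum>b\<in>BV. representation B X b *\<^sub>R b) = (\<Sum>i<k. a i X *\<^sub>R x0 i)"
      using sum.reindex_bij_betw[OF x0, of "\<lambda>b. representation B X b *\<^sub>R b"] by (simp add: a_def)
    finally have X: "X = (\<Sum>i<k. a i X *\<^sub>R x0 i) +
        ((\<Sum>b\<in>BW. representation B X b *\<^sub>R b) + (\<Sum>b\<in>BZ. representation B X b *\<^sub>R b))"
      (is "_ = ?s + (?w + ?z)") .
    have w: "?w \<in> W" unfolding W_def by (intro real_vector.span_sum real_vector.span_scale real_vector.span_base)
    have z: "?z \<in> Z" unfolding spZ[symmetric] by (intro real_vector.span_sum real_vector.span_scale real_vector.span_base)
    have "\<pi> ?w = ?w" using w by (intro \<pi>_eq) auto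
    moreover have "\<pi> ?z = 0" using ZW[OF z] sW by (intro \<pi>_eq) (auto simp: form_linear real_vector.subspace_0)
    moreover have "\<pi> X = \<pi> ?s + (\<pi> ?w + \<pi> ?z)"
      by (subst X) (simp only: linear_add[OF l\<pi>])
    moreover have "(\<Sum>i<k. a i X *\<^sub>R x i) = ?s - \<pi> ?s"
      by (simp add: x_def scaleR_diff_right sum_subtractf linear_sum[OF l\<pi>] linear_scale[OF l\<pi>])
    ultimately have "X - ((\<Sum>i<k. a i X *\<^sub>R x i) + \<pi> X) = ?z" using X by (simp add: algebra_simps)
    then show ?thesis using z by simp
  qed
  have ax: "a i (x j) = (if i = j then 1 else 0)" if "i < k" "j < k" for i j
  proof -
    have "a i (x j) = a i (x0 j)" using aW[OF that(1) \<pi>(1)] by (simp add: x_def linear_diff[OF la])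
    also have "\<dots> = (if i = j then 1 else 0)"
      using real_vector.representation_basis[OF B(2) x0B(1)[OF that(2)]] x0 that
      by (auto simp: a_def bij_betw_def inj_on_def)
    finally show ?thesis .
  qed
  have brZ: "br X Y - \<pi> (br X Y) \<in> Z" for X Y
  proof -
    have "br X Y \<in> span B1" using B1(4) unfolding G_def by blast
    then have "(\<Sum>i<k. a i (br X Y) *\<^sub>R x i) = 0" using aB1 by (intro sum.neutral) auto
    then show ?thesis using decomp[of "br X Y"] by simp
  qed
  have "reduced_form br \<phi> S W \<pi> k x a"
  proof (intro reduced_form.intro reduced_form_axioms.intro nilpotent_form_axioms)
    show "closed1 (a i)" if "i < k" for i
    proof -
      have "br X Y \<in> span B1" for X Y using B1(4) unfolding G_def by blast
      then show ?thesis using la aB1[OF that] by (simp add: closed1_def)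
    qed
    show "\<omega> X Y Z = \<omega> ((\<Sum>i<k. a i X *\<^sub>R x i) + \<pi> X) Y Z" for X Y Z
      using decomp[of X] by (auto simp: Z_iff \<omega>_linear(4))
    show "\<omega> (br X Y) U V = \<omega> (\<pi> (br X Y)) U V" for X Y U V
      using brZ[of X Y] by (auto simp: Z_iff \<omega>_linear)
    show "\<phi> X p = 0" if "\<And>U V. \<omega> X U V = 0" "p \<in> W" for X p
      using ZW[of X p] that by (simp add: Z_iff)
  qed (use sW nondeg l\<pi> \<pi> aW ax W_x in auto)
  then show thesis using dims that by blast
qed

end


section \<open>The nilpotent action on \<open>W\<close>, and changes of generators\<close>

context reduced_form
begin

lemma linear_form: "linear (\<phi> X)"
  using bilinear_form by (simp add: bilinear_def)

lemma form_\<pi>_right: "p \<in> W \<Longrightarrow> \<phi> p (\<pi> X) = \<phi> p X"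
  using form_\<pi>[of p X] form_sym by metis

lemma W_eqI: "p \<in> W \<Longrightarrow> q \<in> W \<Longrightarrow> (\<And>r. r \<in> W \<Longrightarrow> \<phi> p r = \<phi> q r) \<Longrightarrow> p = q"
  using nondeg[of "p - q"] subspace_W by (simp add: form_linear real_vector.subspace_diff)

lemma \<pi>_id: "p \<in> W \<Longrightarrow> \<pi> p = p"
  by (rule W_eqI) (auto simp: \<pi>_W form_\<pi>)

definition N :: "'a \<Rightarrow> 'a \<Rightarrow> 'a" where "N t p = \<pi> (br t p)"

lemma linear_N: "linear (N t)"
  using linear_compose[OF _ linear_\<pi>, of "br t"] bilinear_br by (simp add: bilinear_def N_def[abs_def] comp_def)

lemma N_W: "N t p \<in> W" by (simp add: N_def \<pi>_W)

lemma form_N: "q \<in> W \<Longrightarrow> \<phi> (N t p) q = \<omega> t p q"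
  using \<omega>_cyclic[of t p q] by (simp add: N_def form_\<pi> form_br_eq)

lemma N_skew: "p \<in> W \<Longrightarrow> q \<in> W \<Longrightarrow> \<phi> (N t p) q = - \<phi> p (N t q)"
  using \<omega>_swap23[of t p q] by (simp add: form_N form_sym[of p])

lemma N_add: "N (s + t) p = N s p + N t p" and N_scale: "N (r *\<^sub>R t) p = r *\<^sub>R N t p"
  by (simp_all add: N_def br_linear linear_add[OF linear_\<pi>] linear_scale[OF linear_\<pi>])

text \<open>A bracket and its projection differ by an element of the kernel of \<omega>, which a
  further bracket paired with \<open>W\<close> cannot detect. This makes \<open>N\<close> a
  representation and identifies words in \<open>N\<close> with projected iterated brackets.\<close>

lemma N_\<pi>_br: "N t (\<pi> (br X Y)) = \<pi> (br t (br X Y))"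
proof (rule W_eqI)
  fix r assume r: "r \<in> W"
  show "\<phi> (N t (\<pi> (br X Y))) r = \<phi> (\<pi> (br t (br X Y))) r"
    using \<omega>_br[of X Y t r] \<omega>_swap12[of t "\<pi> (br X Y)" r] \<omega>_swap12[of t "br X Y" r]
      form_N[OF r, of t "\<pi> (br X Y)"] form_N[OF r, of t "br X Y"] by (simp add: N_def)
qed (simp_all add: N_W \<pi>_W)

lemma N_bracket: "N (br s t) p = N s (N t p) - N t (N s p)"
proof -
  have "br s (br t p) + br t (br p s) + br p (br s t) = 0" by (rule jacobi)
  then have "br (br s t) p = br s (br t p) - br t (br s p)"
    by (simp add: br_skew[of "br s t" p] br_skew[of p s] br_linear algebra_simps eq_neg_iff_add_eq_0)
  then show ?thesis by (simp add: N_def[of "br s t"] linear_diff[OF linear_\<pi>] N_\<pi>_br[folded N_def])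
    (simp add: N_def N_\<pi>_br[unfolded N_def])
qed

lemma N_nilpotent: "\<exists>n. \<forall>ts p. length ts = n \<longrightarrow> p \<in> W \<longrightarrow> fold N ts p = 0"
proof -
  obtain n where n: "lower_central_series br n = {0}" using nilpotent by (auto simp: nilpotent_lie_def)
  have lcs: "fold br ts p \<in> lower_central_series br (length ts)" for ts p
  proof (induction ts rule: rev_induct)
    case (snoc t ts)
    then show ?case by (auto intro!: real_vector.span_base)
  qed simp
  have "fold N ts p = \<pi> (fold br ts p)" if "p \<in> W" for ts p
  proof (induction ts rule: rev_induct)
    case (snoc t ts)
    \<comment> \<open>\<open>N_\<pi>_br\<close> speaks of brackets only: after the first letter the
      argument is one, and before it \<open>p\<close> is its own projection.\<close>
    show ?case
    proof (cases ts rule: rev_cases)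
      case Nil
      then show ?thesis by (simp add: N_def)
    next
      case (snoc ts' t')
      then show ?thesis using snoc.IH by (simp add: N_\<pi>_br)
    qed
  qed (simp add: \<pi>_id that)
  moreover have "fold br ts p = 0" if "length ts = n" for ts p using lcs[of ts p] n that by simp
  ultimately show ?thesis using linear_0[OF linear_\<pi>] by (intro exI[of _ n]) auto
qed

text \<open>Up to the kernel of \<omega>, every vector is a combination of generators plus an
  element of \<open>W\<close>. Arguments in \<open>W\<close> contribute nothing since
  \<open>N\<close> kills \<open>f\<close>, so brackets of generators decide whether \<open>f\<close>
  lies in the radical.\<close>

lemma generated:
  assumes f: "f \<in> W" "\<And>t. N t f = 0" "\<And>i j. i < j \<Longrightarrow> j < k \<Longrightarrow> \<phi> f (br (x i) (x j)) = 0"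
  shows "f = 0"
proof -
  have 0: "\<omega> f X p = 0" if "p \<in> W" for X p
    using form_N[OF that, of X f] f(2) \<omega>_swap12[of X f p] by (simp add: form_linear)
  have xx: "\<omega> f (x i) (x j) = 0" if "i < k" "j < k" for i j
    using that f(3)[of i j] f(3)[of j i] \<omega>_swap23[of f "x i" "x j"]
    by (cases i j rule: linorder_cases) (auto simp: form_br_eq)
  have "\<omega> f X Y = 0" for X Y
  proof -
    have lin2: "linear (\<omega> f U)" for U unfolding linear_iff by (simp add: \<omega>_linear)
    have "\<omega> f X (x j) = 0" if "j < k" for j X
    proof -
      have lin3: "linear (\<lambda>X. \<omega> f X (x j))" unfolding linear_iff by (simp add: \<omega>_linear)
      have "\<omega> f X (x j) = \<omega> f ((\<Sum>i<k. a i X *\<^sub>R x i) + \<pi> X) (x j)"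
        using \<omega>_decomp[of X "x j" f] by (metis \<omega>_cyclic)
      then show ?thesis
        using xx that 0[OF \<pi>_W, of "x j" X] \<omega>_swap23[of f "x j" "\<pi> X"]
        by (simp add: \<omega>_linear linear_sum[OF lin3])
    qed
    moreover have "\<omega> f X Y = \<omega> f X ((\<Sum>i<k. a i Y *\<^sub>R x i) + \<pi> Y)"
      using \<omega>_decomp[of Y f X] by (metis \<omega>_cyclic)
    ultimately show ?thesis
      using 0[OF \<pi>_W, of X Y] by (simp add: \<omega>_linear linear_sum[OF lin2])
  qed
  then show ?thesis using radical_W[of f] nondeg f(1) by blast
qed

lemma common_kernel:
  assumes "p \<in> W" "p \<noteq> 0"
  shows "\<exists>f\<in>W. f \<noteq> 0 \<and> (\<forall>t. N t f = 0)"
proof -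
  obtain n where "\<And>ts p. length ts = n \<Longrightarrow> p \<in> W \<Longrightarrow> fold N ts p = 0" using N_nilpotent by blast
  then have "\<exists>f. f \<in> W \<and> f \<notin> {0} \<and> (\<forall>t. N t f \<in> {0})"
    by (intro nil_chain[where n = n and g = p]) (use assms N_W in auto)
  then show ?thesis by auto
qed

text \<open>With \<open>W = 0\<close> all three factors of every term are closed, so \<omega> is a
  third of its image under the Euler operator.\<close>

lemma exact_trivial:
  assumes "\<And>p. p \<in> W \<Longrightarrow> p = 0"
  shows "exact \<omega>"
proof -
  have \<omega>: "\<omega> X Y Z = (\<Sum>i<k. a i X * \<omega> (x i) Y Z)" for X Y Z
  proof -
    have lin: "linear (\<lambda>X. \<omega> X Y Z)" unfolding linear_iff by (simp add: \<omega>_linear)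
    show ?thesis using assms[OF \<pi>_W, of X] by (subst \<omega>_decomp) (simp add: \<omega>_linear linear_sum[OF lin])
  qed
  have "exact (\<lambda>X Y Z. \<Sum>i<k. a i X * \<omega> (x i) Y Z + a i Y * \<omega> (x i) Z X + a i Z * \<omega> (x i) X Y)"
    by (rule exact_sum, rule exact_wedge1[OF closed_a]) simp
  from exact_scale[OF this, of \<omega> "1/3"] show ?thesis
    by (simp add: sum.distrib flip: \<omega>) (simp add: \<omega>_cyclic)
qed

text \<open>There is no bracket of two distinct generators for a common kernel vector to pair with,
  so nilpotency forces \<open>W = 0\<close>.\<close>

lemma exact_one_generator:
  assumes "k \<le> 1"
  shows "exact \<omega>"
proof (rule exact_trivial, rule ccontr)
  fix p assume "p \<in> W" "p \<noteq> 0"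
  then obtain f where "f \<in> W" "f \<noteq> 0" "\<And>t. N t f = 0" using common_kernel by blast
  then show False using generated[of f] assms by auto
qed

lemma \<omega>_decomp3:
  "\<omega> X Y Z = \<omega> ((\<Sum>i<k. a i X *\<^sub>R x i) + \<pi> X) ((\<Sum>i<k. a i Y *\<^sub>R x i) + \<pi> Y) ((\<Sum>i<k. a i Z *\<^sub>R x i) + \<pi> Z)"
  using \<omega>_decomp \<omega>_cyclic by metis

lemma \<omega>_xxW:
  "\<omega> s t (\<pi> Z) = \<phi> (\<pi> (br s t)) Z"
  "\<omega> s (\<pi> Z) t = - \<phi> (\<pi> (br s t)) Z"
  "\<omega> (\<pi> Z) s t = \<phi> (\<pi> (br s t)) Z"
proof -
  show "\<omega> (\<pi> Z) s t = \<phi> (\<pi> (br s t)) Z"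
    using form_\<pi>_right[OF \<pi>_W, of "br s t" Z] form_\<pi>[OF \<pi>_W, of "br s t" Z]
    by (simp add: form_br_eq)
  then show "\<omega> s t (\<pi> Z) = \<phi> (\<pi> (br s t)) Z" by (simp add: \<omega>_cyclic)
  then show "\<omega> s (\<pi> Z) t = - \<phi> (\<pi> (br s t)) Z" using \<omega>_swap23 by metis
qed

lemma \<omega>_xWW:
  "\<omega> t (\<pi> Y) (\<pi> Z) = \<phi> (N t (\<pi> Y)) Z"
  "\<omega> (\<pi> Y) t (\<pi> Z) = - \<phi> (N t (\<pi> Y)) Z"
  "\<omega> (\<pi> Y) (\<pi> Z) t = \<phi> (N t (\<pi> Y)) Z"
proof -
  show 1: "\<omega> t (\<pi> Y) (\<pi> Z) = \<phi> (N t (\<pi> Y)) Z"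
    using form_N[OF \<pi>_W, of t "\<pi> Y" Z] form_\<pi>_right[OF N_W] by simp
  then show "\<omega> (\<pi> Y) t (\<pi> Z) = - \<phi> (N t (\<pi> Y)) Z" using \<omega>_swap12 by metis
  show "\<omega> (\<pi> Y) (\<pi> Z) t = \<phi> (N t (\<pi> Y)) Z" using 1 \<omega>_cyclic by metis
qed

lemma br_flip_\<pi>: "\<phi> (\<pi> (br X Y)) Z = - \<phi> (\<pi> (br Y X)) Z"
  by (subst br_skew) (simp add: linear_neg[OF linear_\<pi>] form_linear)

text \<open>The last assumption says that coordinates change contragrediently to generators.
  \<open>W\<close> and \<pi> stay fixed, so facts about \<open>N\<close> carry over
  unchanged.\<close>

lemma reframe:
  assumes "\<And>i. i < k \<Longrightarrow> closed1 (a' i)" "\<And>i p. i < k \<Longrightarrow> p \<in> W \<Longrightarrow> a' i p = 0"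
    and "\<And>i j. i < k \<Longrightarrow> j < k \<Longrightarrow> a' i (x' j) = (if i = j then 1 else 0)"
    and "\<And>i p. i < k \<Longrightarrow> p \<in> W \<Longrightarrow> \<phi> p (x' i) = 0"
    and "\<And>X. (\<Sum>i<k. a' i X *\<^sub>R x' i) = (\<Sum>i<k. a i X *\<^sub>R x i)"
  shows "reduced_form br \<phi> S W \<pi> k x' a'"
proof (intro reduced_form.intro reduced_form_axioms.intro nilpotent_form_axioms)
  show "\<omega> X Y Z = \<omega> ((\<Sum>i<k. a' i X *\<^sub>R x' i) + \<pi> X) Y Z" for X Y Z
    unfolding assms(5) by (rule \<omega>_decomp)
  show "\<phi> X p = 0" if "\<And>U V. \<omega> X U V = 0" "p \<in> W" for X p
    using radical_W that by blast
qed (fact subspace_W linear_\<pi> \<pi>_W form_\<pi> \<omega>_br assms nondeg)+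

lemma shear:
  assumes ij: "i < k" "j < k" "i \<noteq> j"
  shows "reduced_form br \<phi> S W \<pi> k (x(j := x j + r *\<^sub>R x i)) (a(i := \<lambda>X. a i X - r * a j X))"
proof (rule reframe)
  fix l assume l: "l < k"
  show "closed1 ((a(i := \<lambda>X. a i X - r * a j X)) l)"
    using closed_a[OF l] closed_a[OF ij(1)] closed_a[OF ij(2)]
    by (auto simp: closed1_def linear_iff algebra_simps)
  show "(a(i := \<lambda>X. a i X - r * a j X)) l p = 0" if "p \<in> W" for p
    using a_W that l ij by simp
  show "\<phi> p ((x(j := x j + r *\<^sub>R x i)) l) = 0" if "p \<in> W" for p
    using W_x that l ij by (simp add: form_linear)
  show "(a(i := \<lambda>X. a i X - r * a j X)) l ((x(j := x j + r *\<^sub>R x i)) m) = (if l = m then 1 else 0)"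
    if "m < k" for m
    using closed_a[OF l] closed_a[OF ij(1)] closed_a[OF ij(2)] a_x l ij that
    by (auto simp: closed1_def linear_iff)
next
  fix X
  have s: "(\<Sum>l<k. f l) = f i + (f j + (\<Sum>l\<in>{..<k} - {i} - {j}. f l))" for f :: "nat \<Rightarrow> 'a"
    using ij by (simp add: sum.remove[of _ i] sum.remove[of _ j])
  show "(\<Sum>l<k. (a(i := \<lambda>X. a i X - r * a j X)) l X *\<^sub>R (x(j := x j + r *\<^sub>R x i)) l) = (\<Sum>l<k. a l X *\<^sub>R x l)"
    unfolding s using ij by (simp add: algebra_simps)
qed

lemma permute:
  assumes s: "s permutes {..<k}"
  shows "reduced_form br \<phi> S W \<pi> k (x \<circ> s) (a \<circ> s)"
proof (rule reframe)
  have sk: "s i < k" if "i < k" for i using permutes_in_image[OF s, of i] that by simp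
  show "(\<Sum>l<k. (a \<circ> s) l X *\<^sub>R (x \<circ> s) l) = (\<Sum>l<k. a l X *\<^sub>R x l)" for X
    using sum.permute[OF s, of "\<lambda>l. a l X *\<^sub>R x l"] by (simp add: comp_def)
  fix l assume l: "l < k"
  show "(a \<circ> s) l ((x \<circ> s) m) = (if l = m then 1 else 0)" if "m < k" for m
    using a_x[OF sk sk] that l permutes_inj[OF s] by (auto simp: inj_eq)
  show "closed1 ((a \<circ> s) l)" using closed_a[OF sk[OF l]] by simp
  fix p assume "p \<in> W"
  then show "(a \<circ> s) l p = 0" "\<phi> p ((x \<circ> s) l) = 0" using a_W[OF sk[OF l]] W_x[OF sk[OF l]] by auto
qed

end

subsection \<open>Two generators\<close>

context reduced_form
begin

lemma N_abelian:
  assumes ab: "\<And>p q r. p \<in> W \<Longrightarrow> q \<in> W \<Longrightarrow> r \<in> W \<Longrightarrow> \<omega> p q r = 0" and p: "p \<in> W"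
  shows "N t p = (\<Sum>i<k. a i t *\<^sub>R N (x i) p)"
proof (rule W_eqI)
  fix r assume r: "r \<in> W"
  have l1: "linear (\<lambda>t. \<omega> t p r)" unfolding linear_iff by (simp add: \<omega>_linear)
  have l2: "linear (\<lambda>q. \<phi> q r)" using bilinear_form by (simp add: bilinear_def)
  show "\<phi> (N t p) r = \<phi> (\<Sum>i<k. a i t *\<^sub>R N (x i) p) r"
    using ab[OF \<pi>_W p r, of t] \<omega>_decomp[of t p r]
    by (simp add: form_N[OF r] linear_sum[OF l1] linear_sum[OF l2] \<omega>_linear form_linear)
qed (use N_W subspace_W in \<open>auto intro!: real_vector.subspace_sum real_vector.subspace_scale\<close>)

text \<open>Stated for any pair with the same generator part, because
  \<open>exact_two_generators\<close> picks new generators in the middle of its proof.\<close>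

lemma expand2:
  assumes ab: "\<And>p q r. p \<in> W \<Longrightarrow> q \<in> W \<Longrightarrow> r \<in> W \<Longrightarrow> \<omega> p q r = 0"
    and y: "\<And>X. (\<Sum>i<k. a i X *\<^sub>R x i) = A X *\<^sub>R y1 + B X *\<^sub>R y2"
  shows "\<omega> X Y Z = wedge3 A B (\<phi> (\<pi> (br y1 y2))) X Y Z
    + (A X * \<phi> (N y1 (\<pi> Y)) Z + A Y * \<phi> (N y1 (\<pi> Z)) X + A Z * \<phi> (N y1 (\<pi> X)) Y)
    + (B X * \<phi> (N y2 (\<pi> Y)) Z + B Y * \<phi> (N y2 (\<pi> Z)) X + B Z * \<phi> (N y2 (\<pi> X)) Y)"
proof -
  have sk: "\<phi> (N t (\<pi> X)) Z = - \<phi> (N t (\<pi> Z)) X" for t X Z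
    using \<omega>_swap23[of t "\<pi> X" "\<pi> Z"] by (simp add: \<omega>_xWW)
  show ?thesis
    unfolding \<omega>_decomp3[of X Y Z] y
    by (simp add: \<omega>_linear \<omega>_xxW[where s = y1 and t = y2] \<omega>_xxW[where s = y2 and t = y1]
        \<omega>_xWW[where t = y1] \<omega>_xWW[where t = y2] ab[OF \<pi>_W \<pi>_W \<pi>_W] br_flip_\<pi>[of y2 y1] sk[of _ Y X] sk[of _ Z Y] sk[of _ X Z]
        wedge3_def algebra_simps)
qed


text \<open>On the orthogonal space of \<open>v\<close> each \<open>N t\<close> takes values in the
  line of \<open>v\<close>, so \<omega> vanishes with two arguments there. Its complement in
  \<open>W\<close> is the single line of \<open>w\<close>, and \<omega> is alternating.\<close>

lemma abelian_of_line:
  assumes v: "v \<in> W" "w \<in> W" "\<phi> v w = 1"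
    and line: "\<And>t p. p \<in> W \<Longrightarrow> N t p = \<phi> v p *\<^sub>R N t w - \<phi> (N t w) p *\<^sub>R v"
    and p: "p \<in> W" "q \<in> W" "r \<in> W"
  shows "\<omega> p q r = 0"
proof -
  have 0: "\<omega> t q r = 0" if "q \<in> W" "r \<in> W" "\<phi> v q = 0" "\<phi> v r = 0" for t q r
    using form_N[OF that(2), of t q] line[OF that(1), of t] that(3,4) by (simp add: form_linear)
  define s where "s p = p - \<phi> v p *\<^sub>R w" for p
  have s: "s p \<in> W" "\<phi> v (s p) = 0" if "p \<in> W" for p
    using that v subspace_W by (auto simp: s_def form_linear real_vector.subspace_diff real_vector.subspace_scale)
  have 1: "\<omega> q t r = 0" "\<omega> q r t = 0" if "q \<in> W" "r \<in> W" "\<phi> v q = 0" "\<phi> v r = 0" for t q r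
    using 0[OF that, of t] \<omega>_swap12[of t q r] \<omega>_cyclic[of q r t] by simp_all
  have "\<omega> p q r = \<omega> (\<phi> v p *\<^sub>R w + s p) (\<phi> v q *\<^sub>R w + s q) (\<phi> v r *\<^sub>R w + s r)"
    by (simp add: s_def)
  then show ?thesis
    by (simp only: \<omega>_linear \<omega>_self) (simp add: 0 1 s p)
qed

lemma common_isotropic_kernel:
  assumes "p \<in> W" "N t p \<noteq> 0"
  obtains v where "v \<in> W" "v \<noteq> 0" "\<phi> v v = 0" "\<And>t. N t v = 0"
proof -
  obtain n where n: "\<And>ts p. length ts = n \<Longrightarrow> p \<in> W \<Longrightarrow> fold N ts p = 0" using N_nilpotent by blast
  have "\<exists>v. (v \<in> W \<and> (\<exists>t p. p \<in> W \<and> v = N t p)) \<and> v \<notin> {0} \<and> (\<forall>t. N t v \<in> {0})"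
    by (rule nil_chain[where n = n and g = "N t p"]) (use n N_W assms in auto)
  then obtain v t1 p1 where v: "v \<in> W" "v \<noteq> 0" "\<And>t. N t v = 0" and p1: "p1 \<in> W" "v = N t1 p1" by blast
  have "\<phi> v v = 0" using N_skew[OF p1(1) v(1), of t1] v(3) p1 by (simp add: form_linear)
  then show thesis using that v by blast
qed

text \<open>Two generators have only one bracket, so the pairing with it is injective on the common
  kernel.\<close>

lemma kernel_generator:
  assumes k: "k = 2" and f: "f \<in> W" "\<And>t. N t f = 0" "f \<noteq> 0"
  shows "\<phi> f (\<pi> (br (x 0) (x 1))) \<noteq> 0"
proof
  assume 0: "\<phi> f (\<pi> (br (x 0) (x 1))) = 0"
  have "f = 0"
  proof (rule generated[OF f(1,2)])
    fix i j :: nat assume "i < j" "j < k"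
    then have "i = 0" "j = 1" using k by auto
    then show "\<phi> f (br (x i) (x j)) = 0" using 0 form_\<pi>_right[OF f(1)] by simp
  qed
  then show False using f by simp
qed

lemma exact_two_generators_rank_one:
  assumes k: "k = 2"
    and v: "v \<in> W" "\<phi> v v = 0" "\<And>t. N t v = 0" "\<phi> v w = 1" and w: "w = \<pi> (br (x 0) (x 1))"
    and line: "\<And>t p. p \<in> W \<Longrightarrow> N t p = \<phi> v p *\<^sub>R N t w - \<phi> (N t w) p *\<^sub>R v"
    and nt: "p0 \<in> W" "N t0 p0 \<noteq> 0"
  shows "exact \<omega>"
proof -
  have wW: "w \<in> W" by (simp add: w \<pi>_W)
  note ab = abelian_of_line[OF v(1) wW v(4) line]
  let ?e = "N (x 0) w" and ?e' = "N (x 1) w"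
  have two: "(\<Sum>i<k. f i) = f 0 + f 1" for f :: "nat \<Rightarrow> 'a"
    by (simp add: k numeral_2_eq_2)
  have two': "(\<Sum>i<k. a i X *\<^sub>R x i) = a 0 X *\<^sub>R x 0 + a 1 X *\<^sub>R x 1" for X
    by (rule two)
  have "?e \<noteq> 0 \<or> ?e' \<noteq> 0"
  proof (rule ccontr)
    assume "\<not> ?thesis"
    then have "N (x 0) p = 0 \<and> N (x 1) p = 0" if "p \<in> W" for p
      using line[OF that, of "x 0"] line[OF that, of "x 1"] by (simp add: form_linear)
    then show False using N_abelian[OF ab nt(1), of t0] nt by (simp add: two)
  qed
  then have "\<exists>u\<in>W. \<phi> ?e u \<noteq> 0 \<or> \<phi> ?e' u \<noteq> 0" using nondeg N_W by metis
  then obtain u0 where u0: "u0 \<in> W" "\<phi> ?e u0 \<noteq> 0 \<or> \<phi> ?e' u0 \<noteq> 0" by blast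
  obtain u where u: "u \<in> W" "\<phi> ?e u = 1 \<or> \<phi> ?e' u = 1"
  proof (cases "\<phi> ?e u0 = 0")
    case True
    then show ?thesis using u0 subspace_W that[of "(1 / \<phi> ?e' u0) *\<^sub>R u0"]
      by (simp add: form_linear real_vector.subspace_scale)
  next
    case False
    then show ?thesis using u0 subspace_W that[of "(1 / \<phi> ?e u0) *\<^sub>R u0"]
      by (simp add: form_linear real_vector.subspace_scale)
  qed
  have ev: "\<phi> v (N t w) = 0" "\<phi> w (N t w) = 0" for t
    using N_skew[OF v(1) wW, of t] N_skew[OF wW wW, of t] v(3)[of t] form_sym[of "N t w" w]
    by (simp_all add: form_linear)
  show ?thesis
  proof (rule exact_two_frame_rank_one[where a = "a 0" and b = "a 1" and x = "x 0" and y = "x 1" and w = w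
        and v = v and e = ?e and e' = ?e' and u = u])
    show "closed1 (a 0)" "closed1 (a 1)" using closed_a k by auto
    show "a 0 (x 0) = 1" "a 1 (x 0) = 0" "a 0 (x 1) = 0" "a 1 (x 1) = 1" using a_x k by auto
    show "a 0 p = 0 \<and> a 1 p = 0 \<and> \<phi> p (x 0) = 0 \<and> \<phi> p (x 1) = 0"
      if "p \<in> {v, w, ?e, ?e', u}" for p
    proof -
      have "p \<in> W" using that v wW N_W u by auto
      then show ?thesis using a_W W_x k by auto
    qed
    show "\<omega> X Y Z = wedge3 (a 0) (a 1) (\<phi> w) X Y Z + wedge3 (a 0) (\<phi> v) (\<phi> ?e) X Y Z
        + wedge3 (a 1) (\<phi> v) (\<phi> ?e') X Y Z" for X Y Z
    proof -
      have n: "\<phi> (N t (\<pi> Y)) Z = \<phi> v Y * \<phi> (N t w) Z - \<phi> (N t w) Y * \<phi> v Z" for t Y Z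
        by (subst line[OF \<pi>_W]) (simp add: form_linear form_\<pi>_right v N_W)
      show ?thesis
        by (subst expand2[OF ab two'])
            (simp_all add: n w[symmetric] wedge3_def algebra_simps del: One_nat_def)
    qed
  qed (use v ev u in auto)
qed


text \<open>Dimension 6 is too large for \<open>skew_nilpotent_family\<close>. The kernel vector
  \<open>v\<close> pairs with \<open>w\<close>, so they span a nondegenerate plane; its orthogonal
  complement \<open>P\<close> has dimension at most 4 and carries the compressed family
  \<open>M\<close>.\<close>

lemma exact_two_generators:
  assumes k: "k = 2" and dimW: "dim W \<le> 6"
  shows "exact \<omega>"
proof (cases "\<forall>p\<in>W. \<forall>t. N t p = 0")
  case True
  have ab: "\<omega> p q r = 0" if "p \<in> W" "q \<in> W" "r \<in> W" for p q r
    using form_N[OF that(3), of p q] True that by (simp add: form_linear)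
  have two: "(\<Sum>i<k. a i X *\<^sub>R x i) = a 0 X *\<^sub>R x 0 + a 1 X *\<^sub>R x 1" for X
    by (simp add: k numeral_2_eq_2)
  have om: "\<omega> X Y Z = wedge3 (a 0) (a 1) (\<phi> (\<pi> (br (x 0) (x 1)))) X Y Z" for X Y Z
    using True \<pi>_W by (subst expand2[OF ab two]) (simp_all add: form_linear del: One_nat_def)
  have vals: "a 0 (x 0) = 1" "a 1 (x 0) = 0" "\<phi> (\<pi> (br (x 0) (x 1))) (x 0) = 0"
    using a_x k W_x[OF _ \<pi>_W] by auto
  have "closed1 (a 0)" using closed_a k by simp
  from exact_wedge1[OF this, of "x 0"] show ?thesis
    by (rule exact_cong) (simp add: om vals wedge3_def algebra_simps del: One_nat_def)
next
  case False
  then obtain p0 t0 where nt: "p0 \<in> W" "N t0 p0 \<noteq> 0" by blast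
  define w where "w = \<pi> (br (x 0) (x 1))"
  have wW: "w \<in> W" by (simp add: w_def \<pi>_W)
  obtain v0 where v0: "v0 \<in> W" "v0 \<noteq> 0" "\<phi> v0 v0 = 0" "\<And>t. N t v0 = 0"
    using common_isotropic_kernel[OF nt] by blast
  define v where "v = (1 / \<phi> v0 w) *\<^sub>R v0"
  have v: "v \<in> W" "\<phi> v v = 0" "\<phi> v w = 1" "\<And>t. N t v = 0"
    using v0 kernel_generator[OF k v0(1,4,2)] subspace_W
    by (auto simp: v_def w_def form_linear real_vector.subspace_scale linear_scale[OF linear_N])
  have vw': "\<phi> w v = 1" using v form_sym by metis
  have ev: "\<phi> v (N t p) = 0" if "p \<in> W" for t p
    using N_skew[OF v(1) that, of t] v(4)[of t] by (simp add: form_linear)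
  have skew0: "\<phi> p (N t p) = 0" "\<phi> (N t p) p = 0" if "p \<in> W" for t p
    using N_skew[OF that that, of t] form_sym[of "N t p" p] by simp_all
  define P where "P = {p\<in>W. \<phi> v p = 0 \<and> \<phi> w p = 0}"
  have PD: "p \<in> W" "\<phi> v p = 0" "\<phi> w p = 0" "\<phi> p v = 0" "\<phi> p w = 0" if "p \<in> P" for p
    using that form_sym[of p] by (auto simp: P_def)
  have PI: "p \<in> P" if "p \<in> W" "\<phi> v p = 0" "\<phi> w p = 0" for p using that by (simp add: P_def)
  have sP: "subspace P"
    using subspace_W unfolding real_vector.subspace_def P_def by (auto simp: form_linear)
  have decP: "\<exists>p'\<in>P. \<exists>r. p = \<phi> v p *\<^sub>R w + r *\<^sub>R v + p'" if "p \<in> W" for p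
    by (rule bexI[of _ "p - \<phi> v p *\<^sub>R w - (\<phi> w p - \<phi> v p * \<phi> w w) *\<^sub>R v"],
        rule exI[of _ "\<phi> w p - \<phi> v p * \<phi> w w"], simp, rule PI)
      (use that v vw' wW subspace_W in \<open>auto simp: form_linear real_vector.subspace_diff real_vector.subspace_scale\<close>)
  have nondegP: "p = 0" if p: "p \<in> P" "\<And>q. q \<in> P \<Longrightarrow> \<phi> p q = 0" for p
  proof (rule nondeg)
    show "p \<in> W" using p PD by simp
    fix q assume "q \<in> W"
    then obtain q' r where q': "q' \<in> P" "q = \<phi> v q *\<^sub>R w + r *\<^sub>R v + q'" using decP by blast
    show "\<phi> p q = 0" by (subst q'(2)) (simp add: form_linear PD[OF p(1)] p(2)[OF q'(1)])
  qed
  define M where "M t p = N t p - \<phi> (N t p) w *\<^sub>R v" for t p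
  have MP: "M t p \<in> P" if "p \<in> P" for t p
    using PD[OF that] ev v vw' N_W subspace_W form_sym[of w "N t p"]
    by (intro PI) (auto simp: M_def form_linear real_vector.subspace_diff real_vector.subspace_scale)
  have lM: "linear (M t)" for t
    by (rule linearI) (simp_all add: M_def linear_add[OF linear_N] linear_scale[OF linear_N] form_linear algebra_simps)
  have N_M: "N t p = M t p - \<phi> (N t w) p *\<^sub>R v" if "p \<in> P" for t p
    using N_skew[OF PD(1)[OF that] wW, of t] by (simp add: M_def form_sym[of p])
  have MN: "\<phi> (M t p) q = \<phi> (N t p) q" if "q \<in> P" for t p q
    using PD[OF that] by (simp add: M_def form_linear)
  have skewM: "\<phi> (M t p) q = - \<phi> p (M t q)" if "p \<in> P" "q \<in> P" for t p q
    using N_skew[of p q t] PD that by (simp add: M_def form_linear)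
  obtain n where n: "\<And>ts p. length ts = n \<Longrightarrow> p \<in> W \<Longrightarrow> fold N ts p = 0" using N_nilpotent by blast
  have nilM: "fold M ts p = 0" if len: "length ts = n" and pP: "p \<in> P" for ts p
  proof -
    have MP': "fold M ts p \<in> P" for ts by (induction ts rule: rev_induct) (use MP pP in auto)
    \<comment> \<open>Words in \<open>M\<close> and in \<open>N\<close> differ by multiples of
      \<open>v\<close> only, because \<open>N\<close> kills \<open>v\<close>; elements of
      \<open>P\<close> have no such component.\<close>
    have ex: "\<exists>r. fold M ts p = fold N ts p + r *\<^sub>R v" for ts
    proof (induction ts rule: rev_induct)
      case (snoc t ts)
      then obtain r where r: "fold M ts p = fold N ts p + r *\<^sub>R v" by blast
      have "fold M (ts @ [t]) p = N t (fold M ts p) - \<phi> (N t (fold M ts p)) w *\<^sub>R v" by (simp add: M_def)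
      also have "N t (fold M ts p) = N t (fold N ts p)"
        by (simp add: r linear_add[OF linear_N] linear_scale[OF linear_N] v)
      finally show ?case by (intro exI[of _ "- \<phi> (N t (fold N ts p)) w"]) simp
    qed (auto intro: exI[of _ 0])
    obtain r where r: "fold M ts p = r *\<^sub>R v" using ex[of ts] n[OF len PD(1)[OF pP]] by auto
    then show ?thesis using PD(3)[OF MP'[of ts]] vw' by (simp add: form_linear)
  qed
  have dimP: "dim P \<le> 4"
  proof -
    obtain BP where BP: "BP \<subseteq> P" "independent BP" "P \<subseteq> span BP" "card BP = dim P"
      using real_vector.basis_exists by blast
    have n1: "v \<notin> span BP"
      by (rule not_in_span_functional[OF linear_form[of w]]) (use BP PD vw' in auto)
    have n2: "w \<notin> span (insert v BP)"
      by (rule not_in_span_functional[OF linear_form[of v]]) (use BP PD v in auto)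
    have "independent BP \<and> finite BP \<and> card BP = dim P" using BP finite_independent by simp
    note independent_card_insert[OF independent_card_insert[OF this n1] n2]
    then have "Suc (Suc (dim P)) \<le> dim W"
      using independent_le_dim[of "insert w (insert v BP)" W] BP PD v wW by force
    then show ?thesis using dimW by simp
  qed
  show ?thesis
  proof (cases "\<forall>p\<in>P. \<forall>t. M t p = 0")
    case True
    \<comment> \<open>If \<open>M = 0\<close>, the only thing left on \<open>P\<close> is a multiple
      of \<open>v\<close>, so the one-line formula holds on all of \<open>W\<close>.\<close>
    have line: "N t p = \<phi> v p *\<^sub>R N t w - \<phi> (N t w) p *\<^sub>R v" if p: "p \<in> W" for t p
    proof -
      obtain p' r where p': "p' \<in> P" "p = \<phi> v p *\<^sub>R w + r *\<^sub>R v + p'" using decP p by blast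
      have "\<phi> (N t w) p = \<phi> (N t w) p'"
        using skew0[OF wW, of t] ev[OF wW, of t] form_sym[of v "N t w"] by (subst p'(2)) (simp add: form_linear)
      moreover have "N t p = \<phi> v p *\<^sub>R N t w + N t p'"
        by (subst p'(2)) (simp add: linear_add[OF linear_N] linear_scale[OF linear_N] v)
      ultimately show ?thesis using N_M[OF p'(1), of t] True p' by simp
    qed
    show ?thesis by (rule exact_two_generators_rank_one[OF k v(1,2,4,3) w_def line nt])
  next
    case False
    then obtain p1 t1 where p1: "p1 \<in> P" "M t1 p1 \<noteq> 0" by blast
    have "\<exists>v. v \<in> P \<and> v \<noteq> 0 \<and> \<phi> v v = 0 \<and> (\<forall>t. M t v = 0) \<and> (\<exists>t p. p \<in> P \<and> v = M t p) \<and>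
      (\<forall>t p w. p \<in> P \<longrightarrow> w \<in> P \<longrightarrow> \<phi> v w \<noteq> 0 \<longrightarrow>
        \<phi> v w *\<^sub>R M t p = \<phi> v p *\<^sub>R M t w - \<phi> (M t w) p *\<^sub>R v)"
      by (rule skew_nilpotent_family[OF bilinear_form form_sym sP nondegP MP lM skewM nilM dimP p1])
    then obtain v2 where v2: "v2 \<in> P" "v2 \<noteq> 0" "\<phi> v2 v2 = 0" "\<And>t. M t v2 = 0" "\<exists>t p. p \<in> P \<and> v2 = M t p"
      "\<And>t p w. p \<in> P \<Longrightarrow> w \<in> P \<Longrightarrow> \<phi> v2 w \<noteq> 0 \<Longrightarrow>
        \<phi> v2 w *\<^sub>R M t p = \<phi> v2 p *\<^sub>R M t w - \<phi> (M t w) p *\<^sub>R v2" by blast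
    note pd = PD[OF v2(1)]
    have ev2: "\<phi> v2 (M t p) = 0" if "p \<in> P" for t p
      using skewM[OF v2(1) that, of t] v2(4)[of t] by (simp add: form_linear)
    have "\<exists>w2\<in>P. \<phi> v2 w2 = 1"
    proof -
      obtain z where "z \<in> P" "\<phi> v2 z \<noteq> 0" using nondegP v2 by blast
      then show ?thesis using sP
        by (intro bexI[of _ "(1 / \<phi> v2 z) *\<^sub>R z"]) (auto simp: form_linear real_vector.subspace_scale)
    qed
    then obtain w3 where w3: "w3 \<in> P" "\<phi> v2 w3 = 1" by blast
    have M_line: "M t p = \<phi> v2 p *\<^sub>R M t w2 - \<phi> (M t w2) p *\<^sub>R v2"
      if "p \<in> P" "w2 \<in> P" "\<phi> v2 w2 = 1" for t p w2
      using v2(6)[OF that(1,2), of t] that(3) by simp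
    have P0: "\<omega> t q r = 0" if "q \<in> P" "r \<in> P" "\<phi> v2 q = 0" "\<phi> v2 r = 0" for t q r
      using form_N[OF PD(1)[OF that(2)], of t q] MN[OF that(2), of t q] M_line[OF that(1) w3, of t] that
      by (simp add: form_linear)
    have PPP: "\<omega> p q r = 0" if "p \<in> P" "q \<in> P" "r \<in> P" for p q r
    proof -
      define s where "s p = p - \<phi> v2 p *\<^sub>R w3" for p
      have s: "s p \<in> P" "\<phi> v2 (s p) = 0" if "p \<in> P" for p
        using that w3 sP by (auto simp: s_def form_linear real_vector.subspace_diff real_vector.subspace_scale)
      have 1: "\<omega> q t r = 0" "\<omega> q r t = 0" if "q \<in> P" "r \<in> P" "\<phi> v2 q = 0" "\<phi> v2 r = 0" for t q r
        using P0[OF that, of t] \<omega>_swap12[of t q r] \<omega>_cyclic[of q r t] by simp_all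
      have "\<omega> p q r = \<omega> (\<phi> v2 p *\<^sub>R w3 + s p) (\<phi> v2 q *\<^sub>R w3 + s q) (\<phi> v2 r *\<^sub>R w3 + s r)"
        by (simp add: s_def)
      then show ?thesis
        by (simp only: \<omega>_linear \<omega>_self) (simp add: P0 1 s that)
    qed
    \<comment> \<open>As \<open>w\<close> is a projected bracket, \<open>N w\<close> acts like a
      commutator. The pairings \<open>\<phi> (N s q) (N t r)\<close> factor into an expression
      symmetric in \<open>s\<close> and \<open>t\<close>, so the commutator pairs to zero.\<close>
    have wPP: "\<omega> w q r = 0" if "q \<in> P" "r \<in> P" for q r
    proof -
      have NN: "\<phi> (N s q) (N t r) = \<phi> v2 q * \<phi> v2 r * \<phi> (M s w3) (M t w3)" for s t
      proof -
        have "\<phi> (N s q) (N t r) = \<phi> (M s q) (M t r)"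
          using PD[OF MP[OF that(1), of s]] PD[OF MP[OF that(2), of t]] v(2)
          by (simp add: N_M[OF that(1)] N_M[OF that(2)] form_linear)
        also have "\<dots> = \<phi> v2 q * \<phi> v2 r * \<phi> (M s w3) (M t w3)"
          using ev2[OF w3(1)] form_sym[of v2 "M s w3"] form_sym[of v2 "M t w3"] v2(3)
          by (simp add: M_line[OF that(1) w3, of s] M_line[OF that(2) w3, of t] form_linear)
        finally show ?thesis .
      qed
      have "\<omega> w q r = \<phi> (N (br (x 0) (x 1)) q) r"
        using \<omega>_br[of "x 0" "x 1" q r] form_N[OF PD(1)[OF that(2)]] by (simp add: w_def)
      also have "\<dots> = - \<phi> (N (x 1) q) (N (x 0) r) + \<phi> (N (x 0) q) (N (x 1) r)"
        using N_skew[OF N_W PD(1)[OF that(2)]] by (simp add: N_bracket form_linear)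
      also have "\<dots> = 0" using form_sym[of "M (x 0) w3" "M (x 1) w3"] by (simp add: NN)
      finally show ?thesis .
    qed
    have Wv: "\<omega> v s t = 0" if "t \<in> W" for s t
      using form_N[OF that, of s v] v(4)[of s] \<omega>_swap12[of v s t] by (simp add: form_linear)
    have ab: "\<omega> p q r = 0" if pqr: "p \<in> W" "q \<in> W" "r \<in> W" for p q r
    proof -
      have 1: "\<omega> s v t = 0" if "t \<in> W" for s t using Wv[OF that, of s] \<omega>_swap12[of v s t] by simp
      have 2: "\<omega> t s v = 0" if "t \<in> W" for s t using 1[OF that, of s] \<omega>_cyclic[of t s v] \<omega>_swap12[of v t s] Wv[OF that, of s]
          \<omega>_cyclic[of v t s] \<omega>_swap23[of v s t] by simp
      have 3: "\<omega> q w r = 0" "\<omega> q r w = 0" if "q \<in> P" "r \<in> P" for q r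
        using wPP[OF that] \<omega>_swap12[of w q r] \<omega>_cyclic[of q r w] by simp_all
      obtain p' i where p': "p' \<in> P" "p = \<phi> v p *\<^sub>R w + i *\<^sub>R v + p'" using decP pqr by blast
      obtain q' j where q': "q' \<in> P" "q = \<phi> v q *\<^sub>R w + j *\<^sub>R v + q'" using decP pqr by blast
      obtain r' l where r': "r' \<in> P" "r = \<phi> v r *\<^sub>R w + l *\<^sub>R v + r'" using decP pqr by blast
      note W = PD(1)[OF p'(1)] PD(1)[OF q'(1)] PD(1)[OF r'(1)] wW v(1)
      show ?thesis
        by (subst p'(2), subst q'(2), subst r'(2), simp only: \<omega>_linear \<omega>_self)
          (simp add: Wv 1 2 3 W wPP PPP p'(1) q'(1) r'(1))
    qed
    have two: "(\<Sum>i<k. f i) = f 0 + f 1" for f :: "nat \<Rightarrow> 'a"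
      by (simp add: k numeral_2_eq_2)
    have N2: "N t p = a 0 t *\<^sub>R N (x 0) p + a 1 t *\<^sub>R N (x 1) p" if "p \<in> W" for t p
      using N_abelian[OF ab that, of t] by (simp add: two)
    have kernel: "p = 0" if p: "p \<in> P" "N (x 0) p = 0" "N (x 1) p = 0" for p
    proof (rule ccontr)
      assume "p \<noteq> 0"
      moreover have "N t p = 0" for t using N2[OF PD(1)[OF p(1)], of t] p(2,3) by simp
      ultimately have "\<phi> p w \<noteq> 0" using kernel_generator[OF k PD(1)[OF p(1)]] by (simp add: w_def)
      then show False using PD(5)[OF p(1)] by simp
    qed
    \<comment> \<open>\<open>M\<close> kills \<open>v2\<close>, so \<open>N t v2\<close> is
      \<open>- \<phi> (N t w) v2\<close> times \<open>v\<close>. If both numbers vanished,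
      \<open>v2\<close> would be in the common kernel but orthogonal to \<open>w\<close>.\<close>
    define s0 where "s0 = \<phi> (N (x 0) w) v2"
    define s1 where "s1 = \<phi> (N (x 1) w) v2"
    have "\<not> (s0 = 0 \<and> s1 = 0)"
      using kernel[OF v2(1)] N_M[OF v2(1)] v2(2,4) by (auto simp: s0_def s1_def)
    then have n0: "s0 * s0 + s1 * s1 \<noteq> 0" by (simp add: sum_squares_eq_zero_iff)
    define m where "m = s0 * s0 + s1 * s1"
    have m0: "m \<noteq> 0" using n0 by (simp add: m_def)
    \<comment> \<open>A unimodular change of generators, hence with the same \<open>w\<close>, after which \<open>N y1 w\<close> pairs with \<open>v2\<close>
      to 1 and \<open>N y2 w\<close> pairs with it to 0.\<close>
    define y1 where "y1 = (s0 / m) *\<^sub>R x 0 + (s1 / m) *\<^sub>R x 1"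
    define y2 where "y2 = (- s1) *\<^sub>R x 0 + s0 *\<^sub>R x 1"
    define A where "A X = s0 * a 0 X + s1 * a 1 X" for X
    define B where "B X = - (s1 / m) * a 0 X + (s0 / m) * a 1 X" for X
    have "s0 / m * s0 + s1 / m * s1 = (s0 * s0 + s1 * s1) / m" by (simp add: add_divide_distrib)
    then have s1s: "s0 / m * s0 + s1 / m * s1 = 1" using m0 unfolding m_def[symmetric] by simp
    have s1s': "s0 * s0 / m + s1 * s1 / m = 1" using s1s by simp
    have y12: "(\<Sum>i<k. a i X *\<^sub>R x i) = A X *\<^sub>R y1 + B X *\<^sub>R y2" for X
    proof -
      have "A X *\<^sub>R y1 + B X *\<^sub>R y2 = ((s0 / m * s0 + s1 / m * s1) * a 0 X) *\<^sub>R x 0 + ((s0 / m * s0 + s1 / m * s1) * a 1 X) *\<^sub>R x 1"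
        by (simp add: A_def B_def y1_def y2_def algebra_simps)
      then show ?thesis by (simp add: two s1s s1s')
    qed
    have wy: "w = \<pi> (br y1 y2)"
    proof -
      have "br y1 y2 = (s0 / m * s0 + s1 / m * s1) *\<^sub>R br (x 0) (x 1)"
        by (simp add: y1_def y2_def br_linear br_self br_skew[of "x 1" "x 0"] algebra_simps
            del: One_nat_def)
      then show ?thesis by (simp add: s1s s1s' w_def)
    qed
    have Ny1: "N y1 p = (s0 / m) *\<^sub>R N (x 0) p + (s1 / m) *\<^sub>R N (x 1) p"
      and Ny2: "N y2 p = (- s1) *\<^sub>R N (x 0) p + s0 *\<^sub>R N (x 1) p" for p
      by (simp_all only: y1_def y2_def N_add N_scale)
    have kernel': "p = 0" if p: "p \<in> P" "N y1 p = 0" "N y2 p = 0" for p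
    proof (rule kernel[OF p(1)])
      have "s0 *\<^sub>R N y1 p - (s1 / m) *\<^sub>R N y2 p = (s0 / m * s0 + s1 / m * s1) *\<^sub>R N (x 0) p"
        "s1 *\<^sub>R N y1 p + (s0 / m) *\<^sub>R N y2 p = (s0 / m * s0 + s1 / m * s1) *\<^sub>R N (x 1) p"
        by (simp_all add: Ny1 Ny2 algebra_simps)
      then show "N (x 0) p = 0" "N (x 1) p = 0" using p s1s s1s' by simp_all
    qed
    define w2 where "w2 = N y1 w"
    define e where "e = N y2 w"
    have NwP: "N t w \<in> P" for t using ev[OF wW] skew0[OF wW] N_W by (intro PI) auto
    have w2: "w2 \<in> P" "\<phi> v2 w2 = 1"
    proof -
      show "w2 \<in> P" by (simp add: w2_def NwP)
      have "\<phi> v2 w2 = \<phi> w2 v2" by (rule form_sym)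
      then show "\<phi> v2 w2 = 1" using s1s' by (simp add: w2_def Ny1 form_linear s0_def s1_def)
    qed
    have e: "e \<in> P" "\<phi> v2 e = 0"
    proof -
      show "e \<in> P" by (simp add: e_def NwP)
      have "\<phi> v2 e = \<phi> e v2" by (rule form_sym)
      then show "\<phi> v2 e = 0" by (simp add: e_def Ny2 form_linear s0_def s1_def)
    qed
    define f where "f = M y1 w2"
    have fP: "f \<in> P" using MP[OF w2(1)] by (simp add: f_def)
    have f0: "\<phi> v2 f = 0" "\<phi> w2 f = 0" "\<phi> f w2 = 0" "\<phi> f v2 = 0"
      using ev2[OF w2(1)] skewM[OF w2(1) w2(1), of y1] form_sym[of w2 f] form_sym[of v2 f] by (auto simp: f_def)
    have My1: "M y1 p = \<phi> v2 p *\<^sub>R f - \<phi> f p *\<^sub>R v2" if "p \<in> P" for p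
      using M_line[OF that w2, of y1] by (simp add: f_def)
    \<comment> \<open>\<open>w\<close> is the projection of \<open>br y1 y2\<close>, and
      \<open>\<omega> w w\<close> vanishes. The representation property turns this into
      \<open>N y1 (N y2 w) = N y2 (N y1 w)\<close>, which forces \<open>M y2 = 0\<close>.\<close>
    have "N (br y1 y2) w = 0"
    proof (rule W_eqI)
      fix r assume "r \<in> W"
      then show "\<phi> (N (br y1 y2) w) r = \<phi> 0 r"
        using \<omega>_br[of y1 y2 w r] by (simp add: form_N wy[symmetric] form_linear)
    qed (use N_W subspace_W in \<open>auto simp: real_vector.subspace_0\<close>)
    then have "N y1 e = N y2 w2" by (simp add: N_bracket w2_def e_def)
    then have "M y1 e - \<phi> w2 e *\<^sub>R v = M y2 w2 - \<phi> e w2 *\<^sub>R v"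
      using N_M[OF e(1), of y1] N_M[OF w2(1), of y2] by (simp add: w2_def e_def)
    then have "M y1 e = M y2 w2" by (simp add: form_sym[of w2 e])
    then have My2w: "M y2 w2 = - \<phi> f e *\<^sub>R v2" using My1[OF e(1)] e by simp
    have "\<phi> (M y2 w2) w2 = 0" using skewM[OF w2(1) w2(1), of y2] form_sym[of w2] by simp
    then have fe: "\<phi> f e = 0" using My2w w2 by (simp add: form_linear)
    have My2: "M y2 p = 0" if "p \<in> P" for p
      using M_line[OF that w2, of y2] My2w fe by (simp add: form_linear)
    have "f \<noteq> 0"
    proof
      assume "f = 0"
      then have 0: "M y1 p = 0 \<and> M y2 p = 0" if "p \<in> P" for p using My1 My2 that by (simp add: form_linear)
      have Nt: "N t p = A t *\<^sub>R N y1 p + B t *\<^sub>R N y2 p" if "p \<in> W" for t p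
      proof -
        have "A t *\<^sub>R N y1 p + B t *\<^sub>R N y2 p = ((s0 / m * s0 + s1 / m * s1) * a 0 t) *\<^sub>R N (x 0) p + ((s0 / m * s0 + s1 / m * s1) * a 1 t) *\<^sub>R N (x 1) p"
          by (simp add: A_def B_def Ny1 Ny2 algebra_simps)
        then show ?thesis using N2[OF that, of t] s1s s1s' by simp
      qed
      obtain t p where tp: "p \<in> P" "v2 = M t p" using v2(5) by blast
      have "v2 = A t *\<^sub>R M y1 p + B t *\<^sub>R M y2 p"
        using tp Nt[OF PD(1)[OF tp(1)], of t] by (simp add: M_def form_linear algebra_simps)
      then show False using 0[OF tp(1)] v2(2) by simp
    qed
    \<comment> \<open>The coefficient of \<open>v2\<close> in \<open>e\<close> that makes the
      remainder \<open>r\<close> orthogonal to \<open>w2\<close>.\<close>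
    define \<alpha> where "\<alpha> = \<phi> e w2"
    define r where "r = e - \<alpha> *\<^sub>R v2"
    have rP: "r \<in> P" using e v2(1) sP by (simp add: r_def real_vector.subspace_diff real_vector.subspace_scale)
    have r0: "\<phi> v2 r = 0" "\<phi> w2 r = 0" "\<phi> f r = 0" "\<phi> r f = 0" "\<phi> r v2 = 0"
      using e v2(3) w2 f0 fe form_sym[of w2 e] form_sym[of w2 v2] form_sym[of r f] form_sym[of r v2]
      by (auto simp: r_def \<alpha>_def form_linear)
    have er: "e = \<alpha> *\<^sub>R v2 + r" by (simp add: r_def)
    \<comment> \<open>An isotropic \<open>f\<close> would be killed by \<open>N y1\<close> and
      \<open>N y2\<close> although it lies in \<open>P\<close>, where the common kernel is zero. The
      same reasoning applies to \<open>r\<close> below.\<close>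
    have ff: "\<phi> f f \<noteq> 0"
    proof
      assume "\<phi> f f = 0"
      then have "f = 0"
        using N_M[OF fP, of y1] N_M[OF fP, of y2] My1[OF fP] My2[OF fP] f0 fe form_sym[of f e]
        by (intro kernel'[OF fP]) (simp_all add: w2_def[symmetric] e_def[symmetric])
      then show False using \<open>f \<noteq> 0\<close> by simp
    qed
    have rr: "r = 0 \<or> \<phi> r r \<noteq> 0"
    proof (cases "\<phi> r r = 0")
      case True
      then have "r = 0"
        using N_M[OF rP, of y1] N_M[OF rP, of y2] My1[OF rP] My2[OF rP] r0
        by (intro kernel'[OF rP]) (simp_all add: w2_def[symmetric] e_def[symmetric], simp add: er form_linear)
      then show ?thesis by simp
    qed simp
    have Ny: "N t p = \<phi> v p *\<^sub>R N t w - \<phi> (N t w) p *\<^sub>R v + M t p'"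
      if p: "p = \<phi> v p *\<^sub>R w + l *\<^sub>R v + p'" "p' \<in> P" for t p p' l
    proof -
      have 1: "\<phi> (N t w) p = \<phi> (N t w) p'"
        using skew0[OF wW, of t] ev[OF wW, of t] form_sym[of v "N t w"] by (subst p(1)) (simp add: form_linear)
      have "N t p = \<phi> v p *\<^sub>R N t w + N t p'"
        by (subst p(1)) (simp add: linear_add[OF linear_N] linear_scale[OF linear_N] v)
      then show ?thesis unfolding 1 by (simp add: N_M[OF p(2)])
    qed
    have Ny1f: "\<phi> (N y1 (\<pi> Y)) Z = \<phi> v Y * \<phi> w2 Z - \<phi> w2 Y * \<phi> v Z + \<phi> v2 Y * \<phi> f Z - \<phi> f Y * \<phi> v2 Z" for Y Z
    proof -
      obtain p' l where p': "p' \<in> P" "\<pi> Y = \<phi> v (\<pi> Y) *\<^sub>R w + l *\<^sub>R v + p'" using decP \<pi>_W by blast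
      have 1: "\<phi> v2 p' = \<phi> v2 (\<pi> Y)" "\<phi> f p' = \<phi> f (\<pi> Y)"
        using pd PD[OF fP] by (subst p'(2), simp add: form_linear)+
      show ?thesis
        using Ny[OF p'(2,1), of y1] My1[OF p'(1)] PD(1)[OF w2(1)] PD(1)[OF fP] pd(1) v(1)
        by (simp add: 1 w2_def[symmetric] form_linear form_\<pi>_right)
    qed
    have Ny2f: "\<phi> (N y2 (\<pi> Y)) Z = \<phi> v Y * (\<alpha> * \<phi> v2 Z + \<phi> r Z) - (\<alpha> * \<phi> v2 Y + \<phi> r Y) * \<phi> v Z" for Y Z
    proof -
      obtain p' l where p': "p' \<in> P" "\<pi> Y = \<phi> v (\<pi> Y) *\<^sub>R w + l *\<^sub>R v + p'" using decP \<pi>_W by blast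
      show ?thesis
        using Ny[OF p'(2,1), of y2] My2[OF p'(1)] PD(1)[OF rP] pd(1) v(1)
        by (simp add: e_def[symmetric] er form_linear form_\<pi>_right)
    qed
    have ca: "closed1 (a 0)" "closed1 (a 1)" using closed_a k by auto
    have ax: "a 0 (x 0) = 1" "a 1 (x 0) = 0" "a 0 (x 1) = 0" "a 1 (x 1) = 1" using a_x k by auto
    note la = linear_add linear_scale linear_diff linear_neg
    have lina: "linear (a 0)" "linear (a 1)" using ca by (auto simp: closed1_def)
    show ?thesis
    proof (rule exact_two_frame_rank_two[where a = A and b = B and x = y1 and y = y2 and w = w
        and v = v and v' = v2 and w' = w2 and f = f and r = r and \<alpha> = \<alpha>])
      show "closed1 A" "closed1 B"
        using ca unfolding closed1_def linear_iff A_def B_def by (simp_all add: algebra_simps)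
      show "A y1 = 1" "B y1 = 0" "A y2 = 0" "B y2 = 1"
        using ax s1s s1s' by (simp_all add: A_def B_def y1_def y2_def la[OF lina(1)] la[OF lina(2)] mult.commute
            del: One_nat_def)
      show "A p = 0 \<and> B p = 0 \<and> \<phi> p y1 = 0 \<and> \<phi> p y2 = 0" if "p \<in> {v, w, v2, w2, f, r}" for p
      proof -
        have "p \<in> W" using that v wW PD(1) v2 w2 fP rP by auto
        then show ?thesis using a_W W_x k by (simp add: A_def B_def y1_def y2_def form_linear)
      qed
      show "\<omega> X Y Z = wedge3 A B (\<phi> w) X Y Z + wedge3 A (\<phi> v) (\<phi> w2) X Y Z
       + wedge3 A (\<phi> v2) (\<phi> f) X Y Z + \<alpha> * wedge3 B (\<phi> v) (\<phi> v2) X Y Z + wedge3 B (\<phi> v) (\<phi> r) X Y Z" for X Y Z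
        by (subst expand2[OF ab y12]) (simp_all add: Ny1f Ny2f wy[symmetric] wedge3_def algebra_simps)
    qed (use v v2 w2 PD fP rP f0 r0 ff rr in auto)
  qed
qed

end

subsection \<open>Four generators\<close>

context reduced_form
begin

lemma expand3:
  assumes ab: "\<And>p q r. p \<in> W \<Longrightarrow> q \<in> W \<Longrightarrow> r \<in> W \<Longrightarrow> \<omega> p q r = 0" and k: "k = 3"
  shows "\<omega> X Y Z = \<omega> (x 0) (x 1) (x 2) * wedge3 (a 0) (a 1) (a 2) X Y Z
    + wedge3 (a 0) (a 1) (\<phi> (\<pi> (br (x 0) (x 1)))) X Y Z
    + wedge3 (a 0) (a 2) (\<phi> (\<pi> (br (x 0) (x 2)))) X Y Z
    + wedge3 (a 1) (a 2) (\<phi> (\<pi> (br (x 1) (x 2)))) X Y Z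
    + (a 0 X * \<phi> (N (x 0) (\<pi> Y)) Z + a 0 Y * \<phi> (N (x 0) (\<pi> Z)) X + a 0 Z * \<phi> (N (x 0) (\<pi> X)) Y)
    + (a 1 X * \<phi> (N (x 1) (\<pi> Y)) Z + a 1 Y * \<phi> (N (x 1) (\<pi> Z)) X + a 1 Z * \<phi> (N (x 1) (\<pi> X)) Y)
    + (a 2 X * \<phi> (N (x 2) (\<pi> Y)) Z + a 2 Y * \<phi> (N (x 2) (\<pi> Z)) X + a 2 Z * \<phi> (N (x 2) (\<pi> X)) Y)"
proof -
  have sk: "\<phi> (N t (\<pi> X)) Z = - \<phi> (N t (\<pi> Z)) X" for t X Z
    using \<omega>_swap23[of t "\<pi> X" "\<pi> Z"] by (simp add: \<omega>_xWW)
  have three: "(\<Sum>i<k. a i X *\<^sub>R x i) = a 0 X *\<^sub>R x 0 + a 1 X *\<^sub>R x 1 + a 2 X *\<^sub>R x 2" for X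
    by (simp add: k numeral_3_eq_3 numeral_2_eq_2)
  define y0 y1 y2 where y: "y0 = x 0" "y1 = x 1" "y2 = x 2"
  have s: "\<omega> y1 y0 y2 = - \<omega> y0 y1 y2" "\<omega> y0 y2 y1 = - \<omega> y0 y1 y2" "\<omega> y1 y2 y0 = \<omega> y0 y1 y2"
     "\<omega> y2 y0 y1 = \<omega> y0 y1 y2" "\<omega> y2 y1 y0 = - \<omega> y0 y1 y2"
    using \<omega>_swap12 \<omega>_swap23 \<omega>_cyclic by metis+
  show ?thesis
    unfolding \<omega>_decomp3[of X Y Z] three y[symmetric]
    by (simp add: \<omega>_linear s \<omega>_xxW[where s = y0 and t = y1] \<omega>_xxW[where s = y1 and t = y0]
        \<omega>_xxW[where s = y0 and t = y2] \<omega>_xxW[where s = y2 and t = y0]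
        \<omega>_xxW[where s = y1 and t = y2] \<omega>_xxW[where s = y2 and t = y1]
        \<omega>_xWW[where t = y0] \<omega>_xWW[where t = y1] \<omega>_xWW[where t = y2] ab[OF \<pi>_W \<pi>_W \<pi>_W]
        br_flip_\<pi>[of y1 y0] br_flip_\<pi>[of y2 y0] br_flip_\<pi>[of y2 y1] sk[of _ Y X] sk[of _ Z Y] sk[of _ X Z]
        wedge3_def algebra_simps)
qed

lemma expand4:
  assumes N: "\<And>t p. p \<in> W \<Longrightarrow> N t p = 0" and k: "k = 4"
  shows "\<omega> X Y Z = \<omega> (x 0) (x 1) (x 2) * wedge3 (a 0) (a 1) (a 2) X Y Z
    + \<omega> (x 0) (x 1) (x 3) * wedge3 (a 0) (a 1) (a 3) X Y Z
    + \<omega> (x 0) (x 2) (x 3) * wedge3 (a 0) (a 2) (a 3) X Y Z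
    + \<omega> (x 1) (x 2) (x 3) * wedge3 (a 1) (a 2) (a 3) X Y Z
    + wedge3 (a 0) (a 1) (\<phi> (\<pi> (br (x 0) (x 1)))) X Y Z
    + wedge3 (a 0) (a 2) (\<phi> (\<pi> (br (x 0) (x 2)))) X Y Z
    + wedge3 (a 0) (a 3) (\<phi> (\<pi> (br (x 0) (x 3)))) X Y Z
    + wedge3 (a 1) (a 2) (\<phi> (\<pi> (br (x 1) (x 2)))) X Y Z
    + wedge3 (a 1) (a 3) (\<phi> (\<pi> (br (x 1) (x 3)))) X Y Z
    + wedge3 (a 2) (a 3) (\<phi> (\<pi> (br (x 2) (x 3)))) X Y Z"
proof -
  have ab: "\<omega> t (\<pi> p) (\<pi> q) = 0" "\<omega> (\<pi> p) t (\<pi> q) = 0" "\<omega> (\<pi> p) (\<pi> q) t = 0" for t p q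
    using N[OF \<pi>_W] by (simp_all add: \<omega>_xWW form_linear)
  have four: "(\<Sum>i<k. a i X *\<^sub>R x i) = a 0 X *\<^sub>R x 0 + a 1 X *\<^sub>R x 1 + a 2 X *\<^sub>R x 2 + a 3 X *\<^sub>R x 3" for X
    by (simp add: k eval_nat_numeral)
  define y0 y1 y2 y3 where y: "y0 = x 0" "y1 = x 1" "y2 = x 2" "y3 = x 3"
  have s: "\<omega> y1 y0 t = - \<omega> y0 y1 t" "\<omega> y2 y0 t = - \<omega> y0 y2 t" "\<omega> y3 y0 t = - \<omega> y0 y3 t"
     "\<omega> y2 y1 t = - \<omega> y1 y2 t" "\<omega> y3 y1 t = - \<omega> y1 y3 t" "\<omega> y3 y2 t = - \<omega> y2 y3 t" for t
    using \<omega>_swap12 by metis+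
  have s': "\<omega> t y1 y0 = - \<omega> t y0 y1" "\<omega> t y2 y0 = - \<omega> t y0 y2" "\<omega> t y3 y0 = - \<omega> t y0 y3"
     "\<omega> t y2 y1 = - \<omega> t y1 y2" "\<omega> t y3 y1 = - \<omega> t y1 y3" "\<omega> t y3 y2 = - \<omega> t y2 y3" for t
    using \<omega>_swap23 by metis+
  show ?thesis
    unfolding \<omega>_decomp3[of X Y Z] four y[symmetric]
    by (simp add: \<omega>_linear s s' \<omega>_xxW[where s = y0 and t = y1] \<omega>_xxW[where s = y0 and t = y2]
        \<omega>_xxW[where s = y0 and t = y3] \<omega>_xxW[where s = y1 and t = y2]
        \<omega>_xxW[where s = y1 and t = y3] \<omega>_xxW[where s = y2 and t = y3]
        \<omega>_xxW[where t = y0 and s = y1] \<omega>_xxW[where t = y0 and s = y2]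
        \<omega>_xxW[where t = y0 and s = y3] \<omega>_xxW[where t = y1 and s = y2]
        \<omega>_xxW[where t = y1 and s = y3] \<omega>_xxW[where t = y2 and s = y3] ab
        br_flip_\<pi>[of y1 y0] br_flip_\<pi>[of y2 y0] br_flip_\<pi>[of y3 y0] br_flip_\<pi>[of y2 y1] br_flip_\<pi>[of y3 y1] br_flip_\<pi>[of y3 y2]
        wedge3_def algebra_simps)
qed


lemma line_exists:
  assumes "dim W \<le> 4" "p0 \<in> W" "N t0 p0 \<noteq> 0"
  shows "\<exists>v. v \<in> W \<and> v \<noteq> 0 \<and> \<phi> v v = 0 \<and> (\<forall>t. N t v = 0) \<and>
    (\<forall>t p w. p \<in> W \<longrightarrow> w \<in> W \<longrightarrow> \<phi> v w \<noteq> 0 \<longrightarrow>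
        \<phi> v w *\<^sub>R N t p = \<phi> v p *\<^sub>R N t w - \<phi> (N t w) p *\<^sub>R v)"
proof -
  obtain n where n: "\<And>ts p. length ts = n \<Longrightarrow> p \<in> W \<Longrightarrow> fold N ts p = 0" using N_nilpotent by blast
  have "\<exists>v. v \<in> W \<and> v \<noteq> 0 \<and> \<phi> v v = 0 \<and> (\<forall>t. N t v = 0) \<and> (\<exists>t p. p \<in> W \<and> v = N t p) \<and>
    (\<forall>t p w. p \<in> W \<longrightarrow> w \<in> W \<longrightarrow> \<phi> v w \<noteq> 0 \<longrightarrow>
        \<phi> v w *\<^sub>R N t p = \<phi> v p *\<^sub>R N t w - \<phi> (N t w) p *\<^sub>R v)"
    by (rule skew_nilpotent_family[OF bilinear_form form_sym subspace_W nondeg N_W linear_N N_skew n assms])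
  then show ?thesis by blast
qed

lemma form_N_kernel:
  assumes "v \<in> W" "\<And>t. N t v = 0" "p \<in> W"
  shows "\<phi> v (N t p) = 0"
  using N_skew[OF assms(1,3), of t] assms(2)[of t] by (simp add: form_linear)

lemma form_N_self: "p \<in> W \<Longrightarrow> \<phi> p (N t p) = 0" "p \<in> W \<Longrightarrow> \<phi> (N t p) p = 0"
  using N_skew[of p p t] form_sym[of "N t p" p] by simp_all

text \<open>\<open>N t w\<close> is orthogonal to \<open>w\<close> by skewness and to the kernel
  vector \<open>v\<close>, and these two already span \<open>W\<close>.\<close>

lemma N_eq_0_of_dim_le_2:
  assumes dimW: "dim W \<le> 2" and p: "p \<in> W"
  shows "N t p = 0"
proof (rule ccontr)
  assume nt: "N t p \<noteq> 0"
  obtain v where v: "v \<in> W" "v \<noteq> 0" "\<phi> v v = 0" "\<And>t. N t v = 0"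
    "\<And>t p w. p \<in> W \<Longrightarrow> w \<in> W \<Longrightarrow> \<phi> v w \<noteq> 0 \<Longrightarrow>
        \<phi> v w *\<^sub>R N t p = \<phi> v p *\<^sub>R N t w - \<phi> (N t w) p *\<^sub>R v"
    using line_exists[OF _ p nt] dimW by auto
  obtain w where w: "w \<in> W" "\<phi> v w \<noteq> 0" using nondeg v by blast
  have "v \<notin> span {}" using v by simp
  moreover have "w \<notin> span {v}"
    by (rule not_in_span_functional[OF linear_form[of v]]) (use v w in auto)
  ultimately have "independent {w, v} \<and> finite {w, v} \<and> card {w, v} = 2"
    using independent_card_insert[OF independent_card_insert[OF independent_card_empty]] by (simp add: numeral_2_eq_2)
  then have W: "W \<subseteq> span {w, v}" using independent_spans[of "{w, v}" W] v w dimW by simp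
  have "N t w = 0"
  proof (rule nondeg[OF N_W])
    fix q assume "q \<in> W"
    then show "\<phi> (N t w) q = 0"
      using real_vector.linear_eq_0_on_span[OF linear_form[of "N t w"], of "{w, v}" q] W
        form_N_self[OF w(1), of t] form_N_kernel[OF v(1,4) w(1), of t] form_sym[of v "N t w"] by auto
  qed
  then show False using v(5)[OF p w, of t] w nt by (simp add: form_linear)
qed

lemma exact_four_generators_divisible:
  assumes k: "k = 4" and N: "\<And>t p. p \<in> W \<Longrightarrow> N t p = 0"
    and \<beta>: "\<pi> (br (x 1) (x 2)) = 0" "\<pi> (br (x 1) (x 3)) = 0" "\<pi> (br (x 2) (x 3)) = 0"
  shows "exact \<omega>"
proof -
  have om: "\<omega> X Y Z = \<omega> (x 0) (x 1) (x 2) * wedge3 (a 0) (a 1) (a 2) X Y Z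
    + \<omega> (x 0) (x 1) (x 3) * wedge3 (a 0) (a 1) (a 3) X Y Z
    + \<omega> (x 0) (x 2) (x 3) * wedge3 (a 0) (a 2) (a 3) X Y Z
    + \<omega> (x 1) (x 2) (x 3) * wedge3 (a 1) (a 2) (a 3) X Y Z
    + wedge3 (a 0) (a 1) (\<phi> (\<pi> (br (x 0) (x 1)))) X Y Z
    + wedge3 (a 0) (a 2) (\<phi> (\<pi> (br (x 0) (x 2)))) X Y Z
    + wedge3 (a 0) (a 3) (\<phi> (\<pi> (br (x 0) (x 3)))) X Y Z" for X Y Z
    by (subst expand4[OF N k]) (simp_all add: \<beta> wedge3_def form_linear del: One_nat_def)
  have W: "\<phi> t (x 0) = 0 \<and> \<phi> t (x 1) = 0 \<and> \<phi> t (x 2) = 0 \<and> \<phi> t (x 3) = 0"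
    if "t \<in> {\<pi> (br (x 0) (x 1)), \<pi> (br (x 0) (x 2)), \<pi> (br (x 0) (x 3))}" for t
    using that W_x[OF _ \<pi>_W] k by auto
  show ?thesis
    by (rule exact_four_frame_divisible[OF _ _ _ _ om _ _ _ _ _ _ _ _ _ _ _ _ _ _ _ _ W])
      (use closed_a a_x k in auto)
qed

text \<open>The hypothesis on \<xi> says that the covector with coordinates \<xi> has zero wedge
  with every contraction of \<omega> by an element of \<open>W\<close>. Three shears turn it into a
  multiple of the coordinate at index 0, which is the divisible case.\<close>

lemma exact_four_generators_pencil:
  assumes k: "k = 4" and N: "\<And>t p. p \<in> W \<Longrightarrow> N t p = 0" and \<xi>: "\<xi> 0 \<noteq> 0"
    and \<beta>: "\<And>i j l. i < 4 \<Longrightarrow> j < 4 \<Longrightarrow> l < 4 \<Longrightarrow> \<xi> i *\<^sub>R \<pi> (br (x j) (x l)) - \<xi> j *\<^sub>R \<pi> (br (x i) (x l))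
       + \<xi> l *\<^sub>R \<pi> (br (x i) (x j)) = 0"
  shows "exact \<omega>"
proof -
  define r where "r j = - \<xi> j / \<xi> 0" for j
  have "reduced_form br \<phi> S W \<pi> k (x(1 := x 1 + r 1 *\<^sub>R x 0)) (a(0 := \<lambda>X. a 0 X - r 1 * a 1 X))"
    by (rule shear) (use k in auto)
  from reduced_form.shear[OF this, of 0 2 "r 2"] k
  have "reduced_form br \<phi> S W \<pi> k (x(1 := x 1 + r 1 *\<^sub>R x 0, 2 := x 2 + r 2 *\<^sub>R x 0))
    (a(0 := \<lambda>X. a 0 X - r 1 * a 1 X - r 2 * a 2 X))" by simp
  from reduced_form.shear[OF this, of 0 3 "r 3"] k
  have R: "reduced_form br \<phi> S W \<pi> k (x(1 := x 1 + r 1 *\<^sub>R x 0, 2 := x 2 + r 2 *\<^sub>R x 0, 3 := x 3 + r 3 *\<^sub>R x 0))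
    (a(0 := \<lambda>X. a 0 X - r 1 * a 1 X - r 2 * a 2 X - r 3 * a 3 X))" by simp
  have 0: "\<pi> (br (x j + r j *\<^sub>R x 0) (x l + r l *\<^sub>R x 0)) = 0" if "j < 4" "l < 4" for j l
  proof -
    have "\<pi> (br (x j + r j *\<^sub>R x 0) (x l + r l *\<^sub>R x 0)) =
        (1 / \<xi> 0) *\<^sub>R (\<xi> 0 *\<^sub>R \<pi> (br (x j) (x l)) - \<xi> j *\<^sub>R \<pi> (br (x 0) (x l)) + \<xi> l *\<^sub>R \<pi> (br (x 0) (x j)))"
      using \<xi> by (simp add: r_def br_linear br_self linear_add[OF linear_\<pi>] linear_diff[OF linear_\<pi>] linear_scale[OF linear_\<pi>]
          linear_neg[OF linear_\<pi>] br_skew[of "x j" "x 0"] algebra_simps)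
    then show ?thesis using \<beta>[of 0 j l] that by simp
  qed
  show ?thesis
    by (rule reduced_form.exact_four_generators_divisible[OF R k])
      (use N 0[of 1 2] 0[of 1 3] 0[of 2 3] in auto)
qed

text \<open>Contractions of \<omega> by vectors of \<open>W\<close> are 2-forms in the closed
  coordinates, and their products with these coordinates are exact. Either such products fill the
  four-dimensional space of closed 3-forms, or they lie in a hyperplane and the 2-forms share a
  linear factor.\<close>

lemma exact_four_generators:
  assumes k: "k = 4" and dimW: "dim W \<le> 2"
  shows "exact \<omega>"
proof -
  have N: "N t p = 0" if "p \<in> W" for t p by (rule N_eq_0_of_dim_le_2[OF dimW that])
  define b where "b i j = \<pi> (br (x i) (x j))" for i j
  have ca: "closed1 (a 0)" "closed1 (a 1)" "closed1 (a 2)" "closed1 (a 3)" using closed_a k by auto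
  have ax: "a 0 (x 0) = 1" "a 0 (x 1) = 0" "a 0 (x 2) = 0" "a 0 (x 3) = 0" "a 1 (x 0) = 0" "a 1 (x 1) = 1"
    "a 1 (x 2) = 0" "a 1 (x 3) = 0" "a 2 (x 0) = 0" "a 2 (x 1) = 0" "a 2 (x 2) = 1" "a 2 (x 3) = 0"
    "a 3 (x 0) = 0" "a 3 (x 1) = 0" "a 3 (x 2) = 0" "a 3 (x 3) = 1" using a_x k by auto
  \<comment> \<open>Quadruples of reals model the third exterior power of the four coordinates, so
    that \<open>span\<close> and an inner product are at hand.\<close>
  define \<Theta> where "\<Theta> = (\<lambda>(r, s, t, u) X Y Z. r * wedge3 (a 0) (a 1) (a 2) X Y Z + s * wedge3 (a 0) (a 1) (a 3) X Y Z
     + t * wedge3 (a 0) (a 2) (a 3) X Y Z + u * wedge3 (a 1) (a 2) (a 3) X Y Z)"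
  define E where "E = {c. exact (\<Theta> c)}"
  have sE: "subspace E"
    unfolding real_vector.subspace_def E_def
  proof (intro conjI ballI allI)
    show "0 \<in> {c. exact (\<Theta> c)}" using exact_0 by (simp add: \<Theta>_def zero_prod_def)
    show "c + c' \<in> {c. exact (\<Theta> c)}" if "c \<in> {c. exact (\<Theta> c)}" "c' \<in> {c. exact (\<Theta> c)}" for c c'
    proof -
      have "exact (\<Theta> c)" "exact (\<Theta> c')" using that by auto
      then have "exact (\<Theta> (c + c'))"
        by (rule exact_comb[where r = 1 and s = 1]) (simp add: \<Theta>_def algebra_simps split: prod.splits)
      then show ?thesis by simp
    qed
    show "r *\<^sub>R c \<in> {c. exact (\<Theta> c)}" if "c \<in> {c. exact (\<Theta> c)}" for r c
    proof -
      have "exact (\<Theta> c)" using that by auto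
      then have "exact (\<Theta> (r *\<^sub>R c))"
        by (rule exact_scale[where r = r]) (simp add: \<Theta>_def algebra_simps split: prod.splits)
      then show ?thesis by simp
    qed
  qed
  \<comment> \<open>For each \<open>f\<close>, the quadruples of \<open>a 0\<close> to
    \<open>a 3\<close> wedged with the contraction of \<omega> by \<open>f\<close>.\<close>
  define T where "T = (\<Union>f\<in>W. {(\<phi> (b 1 2) f, \<phi> (b 1 3) f, \<phi> (b 2 3) f, 0),
      (- \<phi> (b 0 2) f, - \<phi> (b 0 3) f, 0, \<phi> (b 2 3) f), (\<phi> (b 0 1) f, 0, - \<phi> (b 0 3) f, - \<phi> (b 1 3) f),
      (0, \<phi> (b 0 1) f, \<phi> (b 0 2) f, \<phi> (b 1 2) f)})"
  have om: "\<omega> f Y Z = \<phi> (b 0 1) f * (a 0 Y * a 1 Z - a 0 Z * a 1 Y) + \<phi> (b 0 2) f * (a 0 Y * a 2 Z - a 0 Z * a 2 Y)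
     + \<phi> (b 0 3) f * (a 0 Y * a 3 Z - a 0 Z * a 3 Y) + \<phi> (b 1 2) f * (a 1 Y * a 2 Z - a 1 Z * a 2 Y)
     + \<phi> (b 1 3) f * (a 1 Y * a 3 Z - a 1 Z * a 3 Y) + \<phi> (b 2 3) f * (a 2 Y * a 3 Z - a 2 Z * a 3 Y)"
    if "f \<in> W" for f Y Z
    using a_W[OF _ that] k by (subst expand4[OF N k]) (simp_all add: b_def wedge3_def algebra_simps)
  have "T \<subseteq> E"
  proof -
    have "exact (\<Theta> (\<phi> (b 1 2) f, \<phi> (b 1 3) f, \<phi> (b 2 3) f, 0))"
      "exact (\<Theta> (- \<phi> (b 0 2) f, - \<phi> (b 0 3) f, 0, \<phi> (b 2 3) f))"
      "exact (\<Theta> (\<phi> (b 0 1) f, 0, - \<phi> (b 0 3) f, - \<phi> (b 1 3) f))"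
      "exact (\<Theta> (0, \<phi> (b 0 1) f, \<phi> (b 0 2) f, \<phi> (b 1 2) f))" if f: "f \<in> W" for f
      by (rule exact_cong[OF exact_wedge1[OF ca(1), of f]], simp add: om[OF f] \<Theta>_def wedge3_def algebra_simps,
          rule exact_cong[OF exact_wedge1[OF ca(2), of f]], simp add: om[OF f] \<Theta>_def wedge3_def algebra_simps,
          rule exact_cong[OF exact_wedge1[OF ca(3), of f]], simp add: om[OF f] \<Theta>_def wedge3_def algebra_simps,
          rule exact_cong[OF exact_wedge1[OF ca(4), of f]], simp add: om[OF f] \<Theta>_def wedge3_def algebra_simps)
    then show ?thesis by (auto simp: T_def E_def)
  qed
  then have TE: "span T \<subseteq> E" using sE real_vector.span_minimal by blast
  show ?thesis
  proof (cases "span T = UNIV")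
    case True
    then have "exact (\<Theta> c)" for c using TE by (auto simp: E_def)
    from this[of "(1, 0, 0, 0)"] this[of "(0, 1, 0, 0)"] this[of "(0, 0, 1, 0)"] this[of "(0, 0, 0, 1)"]
    have e: "exact (wedge3 (a 0) (a 1) (a 2))" "exact (wedge3 (a 0) (a 1) (a 3))"
      "exact (wedge3 (a 0) (a 2) (a 3))" "exact (wedge3 (a 1) (a 2) (a 3))" by (simp_all add: \<Theta>_def)
    have Wx: "\<phi> t (x 0) = 0 \<and> \<phi> t (x 1) = 0 \<and> \<phi> t (x 2) = 0 \<and> \<phi> t (x 3) = 0"
      if "t \<in> {\<pi> (br (x 0) (x 1)), \<pi> (br (x 0) (x 2)), \<pi> (br (x 0) (x 3)),
        \<pi> (br (x 1) (x 2)), \<pi> (br (x 1) (x 3)), \<pi> (br (x 2) (x 3))}" for t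
      using that W_x[OF _ \<pi>_W] k by auto
    show ?thesis
      by (rule exact_four_frame_total[OF ca expand4[OF N k] ax Wx e])
  next
    case False
    then obtain z where z: "z \<noteq> 0" "\<And>c. c \<in> span T \<Longrightarrow> z \<bullet> c = 0" using span_not_UNIV_orthogonal by blast
    obtain z1 z2 z3 z4 where zz: "z = (z1, z2, z3, z4)" by (metis prod_cases4)
    \<comment> \<open>If \<open>z\<close> annihilates the ideal generated by the 2-forms \<open>\<phi> (b i j) f\<close>, its Hodge dual \<open>\<xi>\<close> divides
      all of them.\<close>
    define \<xi> :: "nat \<Rightarrow> real" where "\<xi> i = (if i = 0 then z4 else if i = 1 then - z3 else if i = 2 then z2 else - z1)" for i
    have rel: "\<xi> i *\<^sub>R \<pi> (br (x j) (x l)) - \<xi> j *\<^sub>R \<pi> (br (x i) (x l)) + \<xi> l *\<^sub>R \<pi> (br (x i) (x j)) = 0"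
      if ijl: "i < 4" "j < 4" "l < 4" for i j l
    proof (rule nondeg)
      show "\<xi> i *\<^sub>R \<pi> (br (x j) (x l)) - \<xi> j *\<^sub>R \<pi> (br (x i) (x l)) + \<xi> l *\<^sub>R \<pi> (br (x i) (x j)) \<in> W"
        using \<pi>_W subspace_W by (auto intro!: real_vector.subspace_add real_vector.subspace_diff real_vector.subspace_scale)
      fix f assume f: "f \<in> W"
      have zT: "z \<bullet> c = 0" if "c \<in> T" for c using z(2) that real_vector.span_base by blast
      have mem: "(\<phi> (b 1 2) f, \<phi> (b 1 3) f, \<phi> (b 2 3) f, 0) \<in> T"
        "(- \<phi> (b 0 2) f, - \<phi> (b 0 3) f, 0, \<phi> (b 2 3) f) \<in> T"
        "(\<phi> (b 0 1) f, 0, - \<phi> (b 0 3) f, - \<phi> (b 1 3) f) \<in> T"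
        "(0, \<phi> (b 0 1) f, \<phi> (b 0 2) f, \<phi> (b 1 2) f) \<in> T"
        using f unfolding T_def by blast+
      have e: "z1 * \<phi> (b 1 2) f + z2 * \<phi> (b 1 3) f + z3 * \<phi> (b 2 3) f = 0"
        "- z1 * \<phi> (b 0 2) f - z2 * \<phi> (b 0 3) f + z4 * \<phi> (b 2 3) f = 0"
        "z1 * \<phi> (b 0 1) f - z3 * \<phi> (b 0 3) f - z4 * \<phi> (b 1 3) f = 0"
        "z2 * \<phi> (b 0 1) f + z3 * \<phi> (b 0 2) f + z4 * \<phi> (b 1 2) f = 0"
        using mem[THEN zT] by (simp_all add: zz)
      have s: "\<phi> (b 1 0) f = - \<phi> (b 0 1) f" "\<phi> (b 2 0) f = - \<phi> (b 0 2) f" "\<phi> (b 3 0) f = - \<phi> (b 0 3) f"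
        "\<phi> (b 2 1) f = - \<phi> (b 1 2) f" "\<phi> (b 3 1) f = - \<phi> (b 1 3) f" "\<phi> (b 3 2) f = - \<phi> (b 2 3) f"
        unfolding b_def by (rule br_flip_\<pi>)+
      have s0: "\<phi> (b i i) f = 0" for i by (simp add: b_def br_self linear_0[OF linear_\<pi>] form_linear)
      have "i \<in> {0, 1, 2, 3}" "j \<in> {0, 1, 2, 3}" "l \<in> {0, 1, 2, 3}" using ijl by auto
      then have "\<xi> i * \<phi> (b j l) f - \<xi> j * \<phi> (b i l) f + \<xi> l * \<phi> (b i j) f = 0"
        by (elim insertE emptyE; hypsubst; simp add: \<xi>_def s s0 del: One_nat_def; (use e in linarith)?)
      then show "\<phi> (\<xi> i *\<^sub>R \<pi> (br (x j) (x l)) - \<xi> j *\<^sub>R \<pi> (br (x i) (x l)) + \<xi> l *\<^sub>R \<pi> (br (x i) (x j))) f = 0"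
        by (simp add: b_def form_linear)
    qed
    have "\<exists>i<4. \<xi> i \<noteq> 0"
    proof (rule ccontr)
      assume "\<not> ?thesis"
      then have "\<xi> 0 = 0" "\<xi> 1 = 0" "\<xi> 2 = 0" "\<xi> 3 = 0" by auto
      then show False using z(1) by (simp add: \<xi>_def zz zero_prod_def)
    qed
    then obtain i where i: "i < 4" "\<xi> i \<noteq> 0" by blast
    \<comment> \<open>Brings a nonzero coordinate of \<xi> to index 0, where the pencil argument
      divides by it.\<close>
    define s where "s = Transposition.transpose 0 i"
    have s: "s permutes {..<k}" unfolding s_def by (rule permutes_swap_id) (use i k in auto)
    have sk: "s j < 4" if "j < 4" for j using permutes_in_image[OF s, of j] that k by simp
    show ?thesis
      by (rule reduced_form.exact_four_generators_pencil[OF permute[OF s] k N, of "\<xi> \<circ> s"])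
        (use rel sk i in \<open>auto simp: s_def\<close>)
  qed
qed

end

subsection \<open>Three generators\<close>

context reduced_form
begin

text \<open>Names what \<open>line_exists\<close> provides. It mentions \<phi>, \<open>W\<close> and
  \<open>N\<close> but neither \<open>x\<close> nor \<open>a\<close>, so it survives the changes of
  generators in this part.\<close>

definition line :: "'a \<Rightarrow> bool" where
  "line v \<longleftrightarrow> v \<in> W \<and> v \<noteq> 0 \<and> \<phi> v v = 0 \<and> (\<forall>t. N t v = 0) \<and>
    (\<forall>t p w. p \<in> W \<longrightarrow> w \<in> W \<longrightarrow> \<phi> v w \<noteq> 0 \<longrightarrow>
        \<phi> v w *\<^sub>R N t p = \<phi> v p *\<^sub>R N t w - \<phi> (N t w) p *\<^sub>R v)"

lemma lineD:
  assumes "line v"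
  shows "v \<in> W" "v \<noteq> 0" "\<phi> v v = 0" "N t v = 0"
    "p \<in> W \<Longrightarrow> w \<in> W \<Longrightarrow> \<phi> v w = 1 \<Longrightarrow> N t p = \<phi> v p *\<^sub>R N t w - \<phi> (N t w) p *\<^sub>R v"
proof -
  note l = assms[unfolded line_def]
  show "v \<in> W" "v \<noteq> 0" "\<phi> v v = 0" "N t v = 0" using l by blast+
  assume p: "p \<in> W" and w: "w \<in> W" "\<phi> v w = 1"
  have "\<phi> v w *\<^sub>R N t p = \<phi> v p *\<^sub>R N t w - \<phi> (N t w) p *\<^sub>R v"
    using l p w(1) by (metis w(2) zero_neq_one)
  then show "N t p = \<phi> v p *\<^sub>R N t w - \<phi> (N t w) p *\<^sub>R v" unfolding w(2) by simp
qed

lemma line_scale: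
  assumes l: "line v" and r: "r \<noteq> 0"
  shows "line (r *\<^sub>R v)"
  unfolding line_def
proof (intro conjI allI impI)
  show "r *\<^sub>R v \<in> W" using lineD(1)[OF l] subspace_W by (simp add: real_vector.subspace_scale)
  show "r *\<^sub>R v \<noteq> 0" using lineD(2)[OF l] r by simp
  show "\<phi> (r *\<^sub>R v) (r *\<^sub>R v) = 0" using lineD(3)[OF l] by (simp add: form_linear)
  show "N t (r *\<^sub>R v) = 0" for t using lineD(4)[OF l] by (simp add: linear_scale[OF linear_N])
  fix t p w assume pw: "p \<in> W" "w \<in> W" "\<phi> (r *\<^sub>R v) w \<noteq> 0"
  then have "\<phi> v w \<noteq> 0" by (simp add: form_linear)
  then have "\<phi> v w *\<^sub>R N t p = \<phi> v p *\<^sub>R N t w - \<phi> (N t w) p *\<^sub>R v"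
    using l pw unfolding line_def by blast
  from arg_cong[OF this, of "scaleR r"]
  show "\<phi> (r *\<^sub>R v) w *\<^sub>R N t p = \<phi> (r *\<^sub>R v) p *\<^sub>R N t w - \<phi> (N t w) p *\<^sub>R r *\<^sub>R v"
    by (simp add: form_linear scaleR_right_diff_distrib mult.commute)
qed

lemma line_dual:
  assumes "line v"
  shows "\<exists>w\<in>W. \<phi> v w = 1"
proof -
  obtain w where "w \<in> W" "\<phi> v w \<noteq> 0" using nondeg lineD[OF assms] by blast
  then show ?thesis using subspace_W
    by (intro bexI[of _ "(1 / \<phi> v w) *\<^sub>R w"]) (auto simp: form_linear real_vector.subspace_scale)
qed

lemma line_abelian:
  assumes "line v" "p \<in> W" "q \<in> W" "r \<in> W"
  shows "\<omega> p q r = 0"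
proof -
  obtain w where w: "w \<in> W" "\<phi> v w = 1" using line_dual[OF assms(1)] by blast
  show ?thesis by (rule abelian_of_line[OF lineD(1)[OF assms(1)] w lineD(5)[OF assms(1) _ w] assms(2-4)])
qed

lemma N_line_eq_0_iff:
  assumes "line v" "w \<in> W" "\<phi> v w = 1"
  shows "(\<forall>p\<in>W. N t p = 0) \<longleftrightarrow> N t w = 0"
proof
  assume 0: "N t w = 0"
  show "\<forall>p\<in>W. N t p = 0"
  proof
    fix p assume "p \<in> W"
    from lineD(5)[OF assms(1) this assms(2,3), of t] show "N t p = 0" unfolding 0 by (simp add: form_linear)
  qed
qed (use assms in blast)

text \<open>The projected Jacobi identity; on three generators it constrains how the brackets pair
  with \<open>v\<close> and with the images of \<open>w\<close>.\<close>

lemma N_cocycle: "N X (\<pi> (br Y Z)) + N Y (\<pi> (br Z X)) + N Z (\<pi> (br X Y)) = 0"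
  using jacobi[of X Y Z] linear_0[OF linear_\<pi>] by (simp add: N_\<pi>_br flip: linear_add[OF linear_\<pi>])

lemma three_sum: "k = 3 \<Longrightarrow> (\<Sum>i<k. f i) = f 0 + f 1 + (f 2 :: 'b::comm_monoid_add)"
  by (simp add: numeral_3_eq_3 numeral_2_eq_2)

lemma dual_pair:
  assumes e: "e \<in> W" "e' \<in> W" and ind: "\<And>s t. s *\<^sub>R e + t *\<^sub>R e' = 0 \<Longrightarrow> s = 0 \<and> t = 0"
  shows "\<exists>u\<in>W. \<phi> e u = 1 \<and> \<phi> e' u = 0"
proof -
  have "e' \<noteq> 0" using ind[of 0 1] by auto
  then obtain u1 where u1: "u1 \<in> W" "\<phi> e' u1 \<noteq> 0" using nondeg e by blast
  define f where "f = \<phi> e' u1 *\<^sub>R e - \<phi> e u1 *\<^sub>R e'"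
  have "f \<noteq> 0" using ind[of "\<phi> e' u1" "- \<phi> e u1"] u1 by (auto simp: f_def)
  moreover have "f \<in> W" using e subspace_W by (simp add: f_def real_vector.subspace_diff real_vector.subspace_scale)
  ultimately obtain z where z: "z \<in> W" "\<phi> f z \<noteq> 0" using nondeg by blast
  define u where "u = (1 / \<phi> f z) *\<^sub>R (\<phi> e' u1 *\<^sub>R z - \<phi> e' z *\<^sub>R u1)"
  have "u \<in> W" using z u1 subspace_W by (simp add: u_def real_vector.subspace_diff real_vector.subspace_scale)
  moreover have "\<phi> e' u = 0" by (simp add: u_def form_linear)
  moreover have "\<phi> e' u1 * \<phi> e z - \<phi> e' z * \<phi> e u1 = \<phi> f z" by (simp add: f_def form_linear mult.commute)
  then have "\<phi> e u = 1" using z by (simp add: u_def form_linear)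
  ultimately show ?thesis by blast
qed

lemma exact_three_generators_normal:
  assumes k: "k = 3" and dimW: "dim W \<le> 4" and v: "line v" and w: "w = \<pi> (br (x 0) (x 1))" "\<phi> v w = 1"
    and N2: "N (x 2) w = 0"
    and pq: "\<phi> v (\<pi> (br (x 0) (x 2))) = 0" "\<phi> v (\<pi> (br (x 1) (x 2))) = 0"
    and rank: "(\<forall>s t. s *\<^sub>R N (x 0) w + t *\<^sub>R N (x 1) w = 0 \<longrightarrow> s = 0 \<and> t = 0) \<or>
       N (x 1) w = 0 \<and> N (x 0) w \<noteq> 0"
  shows "exact \<omega>"
proof -
  define e where "e = N (x 0) w"
  define e' where "e' = N (x 1) w"
  define p where "p = \<pi> (br (x 0) (x 2))"
  define q where "q = \<pi> (br (x 1) (x 2))"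
  have WW: "v \<in> W" "w \<in> W" "e \<in> W" "e' \<in> W" "p \<in> W" "q \<in> W"
    using lineD[OF v] \<pi>_W N_W by (auto simp: w e_def e'_def p_def q_def)
  note L = lineD(5)[OF v _ WW(2) w(2)]
  have g: "\<phi> v e = 0" "\<phi> v e' = 0" "\<phi> w e = 0" "\<phi> w e' = 0"
    using form_N_kernel[OF WW(1) lineD(4)[OF v] WW(2)] form_N_self[OF WW(2)] by (auto simp: e_def e'_def)
  have n: "\<phi> (N t (\<pi> Y)) Z = \<phi> v Y * \<phi> (N t w) Z - \<phi> (N t w) Y * \<phi> v Z" for t Y Z
    by (subst L[OF \<pi>_W]) (simp add: form_linear form_\<pi>_right WW N_W)
  have om: "\<omega> X Y Z = \<omega> (x 0) (x 1) (x 2) * wedge3 (a 0) (a 1) (a 2) X Y Z + wedge3 (a 0) (a 1) (\<phi> w) X Y Z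
       + wedge3 (a 0) (a 2) (\<phi> p) X Y Z + wedge3 (a 1) (a 2) (\<phi> q) X Y Z
       + wedge3 (a 0) (\<phi> v) (\<phi> e) X Y Z + wedge3 (a 1) (\<phi> v) (\<phi> e') X Y Z" for X Y Z
    by (subst expand3[OF line_abelian[OF v] k])
      (simp_all add: n N2 e_def e'_def p_def q_def w(1)[symmetric] wedge3_def form_linear algebra_simps del: One_nat_def)
  have ca: "closed1 (a 0)" "closed1 (a 1)" "closed1 (a 2)" using closed_a k by auto
  have ax: "a 0 (x 0) = 1" "a 1 (x 0) = 0" "a 2 (x 0) = 0" "a 0 (x 1) = 0" "a 1 (x 1) = 1" "a 2 (x 1) = 0"
    "a 0 (x 2) = 0" "a 1 (x 2) = 0" "a 2 (x 2) = 1" using a_x k by auto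
  have pq': "\<phi> v p = 0" "\<phi> v q = 0" using pq by (auto simp: p_def q_def)
  interpret T: three_frame br \<phi> "x 0" "x 1" "x 2" v w e e' p q "a 0" "a 1" "a 2" "\<omega> (x 0) (x 1) (x 2)"
  proof
    show "a 0 t = 0 \<and> a 1 t = 0 \<and> a 2 t = 0 \<and> \<phi> t (x 0) = 0 \<and> \<phi> t (x 1) = 0 \<and> \<phi> t (x 2) = 0"
      if "t \<in> {v, w, e, e', p, q}" for t
    proof -
      have "t \<in> W" using that WW by auto
      then show ?thesis using a_W W_x k by auto
    qed
  qed (fact ca ax om lineD(3)[OF v] w(2) g pq')+
  have au: "a 0 u = 0" "a 1 u = 0" "a 2 u = 0" if "u \<in> W" for u using a_W[OF _ that] k by auto
  show ?thesis
    using rank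
  proof
    assume ind: "\<forall>s t. s *\<^sub>R N (x 0) w + t *\<^sub>R N (x 1) w = 0 \<longrightarrow> s = 0 \<and> t = 0"
    obtain u where u: "u \<in> W" "\<phi> e u = 1" "\<phi> e' u = 0"
      using dual_pair[OF WW(3,4)] ind by (auto simp: e_def e'_def)
    obtain u' where u': "u' \<in> W" "\<phi> e' u' = 1" "\<phi> e u' = 0"
      using dual_pair[OF WW(4,3)] ind by (auto simp: e_def e'_def add.commute)
    show ?thesis by (rule T.exact_rank_two[OF au[OF u(1)] u(2,3) au[OF u'(1)] u'(3,2)])
  next
    assume r: "N (x 1) w = 0 \<and> N (x 0) w \<noteq> 0"
    then have e: "e' = 0" "e \<noteq> 0" by (auto simp: e_def e'_def)
    obtain u0 where u0: "u0 \<in> W" "\<phi> e u0 \<noteq> 0" using nondeg e WW by blast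
    define u where "u = (1 / \<phi> e u0) *\<^sub>R u0"
    have u: "u \<in> W" "\<phi> e u = 1" using u0 subspace_W by (auto simp: u_def form_linear real_vector.subspace_scale)
    \<comment> \<open>In the Jacobi identity the terms of \<open>x 1\<close> and \<open>x 2\<close>
      vanish. As \<open>q\<close> is orthogonal to \<open>v\<close>, the line formula reduces what
      remains to \<open>\<phi> e q = 0\<close>.\<close>
    have "N (x 0) q = 0"
      using N_cocycle[of "x 0" "x 1" "x 2"] L[OF \<pi>_W, of "x 1" "br (x 2) (x 0)"] N2 e(1)
      by (simp add: q_def e'_def form_linear w(1)[symmetric] del: One_nat_def)
    then have "\<phi> e q *\<^sub>R v = 0" using L[OF WW(6), of "x 0"] pq' by (simp add: e_def[symmetric] q_def[symmetric])
    then have qe: "\<phi> q e = 0" using lineD(2)[OF v] form_sym[of q e] by simp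
    have vspan: "v \<notin> span {e}"
      by (rule not_in_span_functional[OF linear_form[of w]]) (use g w(2) form_sym[of w v] in auto)
    have "e \<notin> span {}" using e by simp
    note i2 = independent_card_insert[OF independent_card_insert[OF independent_card_empty this] vspan]
    have in3: "\<exists>\<alpha> \<beta> \<gamma>. y = \<alpha> *\<^sub>R v + \<beta> *\<^sub>R e + \<gamma> *\<^sub>R z" if "y \<in> span {z, v, e}" for y z
    proof -
      have "\<exists>\<gamma> \<alpha> \<beta>. y - \<gamma> *\<^sub>R z - \<alpha> *\<^sub>R v - \<beta> *\<^sub>R e \<in> span {}"
        using that unfolding real_vector.span_breakdown_eq .
      then obtain \<alpha> \<beta> \<gamma> where "y - \<gamma> *\<^sub>R z - \<alpha> *\<^sub>R v - \<beta> *\<^sub>R e = 0" by auto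
      then have "y = \<alpha> *\<^sub>R v + \<beta> *\<^sub>R e + \<gamma> *\<^sub>R z" by (simp add: algebra_simps)
      then show ?thesis by blast
    qed
    \<comment> \<open>These are the alternatives of \<open>exact_rank_one\<close>. In the last one
      \<open>w\<close>, \<open>p\<close>, \<open>v\<close>, \<open>e\<close> fill \<open>W\<close>,
      so \<open>q\<close> is a combination of \<open>v\<close> and \<open>e\<close> alone;
      \<open>\<phi> q e = 0\<close> then makes \<open>e\<close> isotropic, and nondegeneracy yields
      \<open>\<phi> e p \<noteq> 0\<close>.\<close>
    consider (p) "p \<in> span {q, v, e}" | (q) "q \<in> span {v}" | (n) "p \<notin> span {q, v, e}" "q \<notin> span {v}" by blast
    then show ?thesis
    proof cases
      case p
      then obtain \<alpha> \<beta> \<gamma> where "p = \<alpha> *\<^sub>R v + \<beta> *\<^sub>R e + \<gamma> *\<^sub>R q" using in3 by blast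
      then show ?thesis by (rule T.exact_rank_one[OF au[OF u(1)] u(2) e(1) qe disjI1])
    next
      case q
      then obtain \<alpha> where "q = \<alpha> *\<^sub>R v" by (auto simp: real_vector.span_singleton)
      then show ?thesis by (rule T.exact_rank_one[OF au[OF u(1)] u(2) e(1) qe disjI2[OF disjI1]])
    next
      case n
      have p2: "p \<notin> span {v, e}" using n(1) real_vector.span_mono[of "{v, e}" "{q, v, e}"] by auto
      note i3 = independent_card_insert[OF i2 p2]
      have w3: "w \<notin> span {p, v, e}"
        by (rule not_in_span_functional[OF linear_form[of v]]) (use g w(2) lineD[OF v] pq in \<open>auto simp: p_def\<close>)
      note i4 = independent_card_insert[OF i3 w3]
      have sp: "W \<subseteq> span {w, p, v, e}" using i4 dimW WW by (intro independent_spans) auto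
      have "q \<in> span {p, v, e}"
      proof (rule ccontr)
        assume q: "q \<notin> span {p, v, e}"
        have "w \<notin> span {q, p, v, e}"
          by (rule not_in_span_functional[OF linear_form[of v]]) (use g w(2) lineD[OF v] pq in \<open>auto simp: p_def q_def\<close>)
        note independent_card_insert[OF independent_card_insert[OF i3 q] this]
        then have "5 \<le> dim W" using independent_le_dim[of "{w, q, p, v, e}" W] WW by simp
        then show False using dimW by simp
      qed
      then obtain \<alpha> \<kappa> \<mu> where q: "q = \<alpha> *\<^sub>R v + \<kappa> *\<^sub>R e + \<mu> *\<^sub>R p" using in3 by blast
      have "\<mu> = 0"
      proof (rule ccontr)
        assume m: "\<mu> \<noteq> 0"
        have "\<mu> *\<^sub>R p = q - \<alpha> *\<^sub>R v - \<kappa> *\<^sub>R e" by (simp add: q)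
        moreover have "p = (1 / \<mu>) *\<^sub>R (\<mu> *\<^sub>R p)" using m by simp
        ultimately have "p = (1 / \<mu>) *\<^sub>R (q - \<alpha> *\<^sub>R v - \<kappa> *\<^sub>R e)" by simp
        also have "\<dots> \<in> span {q, v, e}"
          by (intro real_vector.span_scale real_vector.span_diff real_vector.span_base) auto
        finally show False using n(1) by simp
      qed
      then have q': "q = \<alpha> *\<^sub>R v + \<kappa> *\<^sub>R e" using q by simp
      have "\<kappa> \<noteq> 0" using n(2) q' by (auto simp: real_vector.span_singleton)
      moreover have "\<phi> q e = \<kappa> * \<phi> e e" by (subst q') (simp add: form_linear g)
      ultimately have ee: "\<phi> e e = 0" using qe by simp
      have "\<phi> e p \<noteq> 0"
      proof
        assume ep: "\<phi> e p = 0"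
        have "\<phi> e t = 0" if "t \<in> W" for t
          using real_vector.linear_eq_0_on_span[OF linear_form[of e], of "{w, p, v, e}" t] sp that ep ee g(1,3) form_sym[of e w]
            form_sym[of e v] by auto
        then show False using nondeg[OF WW(3)] e by blast
      qed
      with q' ee have "q = \<alpha> *\<^sub>R v + \<kappa> *\<^sub>R e \<and> \<phi> e e = 0 \<and> \<phi> e p \<noteq> 0" by blast
      then show ?thesis by (rule T.exact_rank_one[OF au[OF u(1)] u(2) e(1) qe disjI2[OF disjI2]])
    qed
  qed
qed

lemma line_generator:
  assumes k: "k = 3" and v: "line v"
  shows "\<phi> v (\<pi> (br (x 0) (x 1))) \<noteq> 0 \<or> \<phi> v (\<pi> (br (x 0) (x 2))) \<noteq> 0 \<or> \<phi> v (\<pi> (br (x 1) (x 2))) \<noteq> 0"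
proof (rule ccontr)
  assume n: "\<not> ?thesis"
  have "v = 0"
  proof (rule generated[OF lineD(1,4)[OF v]])
    fix i j :: nat assume "i < j" "j < k"
    then have "i = 0 \<and> j = 1 \<or> i = 0 \<and> j = 2 \<or> i = 1 \<and> j = 2" using k by auto
    then show "\<phi> v (br (x i) (x j)) = 0" using n form_\<pi>_right[OF lineD(1)[OF v]] by auto
  qed
  then show False using lineD(2)[OF v] by simp
qed

lemma exact_three_generators_rank_one_aux:
  assumes k: "k = 3" and dimW: "dim W \<le> 4" and v: "line v"
    and N: "\<And>p. p \<in> W \<Longrightarrow> N (x 1) p = 0" "\<And>p. p \<in> W \<Longrightarrow> N (x 2) p = 0"
    and nt: "p0 \<in> W" "N (x 0) p0 \<noteq> 0"
    and \<beta>: "\<phi> v (\<pi> (br (x 0) (x 1))) \<noteq> 0" "\<phi> v (\<pi> (br (x 1) (x 2))) = 0"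
  shows "exact \<omega>"
proof -
  define g where "g = \<phi> v (\<pi> (br (x 0) (x 1)))"
  \<comment> \<open>Chosen to make \<open>v\<close> orthogonal to the bracket of \<open>x 0\<close>
    with the new generator \<open>x 2 + r *\<^sub>R x 1\<close>.\<close>
  define r where "r = - \<phi> v (\<pi> (br (x 0) (x 2))) / g"
  have g0: "g \<noteq> 0" using \<beta> by (simp add: g_def)
  have v': "line ((1 / g) *\<^sub>R v)" using line_scale[OF v] g0 by simp
  have R: "reduced_form br \<phi> S W \<pi> k (x(2 := x 2 + r *\<^sub>R x 1)) (a(1 := \<lambda>X. a 1 X - r * a 2 X))"
    by (rule shear) (use k in auto)
  let ?w = "\<pi> (br (x 0) (x 1))"
  have w: "\<phi> ((1 / g) *\<^sub>R v) ?w = 1" using g0 by (simp add: form_linear g_def)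
  have "N (x 0) ?w \<noteq> 0" using N_line_eq_0_iff[OF v' \<pi>_W w] nt by blast
  moreover have "N (x 2 + r *\<^sub>R x 1) ?w = 0" using N \<pi>_W by (simp add: N_add N_scale)
  moreover have "\<phi> v (\<pi> (br (x 0) (x 2 + r *\<^sub>R x 1))) = 0"
    using g0 by (simp only: br_linear linear_add[OF linear_\<pi>] linear_scale[OF linear_\<pi>] form_linear)
      (simp add: r_def g_def)
  moreover have "\<phi> v (\<pi> (br (x 1) (x 2 + r *\<^sub>R x 1))) = 0"
    using \<beta> by (simp add: br_linear br_self linear_add[OF linear_\<pi>] linear_scale[OF linear_\<pi>] linear_0[OF linear_\<pi>] form_linear)
  ultimately show ?thesis
    by (intro reduced_form.exact_three_generators_normal[OF R k dimW v', of ?w])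
      (use w N \<pi>_W in \<open>auto simp: form_linear\<close>)
qed

lemma nontrivial_generator:
  assumes k: "k = 3" and v: "line v" and nt: "p0 \<in> W" "N t0 p0 \<noteq> 0"
  shows "N (x 0) p0 \<noteq> 0 \<or> N (x 1) p0 \<noteq> 0 \<or> N (x 2) p0 \<noteq> 0"
  using N_abelian[OF line_abelian[OF v] nt(1), of t0] nt three_sum[OF k, of "\<lambda>i. a i t0 *\<^sub>R N (x i) p0"]
  by (auto simp del: One_nat_def)

lemma exact_three_generators_rank_one:
  assumes k: "k = 3" and dimW: "dim W \<le> 4" and v: "line v"
    and N: "\<And>p. p \<in> W \<Longrightarrow> N (x 1) p = 0" "\<And>p. p \<in> W \<Longrightarrow> N (x 2) p = 0"
    and nt: "p0 \<in> W" "N t0 p0 \<noteq> 0"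
  shows "exact \<omega>"
proof -
  have nt': "N (x 0) p0 \<noteq> 0" using nontrivial_generator[OF k v nt] N nt by auto
  obtain w where w: "w \<in> W" "\<phi> v w = 1" using line_dual[OF v] by blast
  have \<beta>12: "\<phi> v (\<pi> (br (x 1) (x 2))) = 0"
  proof (rule ccontr)
    assume 0: "\<phi> v (\<pi> (br (x 1) (x 2))) \<noteq> 0"
    \<comment> \<open>By the cocycle identity. Since this vector pairs with \<open>v\<close>, the
      line formula based on it would kill \<open>N (x 0)\<close>.\<close>
    have "N (x 0) (\<pi> (br (x 1) (x 2))) = 0"
      using N_cocycle[of "x 0" "x 1" "x 2"] N[OF \<pi>_W] by (simp del: One_nat_def)
    then have "\<phi> v (\<pi> (br (x 1) (x 2))) *\<^sub>R N (x 0) p0 = \<phi> v p0 *\<^sub>R 0 - \<phi> 0 p0 *\<^sub>R v"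
      using v nt(1) \<pi>_W 0 unfolding line_def by metis
    then show False using 0 nt' by (simp add: form_linear)
  qed
  show ?thesis
  proof (cases "\<phi> v (\<pi> (br (x 0) (x 1))) = 0")
    case False
    show ?thesis by (rule exact_three_generators_rank_one_aux[OF k dimW v N nt(1) nt' False \<beta>12])
  next
    case True
    then have 2: "\<phi> v (\<pi> (br (x 0) (x 2))) \<noteq> 0" using line_generator[OF k v] \<beta>12 by auto
    define s :: "nat \<Rightarrow> nat" where "s = Transposition.transpose 1 2"
    have s: "s permutes {..<k}" unfolding s_def by (rule permutes_swap_id) (use k in auto)
    have s': "s 0 = 0" "s 1 = 2" "s 2 = 1" by (auto simp: s_def transpose_def)
    have "\<phi> v (\<pi> (br (x 2) (x 1))) = 0"
      by (subst br_skew) (simp add: linear_neg[OF linear_\<pi>] form_linear \<beta>12 del: One_nat_def)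
    then show ?thesis
      by (intro reduced_form.exact_three_generators_rank_one_aux[OF permute[OF s] k dimW v _ _ nt(1)])
        (simp_all add: s' N nt nt' 2 del: One_nat_def)
  qed
qed

text \<open>If \<open>x 0\<close> and \<open>x 1\<close> act independently, the cocycle identity
  makes \<open>v\<close> orthogonal to their brackets with \<open>x 2\<close>, as the normal form
  demands. Otherwise a combination of them acts trivially too, and a single acting generator is
  left.\<close>

lemma exact_three_generators_kernel:
  assumes k: "k = 3" and dimW: "dim W \<le> 4" and v: "line v"
    and N: "\<And>p. p \<in> W \<Longrightarrow> N (x 2) p = 0"
    and nt: "p0 \<in> W" "N t0 p0 \<noteq> 0"
  shows "exact \<omega>"
proof -
  obtain w0 where w0: "w0 \<in> W" "\<phi> v w0 = 1" using line_dual[OF v] by blast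
  note L = lineD(5)[OF v _ w0]
  define e where "e i = N (x i) w0" for i
  have lin0: "(\<forall>p\<in>W. s *\<^sub>R N (x 0) p + t *\<^sub>R N (x 1) p = 0) \<longleftrightarrow> s *\<^sub>R e 0 + t *\<^sub>R e 1 = 0" for s t
    using N_line_eq_0_iff[OF v w0, of "s *\<^sub>R x 0 + t *\<^sub>R x 1"] by (simp add: N_add N_scale e_def)
  show ?thesis
  proof (cases "\<forall>s t. s *\<^sub>R e 0 + t *\<^sub>R e 1 = 0 \<longrightarrow> s = 0 \<and> t = 0")
    case True
    let ?p = "\<pi> (br (x 0) (x 2))" and ?q = "\<pi> (br (x 1) (x 2))"
    have "N (x 0) ?q = N (x 1) ?p"
    proof -
      have "N (x 0) ?q + N (x 1) (\<pi> (br (x 2) (x 0))) + N (x 2) (\<pi> (br (x 0) (x 1))) = 0" by (rule N_cocycle)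
      moreover have "\<pi> (br (x 2) (x 0)) = - ?p" by (subst br_skew) (simp add: linear_neg[OF linear_\<pi>])
      ultimately show ?thesis using N[OF \<pi>_W] by (simp add: linear_neg[OF linear_N] del: One_nat_def)
    qed
    then have "\<phi> v ?q *\<^sub>R e 0 - \<phi> (e 0) ?q *\<^sub>R v = \<phi> v ?p *\<^sub>R e 1 - \<phi> (e 1) ?p *\<^sub>R v"
      using L[OF \<pi>_W] unfolding e_def by metis
    then have eq: "\<phi> v ?q *\<^sub>R e 0 + (- \<phi> v ?p) *\<^sub>R e 1 = (\<phi> (e 0) ?q - \<phi> (e 1) ?p) *\<^sub>R v"
      by (simp add: algebra_simps)
    \<comment> \<open>Pairing with \<open>w0\<close> annihilates the \<open>e i\<close> and so
      isolates the coefficient of \<open>v\<close>.\<close>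
    have "\<phi> w0 (e i) = 0" for i by (simp add: e_def form_N_self[OF w0(1)])
    then have "\<phi> w0 ((\<phi> (e 0) ?q - \<phi> (e 1) ?p) *\<^sub>R v) = 0"
      unfolding eq[symmetric] by (simp add: form_linear)
    then have "\<phi> (e 0) ?q - \<phi> (e 1) ?p = 0" using w0(2) form_sym[of w0 v] by (simp add: form_linear)
    then have "\<phi> v ?q *\<^sub>R e 0 + (- \<phi> v ?p) *\<^sub>R e 1 = 0" unfolding eq by simp
    then have "\<phi> v ?q = 0 \<and> - \<phi> v ?p = 0" using True by blast
    then have pq: "\<phi> v ?p = 0" "\<phi> v ?q = 0" by auto
    define g where "g = \<phi> v (\<pi> (br (x 0) (x 1)))"
    have g0: "g \<noteq> 0" using line_generator[OF k v] pq by (simp add: g_def)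
    have v': "line ((1 / g) *\<^sub>R v)" using line_scale[OF v] g0 by simp
    let ?w = "\<pi> (br (x 0) (x 1))"
    have w: "\<phi> ((1 / g) *\<^sub>R v) ?w = 1" using g0 by (simp add: form_linear g_def)
    have ind: "s = 0 \<and> t = 0" if "s *\<^sub>R N (x 0) ?w + t *\<^sub>R N (x 1) ?w = 0" for s t
    proof -
      have "N (s *\<^sub>R x 0 + t *\<^sub>R x 1) ?w = 0" using that by (simp add: N_add N_scale)
      then have "\<forall>p\<in>W. N (s *\<^sub>R x 0 + t *\<^sub>R x 1) p = 0" using N_line_eq_0_iff[OF v' \<pi>_W w] by blast
      then show ?thesis using True lin0[of s t] by (simp add: N_add N_scale)
    qed
    show ?thesis
      by (rule exact_three_generators_normal[OF k dimW v' refl w N[OF \<pi>_W]])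
        (use pq ind in \<open>auto simp: form_linear\<close>)
  next
    case False
    then obtain s t where st: "s \<noteq> 0 \<or> t \<noteq> 0" "s *\<^sub>R e 0 + t *\<^sub>R e 1 = 0" by blast
    show ?thesis
    proof (cases "t = 0")
      case True
      then have "N (x 0) w0 = 0" using st by (simp add: e_def)
      then have N0: "N (x 0) p = 0" if "p \<in> W" for p using N_line_eq_0_iff[OF v w0] that by blast
      define \<sigma> :: "nat \<Rightarrow> nat" where "\<sigma> = Transposition.transpose 0 1"
      have \<sigma>: "\<sigma> permutes {..<k}" unfolding \<sigma>_def by (rule permutes_swap_id) (use k in auto)
      have \<sigma>': "\<sigma> 1 = 0" "\<sigma> 2 = 2" by (auto simp: \<sigma>_def transpose_def)
      show ?thesis
        by (rule reduced_form.exact_three_generators_rank_one[OF permute[OF \<sigma>] k dimW v _ _ nt])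
          (use N N0 in \<open>auto simp: \<sigma>' simp del: One_nat_def\<close>)
    next
      case False
      have R: "reduced_form br \<phi> S W \<pi> k (x(1 := x 1 + (s / t) *\<^sub>R x 0)) (a(0 := \<lambda>X. a 0 X - (s / t) * a 1 X))"
        by (rule shear) (use k in auto)
      have "N (x 1 + (s / t) *\<^sub>R x 0) w0 = (1 / t) *\<^sub>R (s *\<^sub>R e 0 + t *\<^sub>R e 1)"
        using False by (simp add: N_add N_scale e_def algebra_simps)
      then have "N (x 1 + (s / t) *\<^sub>R x 0) w0 = 0" using st by simp
      then have "N (x 1 + (s / t) *\<^sub>R x 0) p = 0" if "p \<in> W" for p
        using N_line_eq_0_iff[OF v w0] that by blast
      then show ?thesis
        by (intro reduced_form.exact_three_generators_rank_one[OF R k dimW v _ _ nt]) (use N in auto)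
    qed
  qed
qed

lemma exact_three_generators_dependent:
  assumes k: "k = 3" and dimW: "dim W \<le> 4" and v: "line v"
    and w: "w \<in> W" "\<phi> v w = 1" and N: "N (x 2) w \<in> span {N (x 0) w, N (x 1) w}"
    and nt: "p0 \<in> W" "N t0 p0 \<noteq> 0"
  shows "exact \<omega>"
proof -
  have "\<exists>s t. N (x 2) w - s *\<^sub>R N (x 0) w - t *\<^sub>R N (x 1) w \<in> span {}"
    using N unfolding real_vector.span_breakdown_eq .
  then obtain s t where st: "N (x 2) w - s *\<^sub>R N (x 0) w - t *\<^sub>R N (x 1) w = 0" by auto
  have "reduced_form br \<phi> S W \<pi> k (x(2 := x 2 + (- s) *\<^sub>R x 0)) (a(0 := \<lambda>X. a 0 X - (- s) * a 2 X))"
    by (rule shear) (use k in auto)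
  from reduced_form.shear[OF this, of 1 2 "- t"] k
  have R: "reduced_form br \<phi> S W \<pi> k (x(2 := x 2 - s *\<^sub>R x 0 - t *\<^sub>R x 1))
      (a(0 := \<lambda>X. a 0 X + s * a 2 X, 1 := \<lambda>X. a 1 X + t * a 2 X))" by simp
  have "N (x 2 - s *\<^sub>R x 0 - t *\<^sub>R x 1) w = N (x 2 + (- s) *\<^sub>R x 0 + (- t) *\<^sub>R x 1) w" by simp
  also have "\<dots> = 0" using st unfolding N_add N_scale by simp
  finally have "N (x 2 - s *\<^sub>R x 0 - t *\<^sub>R x 1) p = 0" if "p \<in> W" for p
    using N_line_eq_0_iff[OF v w] that by blast
  then show ?thesis
    by (intro reduced_form.exact_three_generators_kernel[OF R k dimW v _ nt]) simp
qed

lemma exact_three_generators: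
  assumes k: "k = 3" and dimW: "dim W \<le> 4"
  shows "exact \<omega>"
proof (cases "\<forall>p\<in>W. \<forall>t. N t p = 0")
  case True
  have ab: "\<omega> p q r = 0" if "p \<in> W" "q \<in> W" "r \<in> W" for p q r
    using form_N[OF that(3), of p q] True that by (simp add: form_linear)
  show ?thesis
  proof (cases "\<forall>p\<in>W. p = 0")
    case True
    then show ?thesis by (intro exact_trivial) blast
  next
    case False
    then obtain f where f: "f \<in> W" "f \<noteq> 0" by blast
    let ?r = "\<pi> (br (x 0) (x 1))" and ?p = "\<pi> (br (x 0) (x 2))" and ?q = "\<pi> (br (x 1) (x 2))"
    have "\<phi> f ?r \<noteq> 0 \<or> \<phi> f ?p \<noteq> 0 \<or> \<phi> f ?q \<noteq> 0"
    proof (rule ccontr)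
      assume n: "\<not> ?thesis"
      have "f = 0"
      proof (rule generated[OF f(1)])
        show "N t f = 0" for t using True f by blast
        fix i j :: nat assume "i < j" "j < k"
        then have "i = 0 \<and> j = 1 \<or> i = 0 \<and> j = 2 \<or> i = 1 \<and> j = 2" using k by auto
        then show "\<phi> f (br (x i) (x j)) = 0" using n form_\<pi>_right[OF f(1)] by auto
      qed
      then show False using f by simp
    qed
    then have nz: "\<phi> ?r f \<noteq> 0 \<or> \<phi> ?p f \<noteq> 0 \<or> \<phi> ?q f \<noteq> 0" using form_sym by metis
    have n0: "\<phi> (N t (\<pi> Y)) Z = 0" for t Y Z using True \<pi>_W by (simp add: form_linear)
    have om: "\<omega> X Y Z = \<omega> (x 0) (x 1) (x 2) * wedge3 (a 0) (a 1) (a 2) X Y Z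
      + wedge3 (a 0) (a 1) (\<phi> ?r) X Y Z + wedge3 (a 0) (a 2) (\<phi> ?p) X Y Z + wedge3 (a 1) (a 2) (\<phi> ?q) X Y Z" for X Y Z
      by (subst expand3[OF ab k]) (simp_all add: n0 del: One_nat_def)
    have ca: "closed1 (a 0)" "closed1 (a 1)" "closed1 (a 2)" using closed_a k by auto
    have ax: "a 0 (x 0) = 1" "a 1 (x 0) = 0" "a 2 (x 0) = 0" "a 0 (x 1) = 0" "a 1 (x 1) = 1" "a 2 (x 1) = 0"
      "a 0 (x 2) = 0" "a 1 (x 2) = 0" "a 2 (x 2) = 1" using a_x k by auto
    have Wx: "a 0 t = 0 \<and> a 1 t = 0 \<and> a 2 t = 0 \<and> \<phi> t (x 0) = 0 \<and> \<phi> t (x 1) = 0 \<and> \<phi> t (x 2) = 0"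
      if "t \<in> {?r, ?p, ?q, f}" for t
    proof -
      have "t \<in> W" using that \<pi>_W f by auto
      then show ?thesis using a_W W_x k by auto
    qed
    show ?thesis by (rule exact_three_frame_trivial[OF ca om ax Wx nz])
  qed
next
  case False
  then obtain p0 t0 where nt: "p0 \<in> W" "N t0 p0 \<noteq> 0" by blast
  obtain v where v: "line v" using line_exists[OF dimW nt] unfolding line_def by blast
  obtain w where w: "w \<in> W" "\<phi> v w = 1" using line_dual[OF v] by blast
  define e where "e i = N (x i) w" for i
  have eW: "e i \<in> W" "\<phi> v (e i) = 0" "\<phi> w (e i) = 0" for i
    using N_W form_N_kernel[OF lineD(1,4)[OF v] w(1)] form_N_self[OF w(1)] by (auto simp: e_def)
  \<comment> \<open>All \<open>e i\<close> are orthogonal to the nondegenerate plane of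
    \<open>v\<close> and \<open>w\<close>, which in dimension 4 leaves room for only two independent
    ones.\<close>
  consider "e 2 \<in> span {e 0, e 1}" | "e 1 \<in> span {e 0}" | "e 0 = 0"
  proof (rule ccontr)
    assume "\<not> thesis"
    then have n: "e 2 \<notin> span {e 1, e 0}" "e 1 \<notin> span {e 0}" "e 0 \<notin> span {}" using that by (auto simp: insert_commute)
    have nv: "v \<notin> span {e 2, e 1, e 0}"
      by (rule not_in_span_functional[OF linear_form[of w]]) (use eW w form_sym[of w v] in auto)
    have nw: "w \<notin> span {v, e 2, e 1, e 0}"
      by (rule not_in_span_functional[OF linear_form[of v]]) (use eW w lineD(3)[OF v] in auto)
    note independent_card_insert[OF independent_card_insert[OF independent_card_insert[OF
      independent_card_insert[OF independent_card_insert[OF independent_card_empty n(3)] n(2)] n(1)] nv] nw]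
    then have "5 \<le> dim W" using independent_le_dim[of "{w, v, e 2, e 1, e 0}" W] w eW lineD(1)[OF v] by simp
    then show False using dimW by simp
  qed
  then show ?thesis
  proof cases
    case 1
    then show ?thesis by (intro exact_three_generators_dependent[OF k dimW v w _ nt]) (simp add: e_def)
  next
    case 2
    define s :: "nat \<Rightarrow> nat" where "s = Transposition.transpose 1 2"
    have s: "s permutes {..<k}" unfolding s_def by (rule permutes_swap_id) (use k in auto)
    have s': "s 0 = 0" "s 1 = 2" "s 2 = 1" by (auto simp: s_def transpose_def)
    have "e 1 \<in> span {e 0, e 2}" using 2 real_vector.span_mono[of "{e 0}" "{e 0, e 2}"] by blast
    then show ?thesis
      by (intro reduced_form.exact_three_generators_dependent[OF permute[OF s] k dimW v w _ nt])
        (simp add: e_def s' del: One_nat_def)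
  next
    case 3
    define s :: "nat \<Rightarrow> nat" where "s = Transposition.transpose 0 2"
    have s: "s permutes {..<k}" unfolding s_def by (rule permutes_swap_id) (use k in auto)
    have s': "s 2 = 0" by (auto simp: s_def transpose_def)
    show ?thesis
      by (rule reduced_form.exact_three_generators_dependent[OF permute[OF s] k dimW v w _ nt])
        (use 3 in \<open>simp add: e_def s' real_vector.span_zero\<close>)
  qed
qed

end

subsection \<open>Dimension at most ten\<close>

lemma (in reduced_form) exact_of_dim_le_10:
  assumes "2 * k + dim W \<le> 10"
  shows "exact \<omega>"
proof -
  consider "k \<le> 1" | "k = 2" | "k = 3" | "k = 4" | "dim W = 0" using assms by linarith
  then show ?thesis
  proof cases
    case 1
    then show ?thesis by (rule exact_one_generator)
  next
    case 5
    show ?thesis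
    proof (rule exact_trivial)
      fix p assume "p \<in> W"
      have "W \<subseteq> span {}" using independent_spans[of "{}" W] 5 by (simp add: real_vector.independent_empty)
      then show "p = 0" using \<open>p \<in> W\<close> by auto
    qed
  qed (use assms in \<open>auto intro: exact_two_generators exact_three_generators exact_four_generators\<close>)
qed

section \<open>Adjoints for a metric, and the passage from the dual to the algebra\<close>

lemma Riesz_metric:
  fixes g :: "'a::real_vector \<Rightarrow> 'a \<Rightarrow> real"
  assumes F: "fin_dim (S :: 'a set)" and g: "metric_form g" and l: "linear l"
  shows "\<exists>X. \<forall>Y. g X Y = l Y"
proof -
  have "\<exists>p\<in>UNIV. \<forall>q\<in>UNIV. g p q = l q"
    using g by (intro fin_dim.Riesz[OF F] l real_vector.subspace_UNIV) (auto simp: metric_form_def)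
  then show ?thesis by simp
qed

lemma metric_eqI:
  assumes g: "metric_form g" and eq: "\<And>Z. g X Z = g Y Z"
  shows "X = Y"
proof -
  have "bilinear g" using g by (simp add: metric_form_def)
  then have "\<forall>Z. g (X - Y) Z = 0" using eq by (simp add: bilinear_lsub)
  then have "X - Y = 0" using g unfolding metric_form_def by blast
  then show ?thesis by simp
qed

lemma metric_adjoint:
  fixes g :: "'a::real_vector \<Rightarrow> 'a \<Rightarrow> real"
  assumes F: "fin_dim (S :: 'a set)" and g: "metric_form g" and D: "linear D"
  shows "g (D X) Y = g X (metric_adjoint g D Y)"
proof -
  have b: "bilinear g" and sym: "g X Y = g Y X" for X Y
    using g by (auto simp: metric_form_def)
  have "\<exists>h. \<forall>X. g h X = g (D X) Y" for Y
    using b D by (intro Riesz_metric[OF F g]) (auto simp: bilinear_def linear_iff)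
  then obtain h where h: "\<And>X Y. g (h Y) X = g (D X) Y" by metis
  have "metric_adjoint g D = h"
    unfolding metric_adjoint_def
  proof (rule the_equality)
    show "\<forall>X Y. g (D X) Y = g X (h Y)" using h sym by simp
    show "h' = h" if h': "\<forall>X Y. g (D X) Y = g X (h' Y)" for h'
    proof (intro ext metric_eqI[OF g])
      fix Y Z
      show "g (h' Y) Z = g (h Y) Z" using h'[rule_format, of Z Y] h[of Y Z] sym[of Z "h' Y"] by simp
    qed
  qed
  then show ?thesis using h[of Y X] sym[of X "h Y"] by simp
qed

text \<open>An ad-invariant metric identifies the algebra with its dual equivariantly. Adjoints
  become transposes and derivations become dual derivations, so the splitting of
  \<open>\<Phi>\<close> can be carried back.\<close>

lemma Tstar_solitary_imp_solitary:
  fixes br :: "'a::real_vector \<Rightarrow> 'a \<Rightarrow> 'a"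
  assumes L: "lie_algebra br" and F: "fin_dim (S :: 'a set)" and T: "Tstar_solitary br"
    and g: "metric_form g" "ad_invariant_form br g"
  shows "solitary br g"
  unfolding solitary_def
proof (intro conjI g allI impI, elim conjE)
  interpret invariant_form br g
    using L g by (simp add: invariant_form_def invariant_form_axioms_def metric_form_def)
  note nd = metric_eqI[OF g(1)]
  fix \<phi> assume \<phi>: "linear \<phi>" "ad_invariant_map br \<phi>" "metric_adjoint g \<phi> = \<phi>"
  define \<Phi> where "\<Phi> X Y = g (\<phi> X) Y" for X Y
  have "bilinear \<Phi>"
    using \<phi>(1) bilinear_form by (auto simp: bilinear_def linear_iff \<Phi>_def)
  moreover have "ad_invariant_form br \<Phi>"
    using \<phi>(2) by (simp add: ad_invariant_form_def ad_invariant_map_def \<Phi>_def form_br)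
  moreover have "\<Phi> = dual_transpose \<Phi>"
  proof (intro ext)
    fix X Y
    show "\<Phi> X Y = dual_transpose \<Phi> X Y"
      using metric_adjoint[OF F g(1) \<phi>(1), of X Y] form_sym[of X "\<phi> Y"] by (simp add: \<Phi>_def dual_transpose_def \<phi>(3))
  qed
  ultimately obtain D' where D': "dual_derivation br D'" "\<Phi> = (\<lambda>X Y. D' X Y + dual_transpose D' X Y)"
    using T unfolding Tstar_solitary_def by blast
  have bD': "bilinear D'" using D' by (simp add: dual_derivation_def)
  have "\<exists>d. \<forall>Y. g d Y = D' X Y" for X
    using bD' by (intro Riesz_metric[OF F g(1)]) (simp add: bilinear_def)
  then obtain D where D: "\<And>X Y. g (D X) Y = D' X Y" by metis
  have lD: "linear D"
    by (rule linearI; rule nd) (simp_all add: form_linear D bilinear_ladd[OF bD'] bilinear_lmul[OF bD'])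
  have "D (br X Y) = br (D X) Y + br X (D Y)" for X Y
  proof (rule nd)
    fix Z
    have "g (D (br X Y)) Z = g (D X) (br Y Z) - g (D Y) (br X Z)"
      using D'(1) by (simp add: D dual_derivation_def)
    also have "g (D X) (br Y Z) = g (br (D X) Y) Z" by (simp add: form_br_eq \<omega>_cyclic[of "D X" Y Z])
    also have "g (D Y) (br X Z) = - g (br X (D Y)) Z" by (simp add: form_br[of X "D Y"])
    finally show "g (D (br X Y)) Z = g (br (D X) Y + br X (D Y)) Z" by (simp add: form_linear)
  qed
  then have "lie_derivation br D" using lD by (simp add: lie_derivation_def)
  moreover have "\<phi> = (\<lambda>X. D X + metric_adjoint g D X)"
  proof (intro ext nd)
    fix X Z
    have "g (\<phi> X) Z = D' X Z + D' Z X" using fun_cong[OF fun_cong[OF D'(2)], of X Z] by (simp add: \<Phi>_def dual_transpose_def)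
    also have "\<dots> = g (D X) Z + g (metric_adjoint g D X) Z"
      using metric_adjoint[OF F g(1) lD, of Z X] form_sym[of Z "metric_adjoint g D X"] by (simp add: D)
    finally show "g (\<phi> X) Z = g (D X + metric_adjoint g D X) Z" by (simp add: form_linear)
  qed
  ultimately show "\<exists>D. lie_derivation br D \<and> \<phi> = (\<lambda>X. D X + metric_adjoint g D X)" by blast
qed

theorem proposition7p4:
  fixes br :: "'a::real_vector \<Rightarrow> 'a \<Rightarrow> 'a"
  assumes "lie_algebra br"
    and "\<exists>B::'a set. finite B \<and> span B = UNIV"
    and "dim (UNIV :: 'a set) \<le> 10"
    and "nilpotent_lie br"
  shows "Tstar_solitary br \<and>
    (\<forall>g. metric_form g \<and> ad_invariant_form br g \<longrightarrow> solitary br g)"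
proof -
  obtain S :: "'a set" where S: "fin_dim S" using assms(2) by (auto simp: fin_dim_def)
  have T: "Tstar_solitary br"
    unfolding Tstar_solitary_def
  proof (intro allI impI, elim conjE)
    fix \<phi> :: "'a \<Rightarrow> 'a \<Rightarrow> real"
    assume \<phi>: "bilinear \<phi>" "ad_invariant_form br \<phi>" "\<phi> = dual_transpose \<phi>"
    have "\<phi> X Y = \<phi> Y X" for X Y using fun_cong[OF fun_cong[OF \<phi>(3)], of X Y] by (simp add: dual_transpose_def)
    then interpret nilpotent_form br \<phi> S
      using assms S \<phi> by (simp add: nilpotent_form_def nilpotent_form_axioms_def invariant_form_def invariant_form_axioms_def)
    obtain W \<pi> k x a where R: "reduced_form br \<phi> S W \<pi> k x a" "2 * k + dim W \<le> dim (UNIV :: 'a set)"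
      by (rule reduced_form_exists)
    have "exact \<omega>" using reduced_form.exact_of_dim_le_10[OF R(1)] R(2) assms(3) by simp
    then show "\<exists>D. dual_derivation br D \<and> \<phi> = (\<lambda>X Y. D X Y + dual_transpose D X Y)"
      by (rule exact_imp_dual_derivation)
  qed
  then show ?thesis using Tstar_solitary_imp_solitary[OF assms(1) S T] by blast
qed
end
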